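(* Let $M$ be a half-flat spin $\frac m2$ Grassmann manifold. If $m$ is odd and the vector bundle $E^*\to M$ admits a $\nabla^E$-parallel symplectic form $\omega_E$, then $M$ has canonical $\mathrm{Sp}(E)\cdot\mathrm{Sp}(H)$-invariant metric $g=\omega_E\otimes\omega_H^m$ and $4$-form $\Omega\neq0$. If $\Omega$ is co-closed with respect to the metric $g$, then any $\frac{m-1}{2}$-partially flat connection $\nabla$ in a vector bundle $W$ over $M$ is $(\Omega,\lambda)$-self-dual and hence it is a Yang-Mills connection.
   Context: All objects are holomorphic ($g$ is a complex Riemannian metric). A spin $\frac m2$ Grassmann structure on a complex manifold $M$ is an isomorphism $T^*M\cong E\otimes F$, $F=S^mH$, where $E$, $H$ are holomorphic vector bundles over $M$, $H$ of rank $2$, with a holomorphic connection $\nabla^E$ on $E$ and a holomorphic symplectic connection $\nabla^H$ on $H$ preserving a form $\omega_H\in\Gamma(\wedge^2H)$ (symplectic on the fibres of $H^*$), together with the linear connection $\nabla^E\otimes\mathrm{Id}+\mathrm{Id}\otimes\nabla^F$, where $\nabla^F$ is the connection in $F$ induced by $\nabla^H$. $M$ is half-flat if $\nabla^F$ is flat. A frame $(h_1,h_2)$ of $H^*$ gives the frame $h_A=h_{\alpha_1}\cdots h_{\alpha_m}$ of $S^mH^*$, $A=\alpha_1\ldots\alpha_m$, and $\omega_H^m$ is the bilinear form on $S^mH^*$ given by $\omega_H^m(h_A,h_B)=\sum_{\sigma,\tau}\prod_i\omega_H(h_{\alpha_{\sigma(i)}},h_{\beta_{\tau(i)}})$ (sum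 over all permutations $\sigma,\tau$ of the $\alpha$'s and of the $\beta$'s); it is skew-symmetric for $m$ odd. The canonical $4$-form: let $e_a$ be a basis of $E^*$, $X_{aA}=e_a\otimes h_A$ the corresponding basis of $TM=E^*\otimes S^mH^*$, $X^{aA}$ the dual basis, and $\omega_{ab}$, $\omega_{AB}$ the matrices of $\omega_E$, $\omega_H^m$. Then $\Omega$ denotes $\sum\omega_{ab}\,\omega_{cd}\,\omega_{AC}\,\omega_{BD}\,X^{aA}\wedge X^{bB}\wedge X^{cC}\wedge X^{dD}$. Partial flatness: $\wedge^2T^*M=\wedge^2E\otimes S^2S^mH\oplus S^2E\otimes\wedge^2S^mH$ with $S^2S^mH=\bigoplus_{i\text{ even}}\omega_H^iS^{2m-2i}H$, $\wedge^2S^mH=\bigoplus_{i\text{ odd}}\omega_H^iS^{2m-2i}H$, $0\le i\le m$. Accordingly the curvature of a connection in $W\to M$ has components $\overset{(i)}F$, with values in $\mathrm{End}\,W$, in $\wedge^2E\otimes S^{2m-2i}H$ ($i$ even) and $S^2E\otimes S^{2m-2i}H$ ($i$ odd). The connection is $k$-partially flat if $\overset{(i)}F=0$ for all $i\le2k$. Self-duality: let $*$ be the Hodge operator of $g$. Put $B_\Omega\omega:=*( *\Omega\wedge\omega)$ on $2$-forms, extended to $\mathrm{End}\,W$-valued ones. A connection $\nabla$ with curvature $F^\nabla$ is $(\Omega,\lambda)$-self-dual, where $\lambda\neq0$ is a constant eigenvalue of $B_\Omega$, if $B_\Omega F^\nabla=\lambda F^\nabla$ and $(d*\Omega)\wedge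 F^\nabla=0$; saying it is $(\Omega,\lambda)$-self-dual without specifying $\lambda$ means for some such $\lambda$. $\Omega$ is co-closed if $d*\Omega=0$. $\nabla$ is a Yang-Mills connection if $d^\nabla*F^\nabla=0$, where $d^\nabla$ is the covariant exterior derivative. *)

theory Defs
  imports "HOL-Analysis.Analysis" "HOL-Combinatorics.Permutations"
begin

section \<open>Complex manifolds\<close>

definition hol :: "(complex^'n) set \<Rightarrow> (complex^'n \<Rightarrow> complex) \<Rightarrow> bool" where
  "hol S f \<longleftrightarrow> (\<forall>z\<in>S. f differentiable (at z) \<and>
     (\<forall>c v. frechet_derivative f (at z) (c *s v) = c * frechet_derivative f (at z) v))"

text \<open>The manifold is the whole type \<open>'a\<close>; a chart domain is \<open>U i\<close>, with coordinates
  \<open>\<phi> i\<close>. All local data are written as functions of the coordinate point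
  \<open>z \<in> cdom U \<phi> i\<close>.\<close>

definition cdom :: "('i \<Rightarrow> 'a set) \<Rightarrow> ('i \<Rightarrow> 'a \<Rightarrow> complex^'n) \<Rightarrow> 'i \<Rightarrow> (complex^'n) set" where
  "cdom U \<phi> i = \<phi> i ` U i"

definition overlap :: "('i \<Rightarrow> 'a set) \<Rightarrow> ('i \<Rightarrow> 'a \<Rightarrow> complex^'n) \<Rightarrow> 'i \<Rightarrow> 'i \<Rightarrow> (complex^'n) set" where
  "overlap U \<phi> i j = \<phi> i ` (U i \<inter> U j)"

definition chg :: "('i \<Rightarrow> 'a set) \<Rightarrow> ('i \<Rightarrow> 'a \<Rightarrow> complex^'n) \<Rightarrow> 'i \<Rightarrow> 'i \<Rightarrow> complex^'n \<Rightarrow> complex^'n" where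
  "chg U \<phi> i j = \<phi> j \<circ> inv_into (U i) (\<phi> i)"

definition jac :: "('i \<Rightarrow> 'a set) \<Rightarrow> ('i \<Rightarrow> 'a \<Rightarrow> complex^'n) \<Rightarrow> 'i \<Rightarrow> 'i
    \<Rightarrow> complex^'n \<Rightarrow> complex^'n \<Rightarrow> complex^'n" where
  "jac U \<phi> i j z = frechet_derivative (chg U \<phi> i j) (at z)"

definition complex_manifold ::
  "('i \<Rightarrow> 'a::{t2_space,second_countable_topology} set) \<Rightarrow> ('i \<Rightarrow> 'a \<Rightarrow> complex^'n) \<Rightarrow> bool" where
  "complex_manifold U \<phi> \<longleftrightarrow>
     (\<Union>i. U i) = UNIV \<and>
     (\<forall>i. open (U i) \<and> open (cdom U \<phi> i) \<and>
          homeomorphism (U i) (cdom U \<phi> i) (\<phi> i) (inv_into (U i) (\<phi> i))) \<and>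
     (\<forall>i j k. hol (overlap U \<phi> i j) (\<lambda>z. chg U \<phi> i j z $ k))"

section \<open>Exterior forms on coordinate domains\<close>

text \<open>A \<open>k\<close>-covector is a function on lists of vectors, set to \<open>0\<close> on lists whose
  length is not \<open>k\<close>, so that equality of forms is equality of functions.\<close>

type_synonym 'n covec = "(complex^'n) list \<Rightarrow> complex"
type_synonym 'n form = "complex^'n \<Rightarrow> 'n covec"

definition alt_form :: "nat \<Rightarrow> 'n::finite covec \<Rightarrow> bool" where
  "alt_form k \<alpha> \<longleftrightarrow>
     (\<forall>xs. length xs \<noteq> k \<longrightarrow> \<alpha> xs = 0) \<and>
     (\<forall>xs i c u v. length xs = k \<and> i < k \<longrightarrow>
        \<alpha> (xs[i := c *s u + v]) = c * \<alpha> (xs[i := u]) + \<alpha> (xs[i := v])) \<and>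
     (\<forall>xs i j. length xs = k \<and> i < j \<and> j < k \<and> xs ! i = xs ! j \<longrightarrow> \<alpha> xs = 0)"

definition hol_form :: "nat \<Rightarrow> (complex^'n) set \<Rightarrow> 'n form \<Rightarrow> bool" where
  "hol_form k S \<alpha> \<longleftrightarrow> (\<forall>z\<in>S. alt_form k (\<alpha> z)) \<and> (\<forall>xs. hol S (\<lambda>z. \<alpha> z xs))"

definition wedge :: "nat \<Rightarrow> nat \<Rightarrow> 'n::finite covec \<Rightarrow> 'n covec \<Rightarrow> 'n covec" where
  "wedge k l \<alpha> \<beta> xs =
     (if length xs = k + l then
        (\<Sum>\<sigma> | \<sigma> permutes {..<k + l}. of_int (sign \<sigma>)
            * \<alpha> (map (\<lambda>s. xs ! \<sigma> s) [0..<k]) * \<beta> (map (\<lambda>s. xs ! \<sigma> s) [k..<k + l]))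
          / (fact k * fact l)
      else 0)"

definition ext_d :: "nat \<Rightarrow> 'n::finite form \<Rightarrow> 'n form" where
  "ext_d k \<alpha> z xs =
     (if length xs = Suc k then
        (\<Sum>s<Suc k. (-1) ^ s *
           frechet_derivative (\<lambda>y. \<alpha> y (take s xs @ drop (Suc s) xs)) (at z) (xs ! s))
      else 0)"

definition global_form :: "('i \<Rightarrow> 'a set) \<Rightarrow> ('i \<Rightarrow> 'a \<Rightarrow> complex^'n) \<Rightarrow> nat \<Rightarrow> ('i \<Rightarrow> 'n form) \<Rightarrow> bool" where
  "global_form U \<phi> k \<alpha> \<longleftrightarrow>
     (\<forall>i. hol_form k (cdom U \<phi> i) (\<alpha> i)) \<and>
     (\<forall>i j. \<forall>z\<in>overlap U \<phi> i j. \<forall>xs.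
        \<alpha> i z xs = \<alpha> j (chg U \<phi> i j z) (map (jac U \<phi> i j z) xs))"

section \<open>Holomorphic vector bundles and connections\<close>

text \<open>Matrices of size \<open>r\<close> are functions on pairs of indices, of which only the values
  at indices \<open>< r\<close> are used. A bundle of rank \<open>r\<close>, trivialised over the charts by frames
  \<open>v\<^sup>i\<close>, is given by its transition matrices \<open>v\<^sup>j\<^sub>b = \<Sum>a. t i j z a b * v\<^sup>i\<^sub>a\<close> with \<open>z\<close> the
  coordinates in chart \<open>i\<close>. Finitely many bundles over a complex manifold
  can always be trivialised over the charts of one common atlas.\<close>

type_synonym cmat = "nat \<Rightarrow> nat \<Rightarrow> complex"
type_synonym ('i, 'n) cocycle = "'i \<Rightarrow> 'i \<Rightarrow> complex^'n \<Rightarrow> cmat"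

definition vec_bundle :: "('i \<Rightarrow> 'a set) \<Rightarrow> ('i \<Rightarrow> 'a \<Rightarrow> complex^'n) \<Rightarrow> nat \<Rightarrow> ('i, 'n) cocycle \<Rightarrow> bool" where
  "vec_bundle U \<phi> r t \<longleftrightarrow>
     (\<forall>i j. \<forall>a<r. \<forall>b<r. hol (overlap U \<phi> i j) (\<lambda>z. t i j z a b)) \<and>
     (\<forall>i. \<forall>z\<in>cdom U \<phi> i. \<forall>a<r. \<forall>b<r. t i i z a b = (if a = b then 1 else 0)) \<and>
     (\<forall>i j k. \<forall>z\<in>\<phi> i ` (U i \<inter> U j \<inter> U k). \<forall>a<r. \<forall>b<r.
        t i k z a b = (\<Sum>c<r. t i j z a c * t j k (chg U \<phi> i j z) c b))"

text \<open>The transition matrices of the dual frames are the inverse transposes; the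
  inverse of \<open>t i j z\<close> is \<open>t j i\<close> at the same point of the manifold.\<close>

definition dual_cocycle :: "('i \<Rightarrow> 'a set) \<Rightarrow> ('i \<Rightarrow> 'a \<Rightarrow> complex^'n) \<Rightarrow> ('i, 'n) cocycle \<Rightarrow> ('i, 'n) cocycle" where
  "dual_cocycle U \<phi> t i j z a b = t j i (chg U \<phi> i j z) b a"

text \<open>Matrix-valued forms are matrices of forms. A connection is given by its local
  connection forms, \<open>\<nabla> v\<^sup>i\<^sub>b = \<Sum>a. A i a b \<otimes> v\<^sup>i\<^sub>a\<close>; the second clause says that
  \<open>t * A\<^sup>j = A\<^sup>i * t + dt\<close>.\<close>

type_synonym ('i, 'n) mform = "'i \<Rightarrow> nat \<Rightarrow> nat \<Rightarrow> 'n form"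

definition connection :: "('i \<Rightarrow> 'a set) \<Rightarrow> ('i \<Rightarrow> 'a \<Rightarrow> complex^'n) \<Rightarrow> nat \<Rightarrow> ('i, 'n) cocycle
    \<Rightarrow> ('i, 'n) mform \<Rightarrow> bool" where
  "connection U \<phi> r t A \<longleftrightarrow>
     (\<forall>i. \<forall>a<r. \<forall>b<r. hol_form 1 (cdom U \<phi> i) (A i a b)) \<and>
     (\<forall>i j. \<forall>z\<in>overlap U \<phi> i j. \<forall>v. \<forall>a<r. \<forall>b<r.
        (\<Sum>c<r. t i j z a c * A j c b (chg U \<phi> i j z) [jac U \<phi> i j z v]) =
        (\<Sum>c<r. A i a c z [v] * t i j z c b) + frechet_derivative (\<lambda>y. t i j y a b) (at z) v)"

definition dual_conn :: "('i, 'n::finite) mform \<Rightarrow> ('i, 'n) mform" where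
  "dual_conn A i a b = (\<lambda>z xs. - A i b a z xs)"

definition curvature :: "nat \<Rightarrow> ('i, 'n::finite) mform \<Rightarrow> ('i, 'n) mform" where
  "curvature r A i a b = (\<lambda>z xs. ext_d 1 (A i a b) z xs +
     (\<Sum>c<r. wedge 1 1 (A i a c z) (A i c b z) xs))"

definition flat :: "('i \<Rightarrow> 'a set) \<Rightarrow> ('i \<Rightarrow> 'a \<Rightarrow> complex^'n) \<Rightarrow> nat \<Rightarrow> ('i, 'n) mform \<Rightarrow> bool" where
  "flat U \<phi> r A \<longleftrightarrow>
     (\<forall>i. \<forall>z\<in>cdom U \<phi> i. \<forall>a<r. \<forall>b<r. \<forall>xs. curvature r A i a b z xs = 0)"

text \<open>The covariant exterior derivative of an endomorphism-valued \<open>k\<close>-form: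
  \<open>d \<psi> + A \<and> \<psi> - (-1)\<^sup>k \<psi> \<and> A\<close>.\<close>

definition cov_ext_d :: "nat \<Rightarrow> ('i, 'n::finite) mform \<Rightarrow> 'i \<Rightarrow> nat \<Rightarrow> (nat \<Rightarrow> nat \<Rightarrow> 'n form)
    \<Rightarrow> nat \<Rightarrow> nat \<Rightarrow> 'n form" where
  "cov_ext_d r A i k \<psi> a b = (\<lambda>z xs. ext_d k (\<psi> a b) z xs +
     (\<Sum>c<r. wedge 1 k (A i a c z) (\<psi> c b z) xs
            - (-1) ^ k * wedge k 1 (\<psi> a c z) (A i c b z) xs))"

text \<open>Symplectic forms on a bundle with cocycle \<open>t\<close>, by their matrices in the local frames.\<close>

definition symplectic_mat :: "nat \<Rightarrow> cmat \<Rightarrow> bool" where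
  "symplectic_mat r \<omega> \<longleftrightarrow> (\<forall>a<r. \<forall>b<r. \<omega> b a = - \<omega> a b) \<and>
     (\<forall>x. (\<forall>b<r. (\<Sum>a<r. x a * \<omega> a b) = 0) \<longrightarrow> (\<forall>a<r. x a = 0))"

definition symplectic_form :: "('i \<Rightarrow> 'a set) \<Rightarrow> ('i \<Rightarrow> 'a \<Rightarrow> complex^'n) \<Rightarrow> nat \<Rightarrow> ('i, 'n) cocycle
    \<Rightarrow> ('i \<Rightarrow> complex^'n \<Rightarrow> cmat) \<Rightarrow> bool" where
  "symplectic_form U \<phi> r t \<omega> \<longleftrightarrow>
     (\<forall>i. \<forall>a<r. \<forall>b<r. hol (cdom U \<phi> i) (\<lambda>z. \<omega> i z a b)) \<and>
     (\<forall>i. \<forall>z\<in>cdom U \<phi> i. symplectic_mat r (\<omega> i z)) \<and>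
     (\<forall>i j. \<forall>z\<in>overlap U \<phi> i j. \<forall>a<r. \<forall>b<r.
        \<omega> j (chg U \<phi> i j z) a b =
        (\<Sum>c<r. \<Sum>d<r. t i j z c a * t i j z d b * \<omega> i z c d))"

definition parallel_form :: "('i \<Rightarrow> 'a set) \<Rightarrow> ('i \<Rightarrow> 'a \<Rightarrow> complex^'n) \<Rightarrow> nat
    \<Rightarrow> ('i, 'n) mform \<Rightarrow> ('i \<Rightarrow> complex^'n \<Rightarrow> cmat) \<Rightarrow> bool" where
  "parallel_form U \<phi> r A \<omega> \<longleftrightarrow>
     (\<forall>i. \<forall>z\<in>cdom U \<phi> i. \<forall>v. \<forall>a<r. \<forall>b<r.
        frechet_derivative (\<lambda>y. \<omega> i y a b) (at z) v =
        (\<Sum>c<r. A i c a z [v] * \<omega> i z c b + A i c b z [v] * \<omega> i z a c))"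

section \<open>Symmetric powers of a rank two bundle\<close>

text \<open>Frames of rank two bundles are indexed by \<open>0, 1\<close>. The monomial
  \<open>h\<^sub>0\<^bsup>m-j\<^esup> h\<^sub>1\<^bsup>j\<^esup>\<close> of the frame of the \<open>m\<close>-th symmetric power has index \<open>j \<le> m\<close>
  and multi-index \<open>word m j\<close>.\<close>

definition word :: "nat \<Rightarrow> nat \<Rightarrow> nat list" where
  "word m j = replicate (m - j) 0 @ replicate j 1"

text \<open>The coefficient of the monomial \<open>k\<close> in the image of the monomial \<open>j\<close>, under the
  automorphism, resp. derivation, of the symmetric algebra that extends the matrix \<open>t\<close>.\<close>

definition sym_pow :: "nat \<Rightarrow> cmat \<Rightarrow> cmat" where
  "sym_pow m t k j =
     (\<Sum>\<beta> | length \<beta> = m \<and> set \<beta> \<subseteq> {0, 1} \<and> sum_list \<beta> = k. \<Prod>l<m. t (\<beta> ! l) (word m j ! l))"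

definition sym_der :: "nat \<Rightarrow> cmat \<Rightarrow> cmat" where
  "sym_der m t k j =
     (\<Sum>l<m. \<Sum>\<gamma><2. if sum_list ((word m j)[l := \<gamma>]) = k then t \<gamma> (word m j ! l) else 0)"

definition sym_conn :: "nat \<Rightarrow> ('i, 'n::finite) mform \<Rightarrow> ('i, 'n) mform" where
  "sym_conn m A i k j = (\<lambda>z xs. sym_der m (\<lambda>a b. A i a b z xs) k j)"

text \<open>An element \<open>P\<close> of the symmetric power of degree \<open>2 m - 2 i\<close> of \<open>H\<close> is a symmetric
  multilinear form on the dual of \<open>H\<close>; its value on frame vectors depends only on the
  number of arguments equal to \<open>h\<^sub>1\<close>, and that value is \<open>p n\<close> when the number is \<open>n\<close>. Then
  \<open>omega_mult m i \<omega> p\<close> is the matrix of \<open>\<omega>\<^sup>i P\<close>, seen as a bilinear form on the \<open>m\<close>-th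
  symmetric power of the dual of \<open>H\<close>: \<open>i\<close> pairs of arguments are contracted with
  \<open>\<omega>\<close>, the remaining ones are inserted in \<open>P\<close>.\<close>

definition omega_mult :: "nat \<Rightarrow> nat \<Rightarrow> cmat \<Rightarrow> (nat \<Rightarrow> complex) \<Rightarrow> cmat" where
  "omega_mult m i \<omega> p j k =
     (\<Sum>\<sigma> | \<sigma> permutes {..<m}. \<Sum>\<tau> | \<tau> permutes {..<m}.
        (\<Prod>l<i. \<omega> (word m j ! \<sigma> l) (word m k ! \<tau> l)) *
        p (\<Sum>l=i..<m. word m j ! \<sigma> l + word m k ! \<tau> l))"

definition omega_pow :: "nat \<Rightarrow> cmat \<Rightarrow> cmat" where
  "omega_pow m \<omega> j k =
     (\<Sum>\<sigma> | \<sigma> permutes {..<m}. \<Sum>\<tau> | \<tau> permutes {..<m}.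
        \<Prod>l<m. \<omega> (word m j ! \<sigma> l) (word m k ! \<tau> l))"

section \<open>Spin Grassmann structures\<close>

text \<open>The isomorphism between the cotangent bundle and \<open>E \<otimes> F\<close>, equivalently between the
  tangent bundle and \<open>E\<^sup>* \<otimes> S\<^sup>m H\<^sup>*\<close>, is given by the vector fields \<open>X i a j\<close> that
  correspond to the frame \<open>e\<^sub>a \<otimes> h\<^sub>j\<close> and by the dual coframe \<open>\<theta> i a j\<close>, the image of
  the frame of \<open>E \<otimes> F\<close> dual to \<open>e\<^sub>a \<otimes> h\<^sub>j\<close>.\<close>

definition soldering :: "('i \<Rightarrow> 'a set) \<Rightarrow> ('i \<Rightarrow> 'a \<Rightarrow> complex^'n) \<Rightarrow> nat \<Rightarrow> nat
    \<Rightarrow> ('i, 'n) cocycle \<Rightarrow> ('i, 'n) cocycle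
    \<Rightarrow> ('i \<Rightarrow> nat \<Rightarrow> nat \<Rightarrow> complex^'n \<Rightarrow> complex^'n) \<Rightarrow> ('i, 'n) mform \<Rightarrow> bool" where
  "soldering U \<phi> m r tE tH X \<theta> \<longleftrightarrow>
     (\<forall>i. \<forall>a<r. \<forall>j\<le>m. (\<forall>k. hol (cdom U \<phi> i) (\<lambda>z. X i a j z $ k)) \<and>
        hol_form 1 (cdom U \<phi> i) (\<theta> i a j)) \<and>
     (\<forall>i. \<forall>z\<in>cdom U \<phi> i.
        (\<forall>a<r. \<forall>j\<le>m. \<forall>b<r. \<forall>k\<le>m.
           \<theta> i a j z [X i b k z] = (if a = b \<and> j = k then 1 else 0)) \<and>
        (\<forall>v. (\<Sum>a<r. \<Sum>j\<le>m. \<theta> i a j z [v] *s X i a j z) = v)) \<and>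
     (\<forall>i i'. \<forall>z\<in>overlap U \<phi> i i'. \<forall>b<r. \<forall>k\<le>m.
        X i' b k (chg U \<phi> i i' z) =
        (\<Sum>a<r. \<Sum>j\<le>m. (dual_cocycle U \<phi> tE i i' z a b *
             sym_pow m (dual_cocycle U \<phi> tH i i' z) j k) *s
           jac U \<phi> i i' z (X i a j z)))"

text \<open>The linear connection of the manifold is determined by \<open>CE\<close> and \<open>CH\<close>, hence is not
  a separate datum.\<close>

definition spin_grassmann :: "('i \<Rightarrow> 'a::{t2_space,second_countable_topology} set)
    \<Rightarrow> ('i \<Rightarrow> 'a \<Rightarrow> complex^'n) \<Rightarrow> nat \<Rightarrow> nat
    \<Rightarrow> ('i, 'n) cocycle \<Rightarrow> ('i, 'n) mform \<Rightarrow> ('i, 'n) cocycle \<Rightarrow> ('i, 'n) mform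
    \<Rightarrow> ('i \<Rightarrow> complex^'n \<Rightarrow> cmat)
    \<Rightarrow> ('i \<Rightarrow> nat \<Rightarrow> nat \<Rightarrow> complex^'n \<Rightarrow> complex^'n) \<Rightarrow> ('i, 'n) mform \<Rightarrow> bool" where
  "spin_grassmann U \<phi> m r tE CE tH CH \<omega>H X \<theta> \<longleftrightarrow>
     complex_manifold U \<phi> \<and>
     vec_bundle U \<phi> r tE \<and> connection U \<phi> r tE CE \<and>
     vec_bundle U \<phi> 2 tH \<and> connection U \<phi> 2 tH CH \<and>
     symplectic_form U \<phi> 2 (dual_cocycle U \<phi> tH) \<omega>H \<and>
     parallel_form U \<phi> 2 (dual_conn CH) \<omega>H \<and>
     soldering U \<phi> m r tE tH X \<theta>"

definition half_flat :: "('i \<Rightarrow> 'a set) \<Rightarrow> ('i \<Rightarrow> 'a \<Rightarrow> complex^'n) \<Rightarrow> nat \<Rightarrow> ('i, 'n) mform \<Rightarrow> bool" where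
  "half_flat U \<phi> m CH \<longleftrightarrow> flat U \<phi> (Suc m) (sym_conn m CH)"

definition gr_metric :: "nat \<Rightarrow> nat \<Rightarrow> ('i \<Rightarrow> complex^'n \<Rightarrow> cmat) \<Rightarrow> ('i \<Rightarrow> complex^'n \<Rightarrow> cmat)
    \<Rightarrow> ('i, 'n) mform \<Rightarrow> 'i \<Rightarrow> complex^'n \<Rightarrow> complex^'n \<Rightarrow> complex^'n \<Rightarrow> complex" where
  "gr_metric m r \<omega>E \<omega>H \<theta> i z u v =
     (\<Sum>a<r. \<Sum>b<r. \<Sum>j\<le>m. \<Sum>k\<le>m.
        \<omega>E i z a b * omega_pow m (\<omega>H i z) j k * \<theta> i a j z [u] * \<theta> i b k z [v])"

definition gr_form :: "nat \<Rightarrow> nat \<Rightarrow> ('i \<Rightarrow> complex^'n \<Rightarrow> cmat) \<Rightarrow> ('i \<Rightarrow> complex^'n \<Rightarrow> cmat)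
    \<Rightarrow> ('i, 'n) mform \<Rightarrow> 'i \<Rightarrow> 'n form" where
  "gr_form m r \<omega>E \<omega>H \<theta> i z xs =
     (\<Sum>a<r. \<Sum>b<r. \<Sum>c<r. \<Sum>d<r. \<Sum>A\<le>m. \<Sum>B\<le>m. \<Sum>C\<le>m. \<Sum>D\<le>m.
        \<omega>E i z a b * \<omega>E i z c d * omega_pow m (\<omega>H i z) A C * omega_pow m (\<omega>H i z) B D *
        wedge 1 3 (\<theta> i a A z) (wedge 1 2 (\<theta> i b B z) (wedge 1 1 (\<theta> i c C z) (\<theta> i d D z))) xs)"

definition hol_metric :: "('i \<Rightarrow> 'a set) \<Rightarrow> ('i \<Rightarrow> 'a \<Rightarrow> complex^'n)
    \<Rightarrow> ('i \<Rightarrow> complex^'n \<Rightarrow> complex^'n \<Rightarrow> complex^'n \<Rightarrow> complex) \<Rightarrow> bool" where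
  "hol_metric U \<phi> g \<longleftrightarrow>
     (\<forall>i. \<forall>z\<in>cdom U \<phi> i.
        (\<forall>c u v w. g i z (c *s u + v) w = c * g i z u w + g i z v w) \<and>
        (\<forall>u v. g i z u v = g i z v u) \<and>
        (\<forall>u. (\<forall>v. g i z u v = 0) \<longrightarrow> u = 0)) \<and>
     (\<forall>i u v. hol (cdom U \<phi> i) (\<lambda>z. g i z u v)) \<and>
     (\<forall>i j. \<forall>z\<in>overlap U \<phi> i j. \<forall>u v.
        g i z u v = g j (chg U \<phi> i j z) (jac U \<phi> i j z u) (jac U \<phi> i j z v))"

text \<open>Invariance under all pairs of a symplectic automorphism \<open>S\<close> of the fibre of the dual of
  \<open>E\<close> and a symplectic automorphism \<open>T\<close> of the fibre of the dual of \<open>H\<close>, acting on tangent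
  vectors by \<open>gr_act\<close>.\<close>

definition sp_mat :: "nat \<Rightarrow> cmat \<Rightarrow> cmat \<Rightarrow> bool" where
  "sp_mat r \<omega> S \<longleftrightarrow>
     (\<forall>a<r. \<forall>b<r. (\<Sum>c<r. \<Sum>d<r. S c a * S d b * \<omega> c d) = \<omega> a b)"

definition gr_act :: "nat \<Rightarrow> nat \<Rightarrow> ('i \<Rightarrow> nat \<Rightarrow> nat \<Rightarrow> complex^'n \<Rightarrow> complex^'n) \<Rightarrow> ('i, 'n) mform
    \<Rightarrow> cmat \<Rightarrow> cmat \<Rightarrow> 'i \<Rightarrow> complex^'n \<Rightarrow> complex^'n \<Rightarrow> complex^'n" where
  "gr_act m r X \<theta> S T i z v =
     (\<Sum>a<r. \<Sum>b<r. \<Sum>j\<le>m. \<Sum>k\<le>m.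
        (S b a * sym_pow m T k j * \<theta> i a j z [v]) *s X i b k z)"

definition sp_invariant_metric :: "('i \<Rightarrow> 'a set) \<Rightarrow> ('i \<Rightarrow> 'a \<Rightarrow> complex^'n) \<Rightarrow> nat \<Rightarrow> nat
    \<Rightarrow> ('i \<Rightarrow> complex^'n \<Rightarrow> cmat) \<Rightarrow> ('i \<Rightarrow> complex^'n \<Rightarrow> cmat)
    \<Rightarrow> ('i \<Rightarrow> nat \<Rightarrow> nat \<Rightarrow> complex^'n \<Rightarrow> complex^'n) \<Rightarrow> ('i, 'n) mform
    \<Rightarrow> ('i \<Rightarrow> complex^'n \<Rightarrow> complex^'n \<Rightarrow> complex^'n \<Rightarrow> complex) \<Rightarrow> bool" where
  "sp_invariant_metric U \<phi> m r \<omega>E \<omega>H X \<theta> g \<longleftrightarrow>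
     (\<forall>i. \<forall>z\<in>cdom U \<phi> i. \<forall>S T. sp_mat r (\<omega>E i z) S \<and> sp_mat 2 (\<omega>H i z) T \<longrightarrow>
        (\<forall>u v. g i z (gr_act m r X \<theta> S T i z u) (gr_act m r X \<theta> S T i z v) = g i z u v))"

definition sp_invariant_form :: "('i \<Rightarrow> 'a set) \<Rightarrow> ('i \<Rightarrow> 'a \<Rightarrow> complex^'n) \<Rightarrow> nat \<Rightarrow> nat
    \<Rightarrow> ('i \<Rightarrow> complex^'n \<Rightarrow> cmat) \<Rightarrow> ('i \<Rightarrow> complex^'n \<Rightarrow> cmat)
    \<Rightarrow> ('i \<Rightarrow> nat \<Rightarrow> nat \<Rightarrow> complex^'n \<Rightarrow> complex^'n) \<Rightarrow> ('i, 'n) mform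
    \<Rightarrow> ('i \<Rightarrow> 'n form) \<Rightarrow> bool" where
  "sp_invariant_form U \<phi> m r \<omega>E \<omega>H X \<theta> \<alpha> \<longleftrightarrow>
     (\<forall>i. \<forall>z\<in>cdom U \<phi> i. \<forall>S T. sp_mat r (\<omega>E i z) S \<and> sp_mat 2 (\<omega>H i z) T \<longrightarrow>
        (\<forall>xs. \<alpha> i z (map (gr_act m r X \<theta> S T i z) xs) = \<alpha> i z xs))"

section \<open>Partially flat connections\<close>

text \<open>\<open>q l s t a b\<close> is the component of degree \<open>l\<close> of the \<open>(s, t)\<close> entry of the curvature at
  a point, an element of \<open>S\<^bsup>2m-2l\<^esup> H\<close> for each \<open>a\<close>, \<open>b\<close>, encoded as in \<open>omega_mult\<close>, and
  skew or symmetric in \<open>a\<close>, \<open>b\<close> according to the parity of \<open>l\<close>. As the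
  sum of these components is direct, \<open>q\<close> is determined by the curvature for \<open>l \<le> m\<close>
  and arguments \<open>\<le> 2 m - 2 l\<close>.\<close>

definition curv_components :: "nat \<Rightarrow> nat \<Rightarrow> nat \<Rightarrow> cmat \<Rightarrow> (nat \<Rightarrow> nat \<Rightarrow> complex^'n)
    \<Rightarrow> (nat \<Rightarrow> nat \<Rightarrow> 'n covec)
    \<Rightarrow> (nat \<Rightarrow> nat \<Rightarrow> nat \<Rightarrow> nat \<Rightarrow> nat \<Rightarrow> nat \<Rightarrow> complex) \<Rightarrow> bool" where
  "curv_components m r w \<omega> Xz Fz q \<longleftrightarrow>
     (\<forall>s<w. \<forall>t<w. \<forall>a<r. \<forall>b<r.
        (\<forall>l\<le>m. \<forall>n\<le>2 * m - 2 * l. q l s t b a n = (if even l then - q l s t a b n else q l s t a b n)) \<and>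
        (\<forall>j\<le>m. \<forall>k\<le>m. Fz s t [Xz a j, Xz b k] = (\<Sum>l\<le>m. omega_mult m l \<omega> (q l s t a b) j k)))"

definition partially_flat :: "('i \<Rightarrow> 'a set) \<Rightarrow> ('i \<Rightarrow> 'a \<Rightarrow> complex^'n) \<Rightarrow> nat \<Rightarrow> nat
    \<Rightarrow> ('i \<Rightarrow> complex^'n \<Rightarrow> cmat) \<Rightarrow> ('i \<Rightarrow> nat \<Rightarrow> nat \<Rightarrow> complex^'n \<Rightarrow> complex^'n)
    \<Rightarrow> nat \<Rightarrow> nat \<Rightarrow> ('i, 'n) mform \<Rightarrow> bool" where
  "partially_flat U \<phi> m r \<omega>H X k w A \<longleftrightarrow>
     (\<forall>i. \<forall>z\<in>cdom U \<phi> i. \<exists>q.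
        curv_components m r w (\<omega>H i z) (\<lambda>a j. X i a j z) (\<lambda>s t. curvature w A i s t z) q \<and>
        (\<forall>l\<le>m. l \<le> 2 * k \<longrightarrow>
           (\<forall>s<w. \<forall>t<w. \<forall>a<r. \<forall>b<r. \<forall>n\<le>2 * m - 2 * l. q l s t a b n = 0)))"

section \<open>Hodge operator, self-duality, Yang-Mills\<close>

definition gram :: "(complex^'n \<Rightarrow> complex^'n \<Rightarrow> complex) \<Rightarrow> complex^'n^'n" where
  "gram g = (\<chi> k l. g (axis k 1) (axis l 1))"

text \<open>The Hodge operator of a metric \<open>g\<close> on \<open>k\<close>-covectors,
  \<open>(*\<beta>)\<^bsub>J\<^esub> = 1/k! \<beta>\<^bsup>I\<^esup> vol\<^bsub>IJ\<^esub>\<close>, relative to a volume element \<open>vol\<close>.\<close>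

definition hodge :: "(complex^'n \<Rightarrow> complex^'n \<Rightarrow> complex) \<Rightarrow> 'n covec \<Rightarrow> nat \<Rightarrow> 'n covec \<Rightarrow> 'n covec" where
  "hodge g vol k \<beta> xs =
     (if length xs = CARD('n) - k then
        (\<Sum>I | length I = k. \<Sum>J | length J = k.
           (\<Prod>l<k. matrix_inv (gram g) $ (I ! l) $ (J ! l)) *
           \<beta> (map (\<lambda>s. axis s 1) I) * vol (map (\<lambda>s. axis s 1) J @ xs)) / fact k
      else 0)"

text \<open>The volume element of a complex metric is a square root of the determinant, hence unique
  only up to sign on connected sets. The Hodge operator is therefore formed relative to
  local volume forms \<open>vol\<close> on open subsets \<open>V\<close> of the charts, which exist near every point;
  the conditions below are local and do not change when \<open>vol\<close> changes sign.\<close>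

definition unit_volume :: "('i \<Rightarrow> 'a set) \<Rightarrow> ('i \<Rightarrow> 'a \<Rightarrow> complex^'n)
    \<Rightarrow> ('i \<Rightarrow> complex^'n \<Rightarrow> complex^'n \<Rightarrow> complex^'n \<Rightarrow> complex)
    \<Rightarrow> 'i \<Rightarrow> (complex^'n) set \<Rightarrow> 'n form \<Rightarrow> bool" where
  "unit_volume U \<phi> g i V vol \<longleftrightarrow>
     open V \<and> V \<subseteq> cdom U \<phi> i \<and> hol_form CARD('n) V vol \<and>
     (\<forall>z\<in>V. \<forall>I. distinct I \<and> set I = UNIV \<longrightarrow>
        (vol z (map (\<lambda>s. axis s 1) I))\<^sup>2 = det (gram (g i z)))"

definition co_closed :: "('i \<Rightarrow> 'a set) \<Rightarrow> ('i \<Rightarrow> 'a \<Rightarrow> complex^'n)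
    \<Rightarrow> ('i \<Rightarrow> complex^'n \<Rightarrow> complex^'n \<Rightarrow> complex^'n \<Rightarrow> complex) \<Rightarrow> nat \<Rightarrow> ('i \<Rightarrow> 'n form) \<Rightarrow> bool" where
  "co_closed U \<phi> g k \<alpha> \<longleftrightarrow>
     (\<forall>i V vol. unit_volume U \<phi> g i V vol \<longrightarrow>
        (\<forall>z\<in>V. \<forall>xs. ext_d (CARD('n) - k) (\<lambda>y. hodge (g i y) (vol y) k (\<alpha> i y)) z xs = 0))"

definition B_op :: "(complex^'n \<Rightarrow> complex^'n \<Rightarrow> complex) \<Rightarrow> 'n covec \<Rightarrow> 'n covec \<Rightarrow> 'n covec \<Rightarrow> 'n covec" where
  "B_op g vol \<Omega> \<beta> = hodge g vol (CARD('n) - 4 + 2) (wedge (CARD('n) - 4) 2 (hodge g vol 4 \<Omega>) \<beta>)"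

definition B_eigenvalue :: "('i \<Rightarrow> 'a set) \<Rightarrow> ('i \<Rightarrow> 'a \<Rightarrow> complex^'n)
    \<Rightarrow> ('i \<Rightarrow> complex^'n \<Rightarrow> complex^'n \<Rightarrow> complex^'n \<Rightarrow> complex) \<Rightarrow> ('i \<Rightarrow> 'n form) \<Rightarrow> complex \<Rightarrow> bool" where
  "B_eigenvalue U \<phi> g \<Omega> \<mu> \<longleftrightarrow>
     (\<forall>i V vol. unit_volume U \<phi> g i V vol \<longrightarrow>
        (\<forall>z\<in>V. \<exists>\<beta>. alt_form 2 \<beta> \<and> \<beta> \<noteq> (\<lambda>_. 0) \<and>
           B_op (g i z) (vol z) (\<Omega> i z) \<beta> = (\<lambda>xs. \<mu> * \<beta> xs)))"

definition self_dual :: "('i \<Rightarrow> 'a set) \<Rightarrow> ('i \<Rightarrow> 'a \<Rightarrow> complex^'n)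
    \<Rightarrow> ('i \<Rightarrow> complex^'n \<Rightarrow> complex^'n \<Rightarrow> complex^'n \<Rightarrow> complex) \<Rightarrow> ('i \<Rightarrow> 'n form) \<Rightarrow> complex
    \<Rightarrow> nat \<Rightarrow> ('i, 'n) mform \<Rightarrow> bool" where
  "self_dual U \<phi> g \<Omega> \<mu> w A \<longleftrightarrow>
     \<mu> \<noteq> 0 \<and> B_eigenvalue U \<phi> g \<Omega> \<mu> \<and>
     (\<forall>i V vol. unit_volume U \<phi> g i V vol \<longrightarrow>
        (\<forall>z\<in>V. \<forall>s<w. \<forall>t<w. \<forall>xs.
           B_op (g i z) (vol z) (\<Omega> i z) (curvature w A i s t z) xs = \<mu> * curvature w A i s t z xs \<and>
           wedge (Suc (CARD('n) - 4)) 2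
             (ext_d (CARD('n) - 4) (\<lambda>y. hodge (g i y) (vol y) 4 (\<Omega> i y)) z)
             (curvature w A i s t z) xs = 0))"

definition yang_mills :: "('i \<Rightarrow> 'a set) \<Rightarrow> ('i \<Rightarrow> 'a \<Rightarrow> complex^'n)
    \<Rightarrow> ('i \<Rightarrow> complex^'n \<Rightarrow> complex^'n \<Rightarrow> complex^'n \<Rightarrow> complex) \<Rightarrow> nat \<Rightarrow> ('i, 'n) mform \<Rightarrow> bool" where
  "yang_mills U \<phi> g w A \<longleftrightarrow>
     (\<forall>i V vol. unit_volume U \<phi> g i V vol \<longrightarrow>
        (\<forall>z\<in>V. \<forall>s<w. \<forall>t<w. \<forall>xs.
           cov_ext_d w A i (CARD('n) - 2)
             (\<lambda>a b y. hodge (g i y) (vol y) 2 (curvature w A i a b y)) s t z xs = 0))"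

end

theory Submission
  imports Defs "HOL-Complex_Analysis.Cauchy_Integral_Formula"
begin

text \<open>
  For \<open>s = 1, 2, 3\<close> let \<open>e\<^sub>s\<close> and \<open>f\<^sub>s\<close> be the products of the values of \<open>\<omega>\<^sub>E\<close> and \<open>\<omega>\<^sub>H\<^sup>m\<close> on the pairs
  of the matchings \<open>12|34\<close>, \<open>13|24\<close>, \<open>14|23\<close> of four arguments. Both forms are skew, so
  \<open>\<Omega> = 4 (e\<^sub>1 f\<^sub>2 + e\<^sub>1 f\<^sub>3 - e\<^sub>2 f\<^sub>1 - e\<^sub>3 f\<^sub>1 + e\<^sub>2 f\<^sub>3 - e\<^sub>3 f\<^sub>2)\<close>. Contracting two arguments with the metric dual
  of a two-form \<open>\<beta> = q \<otimes> \<omega>\<^sub>H\<^sup>m\<close>, \<open>q\<close> symmetric, kills \<open>e\<^sub>1\<close> and gives \<open>8 (m + 2) \<beta>\<close>. Since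
  \<open>*\<Omega> \<and> \<theta> \<and> \<eta>\<close> is minus the Hodge dual of a contraction of \<open>\<Omega>\<close>, this means
  \<open>*\<Omega> \<and> \<beta> = -4 (m + 2) *\<beta>\<close>; as the dimension \<open>r (m + 1)\<close> is even, \<open>**\<beta> = \<beta>\<close>, and \<open>\<beta>\<close> is an
  eigenvector of \<open>B\<^sub>\<Omega>\<close> with eigenvalue \<open>-4 (m + 2)\<close>. The curvature \<open>F\<close> of a \<open>(m - 1) / 2\<close>-partially
  flat connection has only the component of top degree \<open>m\<close>, which is of this shape. Finally \<open>*F\<close>
  is a constant multiple of \<open>*\<Omega> \<and> F\<close>, and the covariant derivative of the latter is
  \<open>d*\<Omega> \<and> F + *\<Omega> \<and> d\<^sup>\<nabla>F = 0\<close> by co-closedness and the Bianchi identity.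
\<close>

section \<open>Holomorphic functions of several variables\<close>

text \<open>Three points shape the work. The predicate \<open>hol\<close> only demands complex
  differentiability at each point, while the Bianchi identity needs d d = 0, hence second
  derivatives and their symmetry; both come from Cauchy's formula on complex lines. The link between
  wedging with the Hodge dual of \<Omega> and contracting \<Omega> rests on the vanishing of all
  forms above the top degree. Finally, \<Omega> is evaluated only on decomposable vectors, to which
  the metric duals of the coframe belong because the metric is a tensor product; there the E and F
  indices separate. In 8 (m + 2) = 4 (2 (m + 1) + 2) the rank m + 1 of F enters as the trace of f
  against its inverse, once for each of the two terms e_2 f_1 and e_3 f_1; the last 2 comes from e_2
  f_3 - e_3 f_2. Partial flatness with 2 k = m - 1 leaves just the degree m because m is odd. Square
  roots of the determinant of the metric exist only locally, so everything involving the Hodge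
  operator is done for one local volume form at a time.\<close>

lemma hol_has_derivative:
  "hol S f \<Longrightarrow> z \<in> S \<Longrightarrow> (f has_derivative frechet_derivative f (at z)) (at z)"
  unfolding hol_def using frechet_derivative_works by blast

lemma hol_linear:
  "hol S f \<Longrightarrow> z \<in> S \<Longrightarrow> frechet_derivative f (at z) (c *s v) = c * frechet_derivative f (at z) v"
  unfolding hol_def by blast

lemma hol_bounded_linear: "hol S f \<Longrightarrow> z \<in> S \<Longrightarrow> bounded_linear (frechet_derivative f (at z))"
  using hol_has_derivative has_derivative_bounded_linear by blast

lemma holI:
  assumes "\<And>z. z \<in> S \<Longrightarrow> (f has_derivative D z) (at z)"
    and "\<And>z c v. z \<in> S \<Longrightarrow> D z (c *s v) = c * D z v"
  shows "hol S f"
  unfolding hol_def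
proof (intro ballI conjI allI)
  fix z c v assume z: "z \<in> S"
  show "f differentiable (at z)" using assms(1)[OF z] differentiable_def by blast
  show "frechet_derivative f (at z) (c *s v) = c * frechet_derivative f (at z) v"
    using assms(2)[OF z] frechet_derivative_at[OF assms(1)[OF z]] by metis
qed

lemma hol_subset: "hol S f \<Longrightarrow> T \<subseteq> S \<Longrightarrow> hol T f"
  unfolding hol_def by blast

lemma hol_continuous_on: "hol S f \<Longrightarrow> continuous_on S f"
  by (rule continuous_at_imp_continuous_on) (blast intro: has_derivative_continuous hol_has_derivative)

lemma hol_const: "hol S (\<lambda>z. c)"
  by (rule holI[where D = "\<lambda>_ _. 0"]) auto

lemma hol_add: "hol S f \<Longrightarrow> hol S g \<Longrightarrow> hol S (\<lambda>z. f z + g z)"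
  by (rule holI[where D = "\<lambda>z v. frechet_derivative f (at z) v + frechet_derivative g (at z) v"])
     (auto intro!: derivative_eq_intros hol_has_derivative simp: hol_linear algebra_simps)

lemma hol_mult: "hol S f \<Longrightarrow> hol S g \<Longrightarrow> hol S (\<lambda>z. f z * g z)"
  by (rule holI[where D = "\<lambda>z v. f z * frechet_derivative g (at z) v + frechet_derivative f (at z) v * g z"])
     (auto intro!: derivative_eq_intros hol_has_derivative simp: hol_linear algebra_simps)

lemma hol_sum: "(\<And>i. i \<in> I \<Longrightarrow> hol S (f i)) \<Longrightarrow> hol S (\<lambda>z. \<Sum>i\<in>I. f i z)"
  by (induction I rule: infinite_finite_induct) (auto intro: hol_const hol_add)

lemma hol_prod: "(\<And>i. i \<in> I \<Longrightarrow> hol S (f i)) \<Longrightarrow> hol S (\<lambda>z. \<Prod>i\<in>I. f i z)"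
  by (induction I rule: infinite_finite_induct) (auto intro: hol_const hol_mult)

lemma hol_cmult: "hol S f \<Longrightarrow> hol S (\<lambda>z. c * f z)"
  by (intro hol_mult hol_const)

lemma hol_divide:
  assumes "hol S f" "hol S g" "\<And>z. z \<in> S \<Longrightarrow> g z \<noteq> 0" shows "hol S (\<lambda>z. f z / g z)"
proof -
  have "hol S (\<lambda>z. inverse (g z))"
  proof (rule holI[where D = "\<lambda>z v. - (inverse (g z) * frechet_derivative g (at z) v * inverse (g z))"])
    fix z assume z: "z \<in> S"
    show "((\<lambda>z. inverse (g z)) has_derivative (\<lambda>v. - (inverse (g z) * frechet_derivative g (at z) v * inverse (g z)))) (at z)"
      by (rule Deriv.has_derivative_inverse[OF assms(3)[OF z] hol_has_derivative[OF assms(2) z]])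
    show "- (inverse (g z) * frechet_derivative g (at z) (c *s v) * inverse (g z)) =
      c * - (inverse (g z) * frechet_derivative g (at z) v * inverse (g z))" for c v
      by (simp add: hol_linear[OF assms(2) z])
  qed
  then show ?thesis unfolding divide_inverse by (intro hol_mult assms)
qed

lemma hol_cong:
  assumes "open S" "\<And>z. z \<in> S \<Longrightarrow> f z = g z" "hol S f" shows "hol S g"
proof (rule holI[where D = "\<lambda>z. frechet_derivative f (at z)"])
  fix z assume z: "z \<in> S"
  show "(g has_derivative frechet_derivative f (at z)) (at z)"
    by (rule has_derivative_transform_within_open[OF hol_has_derivative[OF assms(3) z] assms(1) z]) (use assms in auto)
qed (rule hol_linear[OF assms(3)])

text \<open>The parametrisation used by \<open>circlepath\<close> around the origin. Its derivative
  is 2 pi i times itself, which turns Cauchy's contour integral into a mean value over the unit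
  interval.\<close>

definition circ :: "real \<Rightarrow> real \<Rightarrow> complex" where
  "circ \<rho> t = of_real \<rho> * exp (2 * of_real pi * \<i> * of_real t)"

lemma circ_nonzero: "\<rho> > 0 \<Longrightarrow> circ \<rho> t \<noteq> 0"
  by (simp add: circ_def)

lemma norm_circ: "\<rho> > 0 \<Longrightarrow> norm (circ \<rho> t) = \<rho>"
  by (simp add: circ_def norm_mult)

lemma continuous_circ: "continuous_on T (circ \<rho>)"
  unfolding circ_def by (intro continuous_intros)

lemma has_derivative_smult_left: "((\<lambda>\<zeta>. z + \<zeta> *s v) has_derivative (\<lambda>c. c *s v)) (at \<zeta>)"
  for v :: "complex^'n::finite"
proof -
  have "bounded_linear (\<lambda>c. c *s v)"
    unfolding linear_conv_bounded_linear[symmetric]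
    by (rule linearI) (simp_all add: vec_eq_iff algebra_simps)
  then show ?thesis by (auto intro!: derivative_eq_intros bounded_linear_imp_has_derivative)
qed

text \<open>On the complex line through z in direction v the function depends holomorphically on one
  variable, and the directional derivative is its derivative at 0. In this form f enters only
  through its values on a circle that moves with z, so regularity of f in z passes to its
  derivative.\<close>

lemma hol_cauchy:
  fixes f :: "complex^'n::finite \<Rightarrow> complex"
  assumes f: "hol S f" and "0 < \<rho>"
    and sub: "\<And>\<zeta>. norm \<zeta> \<le> \<rho> \<Longrightarrow> z + \<zeta> *s v \<in> S"
  shows "frechet_derivative f (at z) v = integral (cbox 0 1) (\<lambda>t. f (z + circ \<rho> t *s v) / circ \<rho> t)"
proof -
  let ?h = "\<lambda>\<zeta>. f (z + \<zeta> *s v)"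
  have d: "(?h has_field_derivative frechet_derivative f (at (z + \<zeta> *s v)) v) (at \<zeta>)" if "norm \<zeta> \<le> \<rho>" for \<zeta>
  proof -
    have "(?h has_derivative (\<lambda>c. frechet_derivative f (at (z + \<zeta> *s v)) (c *s v))) (at \<zeta>)"
      using has_derivative_compose[OF has_derivative_smult_left hol_has_derivative[OF f sub[OF that]]] .
    then show ?thesis
      unfolding has_field_derivative_def hol_linear[OF f sub[OF that]] by (simp add: mult.commute[of _ "frechet_derivative f _ v"] mult_commute_abs)
  qed
  have c: "continuous_on (cball 0 \<rho>) ?h"
    by (rule continuous_at_imp_continuous_on) (use DERIV_isCont[OF d] in auto)
  have h: "?h holomorphic_on ball 0 \<rho>"
    unfolding holomorphic_on_def field_differentiable_def
  proof (intro ballI exI)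
    fix \<zeta> :: complex assume "\<zeta> \<in> ball 0 \<rho>"
    then show "(?h has_field_derivative frechet_derivative f (at (z + \<zeta> *s v)) v) (at \<zeta> within ball 0 \<rho>)"
      using has_field_derivative_at_within[OF d[of \<zeta>]] by simp
  qed
  have 0: "(0::complex) \<in> ball 0 \<rho>" using assms by simp
  note C = Cauchy_derivative_integral_circlepath[OF c h 0]
  have "frechet_derivative f (at z) v = (1 / (2 * of_real pi * \<i>)) * contour_integral (circlepath 0 \<rho>) (\<lambda>u. ?h u / u\<^sup>2)"
    using DERIV_unique[OF d[of 0] C(2)] assms by simp
  also have "contour_integral (circlepath 0 \<rho>) (\<lambda>u. ?h u / u\<^sup>2) =
    integral {0..1} (\<lambda>t. ?h (circlepath 0 \<rho> t) / (circlepath 0 \<rho> t)\<^sup>2 * vector_derivative (circlepath 0 \<rho>) (at t))"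
    unfolding contour_integral_integral by simp
  also have "\<dots> = integral {0..1} (\<lambda>t. (2 * of_real pi * \<i>) * (?h (circ \<rho> t) / circ \<rho> t))"
  proof (rule integral_cong)
    fix t :: real
    have "vector_derivative (circlepath 0 \<rho>) (at t) = 2 * of_real pi * \<i> * circ \<rho> t"
      by (simp add: vector_derivative_circlepath circ_def)
    moreover have "circlepath 0 \<rho> t = circ \<rho> t" by (simp add: circlepath circ_def)
    ultimately show "?h (circlepath 0 \<rho> t) / (circlepath 0 \<rho> t)\<^sup>2 * vector_derivative (circlepath 0 \<rho>) (at t)
       = (2 * of_real pi * \<i>) * (?h (circ \<rho> t) / circ \<rho> t)"
      using circ_nonzero[OF assms(2), of t] by (simp add: power2_eq_square field_simps)
  qed
  also have "\<dots> = (2 * of_real pi * \<i>) * integral {0..1} (\<lambda>t. ?h (circ \<rho> t) / circ \<rho> t)"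
    by (rule integral_mult_right)
  finally show ?thesis by simp
qed

text \<open>A radius that serves all centres near z0 at once is needed to use Cauchy's formula with
  a fixed circle on a whole neighbourhood.\<close>

lemma exists_polydisc:
  fixes S :: "(complex^'n::finite) set"
  assumes "open S" "z0 \<in> S"
  obtains \<epsilon> where "\<epsilon> > 0" "\<And>z \<zeta>. z \<in> ball z0 \<epsilon> \<Longrightarrow> norm \<zeta> \<le> \<epsilon> \<Longrightarrow> z + \<zeta> *s v \<in> S"
proof -
  obtain e where e: "e > 0" "ball z0 e \<subseteq> S" using assms openE by blast
  have n: "norm (\<zeta> *s v) \<le> norm \<zeta> * norm v" for \<zeta>
    by (simp add: norm_vec_def vector_scalar_mult_def norm_mult L2_set_right_distrib)
  \<comment> \<open>A shift of the centre and a shift along v together cost less than \<epsilon> (1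
    + norm v); the 2 in the denominator leaves room below e and keeps it positive for v = 0.\<close>
  define \<epsilon> where "\<epsilon> = e / (2 + norm v)"
  have "\<epsilon> > 0" using e by (simp add: \<epsilon>_def add_pos_nonneg)
  moreover have "z + \<zeta> *s v \<in> S" if "z \<in> ball z0 \<epsilon>" "norm \<zeta> \<le> \<epsilon>" for z \<zeta>
  proof -
    have "norm (z + \<zeta> *s v - z0) \<le> norm (z - z0) + norm (\<zeta> *s v)"
      by (metis (no_types) add_diff_eq add.commute norm_triangle_ineq)
    also have "\<dots> < \<epsilon> + \<epsilon> * norm v"
      using that n[of \<zeta>] mult_right_mono[OF that(2), of "norm v"] by (auto simp: dist_norm norm_minus_commute)
    also have "\<dots> < \<epsilon> * (2 + norm v)" using \<open>\<epsilon> > 0\<close> by (simp add: algebra_simps)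
    also have "\<dots> = e" unfolding \<epsilon>_def by (simp add: add_nonneg_eq_0_iff)
    finally show ?thesis using e by (auto simp: dist_norm norm_minus_commute)
  qed
  ultimately show ?thesis using that by blast
qed

text \<open>Continuity of the derivative is not part of \<open>hol\<close>; it is inherited from the
  continuity of f through Cauchy's integral.\<close>

lemma hol_deriv_continuous:
  fixes f :: "complex^'n::finite \<Rightarrow> complex"
  assumes "open S" "hol S f"
  shows "continuous_on S (\<lambda>z. frechet_derivative f (at z) v)"
proof (rule continuous_at_imp_continuous_on, rule ballI)
  fix z0 assume "z0 \<in> S"
  then obtain \<epsilon> where e: "\<epsilon> > 0" "\<And>z \<zeta>. z \<in> ball z0 \<epsilon> \<Longrightarrow> norm \<zeta> \<le> \<epsilon> \<Longrightarrow> z + \<zeta> *s v \<in> S"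
    using exists_polydisc[OF assms(1)] by blast
  have "continuous_on (ball z0 \<epsilon>) (\<lambda>z. integral (cbox 0 1) (\<lambda>t. f (z + circ \<epsilon> t *s v) / circ \<epsilon> t))"
  proof (rule integral_continuous_on_param)
    have "continuous_on (ball z0 \<epsilon> \<times> cbox 0 1) (\<lambda>p. f (fst p + circ \<epsilon> (snd p) *s v))"
      by (rule continuous_on_compose2[OF hol_continuous_on[OF assms(2)]])
         (auto intro!: continuous_intros continuous_on_compose2[OF continuous_circ[of UNIV]] e(2)[unfolded vector_scalar_mult_def] simp: norm_circ[OF e(1)] vector_scalar_mult_def)
    then show "continuous_on (ball z0 \<epsilon> \<times> cbox 0 1) (\<lambda>(z, t). f (z + circ \<epsilon> t *s v) / circ \<epsilon> t)"
      unfolding split_beta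
      by (intro continuous_intros continuous_on_compose2[OF continuous_circ[of UNIV]]) (auto simp: circ_nonzero[OF e(1)])
  qed
  then have "continuous_on (ball z0 \<epsilon>) (\<lambda>z. frechet_derivative f (at z) v)"
    by (subst continuous_on_cong[OF refl hol_cauchy[OF assms(2) e(1) e(2)]]) auto
  then show "isCont (\<lambda>z. frechet_derivative f (at z) v) z0"
    using e(1) by (simp add: continuous_on_eq_continuous_at)
qed

text \<open>Differentiation under the integral sign in Cauchy's formula. Recognising the result as
  Cauchy's formula for another directional derivative gives the symmetry of second derivatives.\<close>

lemma hol_deriv_has_derivative:
  fixes f :: "complex^'n::finite \<Rightarrow> complex"
  assumes "open S" "hol S f" "z0 \<in> S"
  obtains \<epsilon> where "\<epsilon> > 0" "\<And>\<zeta>. norm \<zeta> \<le> \<epsilon> \<Longrightarrow> z0 + \<zeta> *s v \<in> S"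
    "((\<lambda>z. frechet_derivative f (at z) v) has_derivative
    (\<lambda>w. integral (cbox 0 1) (\<lambda>t. frechet_derivative f (at (z0 + circ \<epsilon> t *s v)) w / circ \<epsilon> t))) (at z0)"
proof -
  obtain \<epsilon> where e: "\<epsilon> > 0" "\<And>z \<zeta>. z \<in> ball z0 \<epsilon> \<Longrightarrow> norm \<zeta> \<le> \<epsilon> \<Longrightarrow> z + \<zeta> *s v \<in> S"
    using exists_polydisc[OF assms(1,3)] by blast
  let ?g = "\<lambda>z t. f (z + circ \<epsilon> t *s v) / circ \<epsilon> t"
  let ?D = "\<lambda>z t w. frechet_derivative f (at (z + circ \<epsilon> t *s v)) w / circ \<epsilon> t"
  have inS: "z + circ \<epsilon> t *s v \<in> S" if "z \<in> ball z0 \<epsilon>" for z t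
    using e(2)[OF that] norm_circ[OF e(1)] by simp
  have dg: "((\<lambda>z. ?g z t) has_derivative ?D z t) (at z)" if z: "z \<in> ball z0 \<epsilon>" for z t
  proof -
    have "((\<lambda>z. z + circ \<epsilon> t *s v) has_derivative (\<lambda>w. w)) (at z)"
      by (auto intro!: derivative_eq_intros)
    note has_derivative_compose[OF this hol_has_derivative[OF assms(2) inS[OF z]]]
    from has_derivative_mult_left[OF this, of "inverse (circ \<epsilon> t)"]
    show ?thesis by (simp add: divide_inverse)
  qed
  \<comment> \<open>The Leibniz rule for integrals asks for the derivative as a bounded linear
    operator, continuous in the operator norm. In finite dimension this continuity can be checked on
    each vector separately.\<close>
  have bl: "blinfun_apply (Blinfun (?D z t)) = ?D z t" if z: "z \<in> ball z0 \<epsilon>" for z t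
    using dg[OF z] has_derivative_bounded_linear bounded_linear_Blinfun_apply by blast
  have cont: "continuous_on (ball z0 \<epsilon> \<times> cbox 0 1) (\<lambda>p. ?D (fst p) (snd p) w)" for w
  proof -
    have "continuous_on (ball z0 \<epsilon> \<times> cbox 0 1) (\<lambda>p. frechet_derivative f (at (fst p + circ \<epsilon> (snd p) *s v)) w)"
      by (rule continuous_on_compose2[OF hol_deriv_continuous[OF assms(1,2)]])
         (auto intro!: continuous_intros continuous_on_compose2[OF continuous_circ[of UNIV]] inS[unfolded vector_scalar_mult_def] simp: vector_scalar_mult_def)
    then show ?thesis
      by (intro continuous_intros continuous_on_compose2[OF continuous_circ[of UNIV]]) (auto simp: circ_nonzero[OF e(1)])
  qed
  have contB: "continuous_on (ball z0 \<epsilon> \<times> cbox 0 1) (\<lambda>p. Blinfun (?D (fst p) (snd p)))"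
    unfolding continuous_on_eq_continuous_within
  proof (intro ballI continuous_blinfun_componentwiseI1)
    fix p i assume p: "p \<in> ball z0 \<epsilon> \<times> cbox (0::real) 1"
    have "continuous_on (ball z0 \<epsilon> \<times> cbox 0 1) (\<lambda>p. blinfun_apply (Blinfun (?D (fst p) (snd p))) i)"
      by (subst continuous_on_cong[OF refl, where g = "\<lambda>p. ?D (fst p) (snd p) i"]) (use cont[of i] in \<open>auto simp: bl\<close>)
    then show "continuous (at p within ball z0 \<epsilon> \<times> cbox 0 1) (\<lambda>p. blinfun_apply (Blinfun (?D (fst p) (snd p))) i)"
      using p continuous_on_eq_continuous_within by blast
  qed
  have intg: "(\<lambda>t. Blinfun (?D z0 t)) integrable_on cbox 0 1"
    by (rule integrable_continuous, rule continuous_on_compose2[OF contB, where f = "\<lambda>t. (z0, t)", simplified])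
       (auto intro!: continuous_intros simp: e(1))
  have "((\<lambda>z. integral (cbox 0 1) (?g z)) has_derivative integral (cbox 0 1) (\<lambda>t. Blinfun (?D z0 t))) (at z0 within ball z0 \<epsilon>)"
  proof (rule leibniz_rule)
    fix z :: "complex^'n" assume z: "z \<in> ball z0 \<epsilon>"
    show "((\<lambda>z. ?g z t) has_derivative blinfun_apply (Blinfun (?D z t))) (at z within ball z0 \<epsilon>)" for t
      unfolding bl[OF z] by (rule has_derivative_at_withinI[OF dg[OF z]])
    have "continuous_on (cbox 0 1) (\<lambda>t. f (z + circ \<epsilon> t *s v))"
      by (rule continuous_on_compose2[OF hol_continuous_on[OF assms(2)]])
         (auto intro!: continuous_intros continuous_on_compose2[OF continuous_circ[of UNIV]] inS[OF z, unfolded vector_scalar_mult_def] simp: vector_scalar_mult_def)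
    then show "?g z integrable_on cbox 0 1"
      by (intro integrable_continuous continuous_intros continuous_circ) (auto simp: circ_nonzero[OF e(1)])
  next
    show "continuous_on (ball z0 \<epsilon> \<times> cbox 0 1) (\<lambda>(z, t). Blinfun (?D z t))"
      using contB unfolding split_beta .
  qed (use e(1) in simp_all)
  moreover have "blinfun_apply (integral (cbox 0 1) (\<lambda>t. Blinfun (?D z0 t))) = (\<lambda>w. integral (cbox 0 1) (\<lambda>t. ?D z0 t w))"
  proof
    fix w
    have "z0 \<in> ball z0 \<epsilon>" using e(1) by simp
    then show "blinfun_apply (integral (cbox 0 1) (\<lambda>t. Blinfun (?D z0 t))) w = integral (cbox 0 1) (\<lambda>t. ?D z0 t w)"
      unfolding blinfun_apply_integral[OF intg] by (simp only: bl)
  qed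
  ultimately have "((\<lambda>z. integral (cbox 0 1) (?g z)) has_derivative (\<lambda>w. integral (cbox 0 1) (\<lambda>t. ?D z0 t w))) (at z0)"
    using e(1) at_within_open[of z0 "ball z0 \<epsilon>"] by simp
  then have "((\<lambda>z. frechet_derivative f (at z) v) has_derivative (\<lambda>w. integral (cbox 0 1) (\<lambda>t. ?D z0 t w))) (at z0)"
  proof (rule has_derivative_transform_within_open[where s = "ball z0 \<epsilon>"])
    show "z0 \<in> ball z0 \<epsilon>" using e(1) by simp
    show "integral (cbox 0 1) (?g z) = frechet_derivative f (at z) v" if "z \<in> ball z0 \<epsilon>" for z
      by (rule hol_cauchy[OF assms(2) e(1) e(2)[OF that], symmetric])
  qed (rule open_ball)
  moreover have "\<And>\<zeta>. norm \<zeta> \<le> \<epsilon> \<Longrightarrow> z0 + \<zeta> *s v \<in> S"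
    by (rule e(2)) (use e(1) in auto)
  ultimately show ?thesis using that e(1) by simp
qed

text \<open>Complex linearity passes from the integrand to the integral, so directional derivatives
  stay in the class \<open>hol\<close> and may be differentiated again.\<close>

lemma hol_deriv:
  fixes f :: "complex^'n::finite \<Rightarrow> complex"
  assumes "open S" "hol S f"
  shows "hol S (\<lambda>z. frechet_derivative f (at z) v)"
  unfolding hol_def
proof (intro ballI conjI allI)
  fix z c w assume z: "z \<in> S"
  obtain \<epsilon> where e: "\<epsilon> > 0"
    "\<And>\<zeta>. norm \<zeta> \<le> \<epsilon> \<Longrightarrow> z + \<zeta> *s v \<in> S" and
    d: "((\<lambda>z. frechet_derivative f (at z) v) has_derivative
    (\<lambda>w. integral (cbox 0 1) (\<lambda>t. frechet_derivative f (at (z + circ \<epsilon> t *s v)) w / circ \<epsilon> t))) (at z)"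
    by (rule hol_deriv_has_derivative[OF assms z, of v]) (rule that)
  show "(\<lambda>z. frechet_derivative f (at z) v) differentiable (at z)" using d differentiable_def by blast
  have *: "frechet_derivative f (at (z + circ \<epsilon> t *s v)) (c *s w) / circ \<epsilon> t =
      c * (frechet_derivative f (at (z + circ \<epsilon> t *s v)) w / circ \<epsilon> t)" for t
    using hol_linear[OF assms(2) e(2), of "circ \<epsilon> t"] norm_circ[OF e(1), of t] by simp
  show "frechet_derivative (\<lambda>z. frechet_derivative f (at z) v) (at z) (c *s w)
      = c * frechet_derivative (\<lambda>z. frechet_derivative f (at z) v) (at z) w"
    unfolding frechet_derivative_at[OF d, symmetric] by (simp only: * integral_mult_right)
qed

lemma hol_deriv_commute:
  fixes f :: "complex^'n::finite \<Rightarrow> complex"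
  assumes "open S" "hol S f" "z \<in> S"
  shows "frechet_derivative (\<lambda>z. frechet_derivative f (at z) v) (at z) w =
    frechet_derivative (\<lambda>z. frechet_derivative f (at z) w) (at z) v"
proof -
  obtain \<epsilon> where e: "\<epsilon> > 0"
    "\<And>\<zeta>. norm \<zeta> \<le> \<epsilon> \<Longrightarrow> z + \<zeta> *s v \<in> S" and
    d: "((\<lambda>z. frechet_derivative f (at z) v) has_derivative
    (\<lambda>w. integral (cbox 0 1) (\<lambda>t. frechet_derivative f (at (z + circ \<epsilon> t *s v)) w / circ \<epsilon> t))) (at z)"
    by (rule hol_deriv_has_derivative[OF assms, of v]) (rule that)
  show ?thesis
    unfolding frechet_derivative_at[OF d, symmetric]
    by (rule hol_cauchy[OF hol_deriv[OF assms(1,2)] e, symmetric])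
qed

section \<open>The exterior algebra\<close>

text \<open>The linearity of \<open>alt_form\<close>, with the list split at the varying argument:
  this form survives \<open>take\<close>, \<open>drop\<close>, \<open>#\<close> and
  \<open>@\<close>. Lists of other lengths are left unrestricted.\<close>

definition multilin :: "nat \<Rightarrow> 'n::finite covec \<Rightarrow> bool" where
  "multilin k T \<longleftrightarrow> (\<forall>ys zs c u v. length ys + length zs + 1 = k \<longrightarrow>
     T (ys @ (c *s u + v) # zs) = c * T (ys @ u # zs) + T (ys @ v # zs))"

lemma multilinD: "multilin k T \<Longrightarrow> length ys + length zs + 1 = k \<Longrightarrow>
    T (ys @ (c *s u + v) # zs) = c * T (ys @ u # zs) + T (ys @ v # zs)"
  by (simp add: multilin_def)

text \<open>There is no factor 1 / n!. With this normalisation every constant in the algebra of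
  \<open>wedge\<close> is a factorial counting the permutations of one factor.\<close>

definition Alt :: "nat \<Rightarrow> 'n::finite covec \<Rightarrow> 'n covec" where
  "Alt n T xs = (if length xs = n then
     (\<Sum>\<sigma> | \<sigma> permutes {..<n}. of_int (sign \<sigma>) * T (permute_list \<sigma> xs)) else 0)"

definition tensor :: "nat \<Rightarrow> 'n::finite covec \<Rightarrow> 'n covec \<Rightarrow> 'n covec" where
  "tensor k \<alpha> \<beta> xs = \<alpha> (take k xs) * \<beta> (drop k xs)"

lemma alt_form_length: "alt_form k \<alpha> \<Longrightarrow> length xs \<noteq> k \<Longrightarrow> \<alpha> xs = 0"
  by (simp add: alt_form_def)

lemma alt_form_update:
  assumes "alt_form k \<alpha>" "length xs = k" "i < k"
  shows "\<alpha> (xs[i := c *s u + v]) = c * \<alpha> (xs[i := u]) + \<alpha> (xs[i := v])"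
proof -
  have "\<And>xs i c u v. length xs = k \<and> i < k \<Longrightarrow>
      \<alpha> (xs[i := c *s u + v]) = c * \<alpha> (xs[i := u]) + \<alpha> (xs[i := v])"
    using assms(1) unfolding alt_form_def by (elim conjE) blast
  from this[OF conjI[OF assms(2,3)]] show ?thesis .
qed

lemma alt_form_repeated:
  assumes "alt_form k \<alpha>" "length xs = k" "i < j" "j < k" "xs ! i = xs ! j"
  shows "\<alpha> xs = 0"
proof -
  have "\<And>xs i j. length xs = k \<and> i < j \<and> j < k \<and> xs ! i = xs ! j \<Longrightarrow> \<alpha> xs = 0"
    using assms(1) unfolding alt_form_def by (elim conjE) blast
  from this[of xs i j] assms show ?thesis by simp
qed

lemma alt_form_multilin:
  fixes \<alpha> :: "'n::finite covec"
  shows "alt_form k \<alpha> \<Longrightarrow> multilin k \<alpha>"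
  unfolding multilin_def
proof (intro allI impI)
  fix ys zs :: "(complex^'n) list" and c u v
  assume a: "alt_form k \<alpha>" and l: "length ys + length zs + 1 = k"
  from alt_form_update[OF a, of "ys @ u # zs" "length ys" c u v] l
  show "\<alpha> (ys @ (c *s u + v) # zs) = c * \<alpha> (ys @ u # zs) + \<alpha> (ys @ v # zs)" by simp
qed

lemma alt_formI:
  fixes \<alpha> :: "'n::finite covec"
  assumes "\<And>xs. length xs \<noteq> k \<Longrightarrow> \<alpha> xs = 0" and "multilin k \<alpha>"
    and "\<And>xs i j. length xs = k \<Longrightarrow> i < j \<Longrightarrow> j < k \<Longrightarrow> xs ! i = xs ! j \<Longrightarrow> \<alpha> xs = 0"
  shows "alt_form k \<alpha>"
  unfolding alt_form_def
proof (intro conjI allI impI)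
  fix xs :: "(complex^'n) list" and i c u v
  assume "length xs = k \<and> i < k"
  then show "\<alpha> (xs[i := c *s u + v]) = c * \<alpha> (xs[i := u]) + \<alpha> (xs[i := v])"
    using assms(2) by (auto simp: multilin_def upd_conv_take_nth_drop)
qed (use assms in auto)

lemma multilin_add:
  "multilin k T \<Longrightarrow> length ys + length zs + 1 = k \<Longrightarrow> T (ys @ (u + v) # zs) = T (ys @ u # zs) + T (ys @ v # zs)"
  unfolding multilin_def by (metis mult.left_neutral vector_smult_lid)

lemma multilin_zero:
  "multilin k T \<Longrightarrow> length ys + length zs + 1 = k \<Longrightarrow> T (ys @ 0 # zs) = 0"
  using multilin_add[of k T ys zs 0 0] by simp

lemma multilin_scale:
  "multilin k T \<Longrightarrow> length ys + length zs + 1 = k \<Longrightarrow> T (ys @ (c *s u) # zs) = c * T (ys @ u # zs)"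
  using multilin_zero[of k T ys zs] unfolding multilin_def by (metis add.right_neutral)

lemma multilin_sum:
  assumes "multilin k T" "length ys + length zs + 1 = k"
  shows "T (ys @ (\<Sum>p\<in>P. c p *s u p) # zs) = (\<Sum>p\<in>P. c p * T (ys @ u p # zs))"
  using assms
  by (induction P rule: infinite_finite_induct) (auto simp: multilin_zero multilin_add multilin_scale)

lemma multilin_Cons: "multilin (Suc k) T \<Longrightarrow> multilin k (\<lambda>xs. T (x # xs))"
  unfolding multilin_def by (metis append_Cons length_Cons add_Suc)

lemma multilin_append: "multilin k T \<Longrightarrow> length zs \<le> k \<Longrightarrow> multilin (k - length zs) (\<lambda>xs. T (xs @ zs))"
  unfolding multilin_def by simp

lemma multilin_tensor:
  fixes \<alpha> \<beta> :: "'n::finite covec"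
  assumes "multilin k \<alpha>" "multilin l \<beta>" shows "multilin (k + l) (tensor k \<alpha> \<beta>)"
  unfolding multilin_def
proof (intro allI impI)
  fix ys zs :: "(complex^'n) list" and c u v
  assume l: "length ys + length zs + 1 = k + l"
  show "tensor k \<alpha> \<beta> (ys @ (c *s u + v) # zs) = c * tensor k \<alpha> \<beta> (ys @ u # zs) + tensor k \<alpha> \<beta> (ys @ v # zs)"
  proof (cases "length ys < k")
    case True
    then obtain q where q: "k - length ys = Suc q" by (metis Suc_diff_Suc)
    have "\<alpha> (ys @ (c *s u + v) # take q zs) = c * \<alpha> (ys @ u # take q zs) + \<alpha> (ys @ v # take q zs)"
      using assms(1) l True q unfolding multilin_def by auto
    then show ?thesis using True q by (simp add: tensor_def algebra_simps)
  next
    case False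
    then have "\<beta> (drop k ys @ (c *s u + v) # zs) = c * \<beta> (drop k ys @ u # zs) + \<beta> (drop k ys @ v # zs)"
      using assms(2) l unfolding multilin_def by auto
    then show ?thesis using False by (simp add: tensor_def algebra_simps)
  qed
qed

lemma multilin_Alt:
  fixes T :: "'n::finite covec"
  assumes "multilin k T" shows "multilin k (Alt k T)"
  unfolding multilin_def
proof (intro allI impI)
  fix ys zs :: "(complex^'n) list" and c u v
  assume l: "length ys + length zs + 1 = k"
  let ?w = "\<lambda>x. ys @ x # zs"
  have "T (permute_list \<sigma> (?w (c *s u + v))) = c * T (permute_list \<sigma> (?w u)) + T (permute_list \<sigma> (?w v))"
    if s: "\<sigma> permutes {..<k}" for \<sigma>
  proof -
    \<comment> \<open>The place to which the permutation carries the varying argument; at all other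
      places the permuted list does not depend on it.\<close>
    define i where "i = inv \<sigma> (length ys)"
    have i: "\<sigma> i = length ys" "i < k"
      using s l permutes_in_image[OF permutes_inv[OF s], of "length ys"]
      by (auto simp: i_def permutes_inverses)
    have ne: "\<sigma> j = length ys \<longleftrightarrow> j = i" for j
      using i(1) permutes_inj[OF s] by (metis injD)
    have *: "permute_list \<sigma> (?w x) = take i (permute_list \<sigma> (?w 0)) @ x # drop (Suc i) (permute_list \<sigma> (?w 0))" for x
    proof (rule nth_equalityI)
      show "length (permute_list \<sigma> (?w x)) = length (take i (permute_list \<sigma> (?w 0)) @ x # drop (Suc i) (permute_list \<sigma> (?w 0)))"
        using l i by simp
      fix j assume j: "j < length (permute_list \<sigma> (?w x))"
      have "(take i (permute_list \<sigma> (?w 0)) @ x # drop (Suc i) (permute_list \<sigma> (?w 0))) ! j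
        = ((permute_list \<sigma> (?w 0))[i := x]) ! j"
        using l i by (simp add: upd_conv_take_nth_drop)
      also have "\<dots> = (if j = i then x else (permute_list \<sigma> (?w 0)) ! j)"
        using j l i by (simp add: nth_list_update)
      also have "\<dots> = permute_list \<sigma> (?w x) ! j"
        using j l i ne[of j] by (auto simp: permute_list_def nth_append nth_Cons split: nat.split)
      finally show "permute_list \<sigma> (?w x) ! j = (take i (permute_list \<sigma> (?w 0)) @ x # drop (Suc i) (permute_list \<sigma> (?w 0))) ! j"
        by simp
    qed
    show ?thesis
      using assms i l unfolding multilin_def
      apply (subst (1 2 3) *) by simp
  qed
  then show "Alt k T (?w (c *s u + v)) = c * Alt k T (?w u) + Alt k T (?w v)"
    using l by (simp add: Alt_def sum_distrib_left sum.distrib[symmetric] algebra_simps)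
qed

section \<open>Alternation and the wedge product\<close>

lemma sign_mult_self: "of_int (sign \<sigma>) * (of_int (sign \<sigma>) * x) = (x::complex)"
  by (simp add: sign_def)

lemma permutes_permutation: "\<sigma> permutes {..<n::nat} \<Longrightarrow> permutation \<sigma>"
  using permutation_permutes by blast

text \<open>Permuting the slots of T is a right translation of the summation index, which costs one
  sign. Permuting the arguments, in \<open>Alt_permute_arg\<close>, is a left translation.\<close>

lemma Alt_permute:
  assumes "\<tau> permutes {..<n}"
  shows "Alt n (\<lambda>ys. T (permute_list \<tau> ys)) xs = of_int (sign \<tau>) * Alt n T xs"
proof (cases "length xs = n")
  case True
  have "(\<Sum>\<sigma> | \<sigma> permutes {..<n}. of_int (sign \<sigma>) * T (permute_list \<tau> (permute_list \<sigma> xs)))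
    = (\<Sum>\<sigma> | \<sigma> permutes {..<n}. of_int (sign \<tau>) * (of_int (sign (\<sigma> \<circ> \<tau>)) * T (permute_list (\<sigma> \<circ> \<tau>) xs)))"
    using assms True
    by (intro sum.cong) (auto simp: permute_list_compose sign_compose permutes_permutation sign_mult_self mult.assoc mult.left_commute[of "of_int (sign \<tau>)"])
  also have "\<dots> = of_int (sign \<tau>) * (\<Sum>\<sigma> | \<sigma> permutes {..<n}. of_int (sign \<sigma>) * T (permute_list \<sigma> xs))"
    unfolding sum_distrib_left[symmetric]
    by (subst sum_permutations_compose_right[OF assms, of "\<lambda>\<sigma>. of_int (sign \<sigma>) * T (permute_list \<sigma> xs)", symmetric]) (rule refl)
  finally show ?thesis using True by (simp add: Alt_def)
qed (simp add: Alt_def)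

lemma Alt_permute_arg:
  assumes "\<tau> permutes {..<n}" "length xs = n"
  shows "Alt n T (permute_list \<tau> xs) = of_int (sign \<tau>) * Alt n T xs"
proof -
  have "(\<Sum>\<sigma> | \<sigma> permutes {..<n}. of_int (sign \<sigma>) * T (permute_list \<sigma> (permute_list \<tau> xs)))
    = (\<Sum>\<sigma> | \<sigma> permutes {..<n}. of_int (sign \<tau>) * (of_int (sign (\<tau> \<circ> \<sigma>)) * T (permute_list (\<tau> \<circ> \<sigma>) xs)))"
    using assms
    by (intro sum.cong) (auto simp: permute_list_compose sign_compose permutes_permutation sign_mult_self mult.assoc)
  also have "\<dots> = of_int (sign \<tau>) * (\<Sum>\<sigma> | \<sigma> permutes {..<n}. of_int (sign \<sigma>) * T (permute_list \<sigma> xs))"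
    unfolding sum_distrib_left[symmetric]
    by (subst setum_permutations_compose_left[OF assms(1), of "\<lambda>\<sigma>. of_int (sign \<sigma>) * T (permute_list \<sigma> xs)", symmetric]) (rule refl)
  finally show ?thesis using assms by (simp add: Alt_def)
qed

lemma permutes_transpose_lt: "i < n \<Longrightarrow> j < n \<Longrightarrow> Transposition.transpose i j permutes {..<n::nat}"
  by (rule permutes_swap_id) auto

lemma permute_list_transpose_eq:
  "xs ! i = xs ! j \<Longrightarrow> i < length xs \<Longrightarrow> j < length xs \<Longrightarrow> permute_list (Transposition.transpose i j) xs = xs"
  by (rule nth_equalityI) (auto simp: permute_list_def Transposition.transpose_def)

text \<open>A list with two equal entries is fixed by their transposition, so its value equals its
  own negative.\<close>

lemma alt_form_Alt:
  fixes T :: "'n::finite covec"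
  assumes "multilin k T" shows "alt_form k (Alt k T)"
proof (rule alt_formI)
  fix xs :: "(complex^'n) list" and i j
  assume "length xs = k" "i < j" "j < k" "xs ! i = xs ! j"
  then have "Alt k T xs = - Alt k T xs"
    using Alt_permute_arg[of "Transposition.transpose i j" k xs T]
    by (auto simp: permutes_transpose_lt permute_list_transpose_eq sign_swap_id)
  then show "Alt k T xs = 0" by simp
qed (auto simp: Alt_def multilin_Alt assms)

lemma wedge_Alt: "wedge k l \<alpha> \<beta> xs = Alt (k + l) (tensor k \<alpha> \<beta>) xs / (fact k * fact l)"
proof (cases "length xs = k + l")
  case True
  have 1: "map (\<lambda>s. xs ! \<sigma> s) [0..<k] = take k (permute_list \<sigma> xs)"
     and 2: "map (\<lambda>s. xs ! \<sigma> s) [k..<k + l] = drop k (permute_list \<sigma> xs)" for \<sigma>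
    using True by (simp_all add: permute_list_def take_map drop_map)
  show ?thesis
    using True by (simp add: wedge_def Alt_def 1 2 tensor_def mult.assoc)
qed (simp add: wedge_def Alt_def)

lemma alt_form_scale: "alt_form k \<alpha> \<Longrightarrow> alt_form k (\<lambda>xs. c * \<alpha> xs)"
  unfolding alt_form_def by (auto simp: algebra_simps)

lemma alt_form_add: "alt_form k \<alpha> \<Longrightarrow> alt_form k \<beta> \<Longrightarrow> alt_form k (\<lambda>xs. \<alpha> xs + \<beta> xs)"
  unfolding alt_form_def by (simp add: algebra_simps)

lemma alt_form_zero: "alt_form k (\<lambda>xs. 0)"
  unfolding alt_form_def by auto

lemma alt_form_sum: "(\<And>i. i \<in> I \<Longrightarrow> alt_form k (\<alpha> i)) \<Longrightarrow> alt_form k (\<lambda>xs. \<Sum>i\<in>I. \<alpha> i xs)"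
  by (induction I rule: infinite_finite_induct) (auto intro: alt_form_zero alt_form_add)

lemma alt_form_wedge:
  assumes "multilin k \<alpha>" "multilin l \<beta>" shows "alt_form (k + l) (wedge k l \<alpha> \<beta>)"
proof -
  have "wedge k l \<alpha> \<beta> = (\<lambda>xs. (1 / (fact k * fact l)) * Alt (k + l) (tensor k \<alpha> \<beta>) xs)"
    by (auto simp: wedge_Alt)
  then show ?thesis using alt_form_scale[OF alt_form_Alt[OF multilin_tensor[OF assms]]] by metis
qed

lemma card_permutes: "card {\<sigma>. \<sigma> permutes {..<k::nat}} = fact k"
  by (rule card_permutations) auto

lemma Alt_cong: "(\<And>ys. length ys = n \<Longrightarrow> T ys = S ys) \<Longrightarrow> Alt n T xs = Alt n S xs"
  by (simp add: Alt_def)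

lemma Alt_sum: "Alt n (\<lambda>ys. \<Sum>p\<in>P. c p * T p ys) xs = (\<Sum>p\<in>P. c p * Alt n (T p) xs)"
proof (cases "length xs = n")
  case True
  have "Alt n (\<lambda>ys. \<Sum>p\<in>P. c p * T p ys) xs = (\<Sum>\<sigma> | \<sigma> permutes {..<n}. \<Sum>p\<in>P. c p * (of_int (sign \<sigma>) * T p (permute_list \<sigma> xs)))"
    using True by (simp add: Alt_def sum_distrib_left mult.left_commute)
  then show ?thesis
    using True by (simp add: Alt_def sum_distrib_left sum.swap[of _ P])
qed (simp add: Alt_def)

lemma permute_list_take:
  assumes "\<rho> permutes {..<k}" "k \<le> length xs"
  shows "take k (permute_list \<rho> xs) = permute_list \<rho> (take k xs)"
    and "drop k (permute_list \<rho> xs) = drop k xs"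
proof -
  have p: "\<rho> permutes {..<length xs}" using assms by (meson permutes_subset lessThan_subset_iff)
  have lt: "i < k \<Longrightarrow> \<rho> i < k" for i using permutes_in_image[OF assms(1)] by auto
  show "take k (permute_list \<rho> xs) = permute_list \<rho> (take k xs)"
    using assms lt by (intro nth_equalityI) (auto simp: permute_list_def)
  show "drop k (permute_list \<rho> xs) = drop k xs"
    using assms permutes_not_in[OF assms(1)] by (intro nth_equalityI) (auto simp: permute_list_def)
qed

text \<open>Each permutation of the first k slots is also one of all slots. The outer alternation
  absorbs it at the cost of its sign, which cancels the sign already there, so the k! summands are
  equal.\<close>

lemma Alt_tensor_left:
  fixes T S :: "'n::finite covec"
  shows "Alt (k + l) (tensor k (Alt k T) S) xs = fact k * Alt (k + l) (tensor k T S) xs"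
proof -
  have "Alt (k + l) (tensor k (Alt k T) S) xs =
    Alt (k + l) (\<lambda>ys. \<Sum>\<rho> | \<rho> permutes {..<k}. of_int (sign \<rho>) * tensor k T S (permute_list \<rho> ys)) xs"
  proof (rule Alt_cong)
    fix ys :: "(complex^'n) list" assume "length ys = k + l"
    then show "tensor k (Alt k T) S ys = (\<Sum>\<rho> | \<rho> permutes {..<k}. of_int (sign \<rho>) * tensor k T S (permute_list \<rho> ys))"
      unfolding tensor_def Alt_def sum_distrib_right
      by (auto intro!: sum.cong simp: permute_list_take min_def sum_distrib_right mult.assoc)
  qed
  also have "\<dots> = (\<Sum>\<rho> | \<rho> permutes {..<k}. of_int (sign \<rho>) * Alt (k + l) (\<lambda>ys. tensor k T S (permute_list \<rho> ys)) xs)"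
    by (rule Alt_sum)
  also have "\<dots> = (\<Sum>\<rho> | \<rho> permutes {..<k}. Alt (k + l) (tensor k T S) xs)"
  proof (rule sum.cong)
    fix \<rho> assume "\<rho> \<in> {\<rho>. \<rho> permutes {..<k}}"
    then have "\<rho> permutes {..<k + l}" using permutes_subset[of \<rho> "{..<k}" "{..<k+l}"] by auto
    then show "of_int (sign \<rho>) * Alt (k + l) (\<lambda>ys. tensor k T S (permute_list \<rho> ys)) xs = Alt (k + l) (tensor k T S) xs"
      by (simp add: Alt_permute sign_mult_self)
  qed simp
  finally show ?thesis by (simp add: card_permutes)
qed

text \<open>The right factor of \<open>tensor\<close> reads the slots behind the first k; a
  permutation of its arguments has to be moved there, with the sign unchanged.\<close>

definition shift_perm :: "nat \<Rightarrow> nat \<Rightarrow> (nat \<Rightarrow> nat) \<Rightarrow> nat \<Rightarrow> nat" where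
  "shift_perm k l \<rho> = map_permutation {..<l} (\<lambda>i. k + i) \<rho>"

lemma shift_perm:
  assumes "\<rho> permutes {..<l}"
  shows "shift_perm k l \<rho> permutes {k..<k + l}" "sign (shift_perm k l \<rho>) = sign \<rho>"
    "i < l \<Longrightarrow> shift_perm k l \<rho> (k + i) = k + \<rho> i"
proof -
  have "(\<lambda>i. k + i) ` {..<l} = {k..<k + l}"
    by (metis add.commute add_0_left atLeast0LessThan image_add_atLeastLessThan)
  then have b: "bij_betw (\<lambda>i. k + i) {..<l} {k..<k + l}" by (simp add: bij_betw_def)
  show "shift_perm k l \<rho> permutes {k..<k + l}" unfolding shift_perm_def
    by (rule map_permutation_permutes[OF b assms])
  show "sign (shift_perm k l \<rho>) = sign \<rho>" unfolding shift_perm_def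
    by (rule sign_map_permutation) (use assms in auto)
  show "shift_perm k l \<rho> (k + i) = k + \<rho> i" if "i < l" unfolding shift_perm_def
    by (rule map_permutation_apply) (use assms that in auto)
qed

lemma permute_list_drop:
  assumes "\<rho> permutes {..<l}" "length xs = k + l"
  shows "drop k (permute_list (shift_perm k l \<rho>) xs) = permute_list \<rho> (drop k xs)"
    and "take k (permute_list (shift_perm k l \<rho>) xs) = take k xs"
proof -
  show "drop k (permute_list (shift_perm k l \<rho>) xs) = permute_list \<rho> (drop k xs)"
    using assms permutes_in_image[OF assms(1)]
    by (intro nth_equalityI) (auto simp: permute_list_def shift_perm)
  show "take k (permute_list (shift_perm k l \<rho>) xs) = take k xs"
    using assms permutes_not_in[OF shift_perm(1)[OF assms(1), of k]]
    by (intro nth_equalityI) (auto simp: permute_list_def)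
qed

lemma Alt_tensor_right:
  fixes T S :: "'n::finite covec"
  shows "Alt (k + l) (tensor k T (Alt l S)) xs = fact l * Alt (k + l) (tensor k T S) xs"
proof -
  have "Alt (k + l) (tensor k T (Alt l S)) xs =
    Alt (k + l) (\<lambda>ys. \<Sum>\<rho> | \<rho> permutes {..<l}. of_int (sign \<rho>) * tensor k T S (permute_list (shift_perm k l \<rho>) ys)) xs"
  proof (rule Alt_cong)
    fix ys :: "(complex^'n) list" assume "length ys = k + l"
    then show "tensor k T (Alt l S) ys = (\<Sum>\<rho> | \<rho> permutes {..<l}. of_int (sign \<rho>) * tensor k T S (permute_list (shift_perm k l \<rho>) ys))"
      unfolding tensor_def Alt_def 
      by (auto intro!: sum.cong simp: permute_list_drop sum_distrib_left)
  qed
  also have "\<dots> = (\<Sum>\<rho> | \<rho> permutes {..<l}. of_int (sign \<rho>) * Alt (k + l) (\<lambda>ys. tensor k T S (permute_list (shift_perm k l \<rho>) ys)) xs)"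
    by (rule Alt_sum)
  also have "\<dots> = (\<Sum>\<rho> | \<rho> permutes {..<l}. Alt (k + l) (tensor k T S) xs)"
  proof (rule sum.cong)
    fix \<rho> assume r: "\<rho> \<in> {\<rho>. \<rho> permutes {..<l}}"
    then have "shift_perm k l \<rho> permutes {..<k + l}"
      using permutes_subset[OF shift_perm(1), of \<rho> l k "{..<k+l}"] by (auto simp: subset_iff)
    then show "of_int (sign \<rho>) * Alt (k + l) (\<lambda>ys. tensor k T S (permute_list (shift_perm k l \<rho>) ys)) xs = Alt (k + l) (tensor k T S) xs"
      using r by (simp add: Alt_permute shift_perm sign_mult_self)
  qed simp
  finally show ?thesis by (simp add: card_permutes)
qed

lemma Alt_scale: "Alt n (\<lambda>ys. c * T ys) xs = c * Alt n T xs"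
  using Alt_sum[of n "\<lambda>_. c" "\<lambda>_. T" "{()}"] by simp

lemma tensor_assoc: "tensor (k + l) (tensor k \<alpha> \<beta>) \<gamma> = tensor k \<alpha> (tensor l \<beta> \<gamma>)"
  by (rule ext) (simp add: tensor_def drop_take add.commute[of k l])

text \<open>Both sides are multiples of the alternation of \<open>\<alpha> \<otimes> \<beta> \<otimes> \<gamma>\<close>.\<close>

lemma wedge_assoc:
  "wedge (k + l) p (wedge k l \<alpha> \<beta>) \<gamma> xs = wedge k (l + p) \<alpha> (wedge l p \<beta> \<gamma>) xs"
proof -
  have 1: "tensor (k + l) (wedge k l \<alpha> \<beta>) \<gamma> = (\<lambda>ys. (1 / (fact k * fact l)) * tensor (k + l) (Alt (k + l) (tensor k \<alpha> \<beta>)) \<gamma> ys)"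
    by (auto simp: tensor_def wedge_Alt)
  have 2: "tensor k \<alpha> (wedge l p \<beta> \<gamma>) = (\<lambda>ys. (1 / (fact l * fact p)) * tensor k \<alpha> (Alt (l + p) (tensor l \<beta> \<gamma>)) ys)"
    by (auto simp: tensor_def wedge_Alt)
  show ?thesis
    unfolding wedge_Alt[of "k + l"] wedge_Alt[of k "l + p"] 1 2 Alt_scale Alt_tensor_left
    unfolding add.assoc Alt_tensor_right unfolding tensor_assoc
    by (simp add: divide_simps)
qed

text \<open>As a permutation of positions it carries the head of a list behind the next k entries.
  It is a product of k adjacent transpositions, which gives the sign.\<close>

definition rot :: "nat \<Rightarrow> nat \<Rightarrow> nat" where
  "rot k i = (if i < k then Suc i else if i = k then 0 else i)"

lemma rot_Suc: "rot (Suc k) = rot k \<circ> Transposition.transpose k (Suc k)"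
  by (auto simp: rot_def Transposition.transpose_def fun_eq_iff)

lemma rot_permutes: "rot k permutes {..<Suc k}"
proof (induction k)
  case 0
  have "rot 0 = id" by (auto simp: rot_def fun_eq_iff)
  then show ?case by (metis permutes_id)
next
  case (Suc k)
  show ?case unfolding rot_Suc
    by (intro permutes_compose permutes_swap_id) (use permutes_subset[OF Suc, of "{..<Suc (Suc k)}"] in auto)
qed

lemma sign_rot: "sign (rot k) = (-1) ^ k"
proof (induction k)
  case 0
  have "rot 0 = id" by (auto simp: rot_def fun_eq_iff)
  then show ?case by simp
next
  case (Suc k)
  have "permutation (rot k)" using rot_permutes permutes_permutation by blast
  then show ?case unfolding rot_Suc by (subst sign_compose) (auto simp: permutation_swap_id sign_swap_id Suc)
qed

lemma permute_list_rot: "length xs = k \<Longrightarrow> permute_list (rot k) (x # xs) = xs @ [x]"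
  by (rule nth_equalityI) (auto simp: permute_list_def rot_def nth_append less_Suc_eq)

text \<open>The cycle \<open>rot k\<close> exchanges the two tensor products, and its sign is the
  power of -1.\<close>

lemma wedge_commute_1:
  fixes \<alpha> :: "'n::finite covec"
  shows "wedge k 1 \<alpha> \<theta> xs = (-1) ^ k * wedge 1 k \<theta> \<alpha> xs"
proof -
  have "Alt (k + 1) (\<lambda>ys. tensor k \<alpha> \<theta> (permute_list (rot k) ys)) xs = (-1) ^ k * Alt (k + 1) (tensor k \<alpha> \<theta>) xs"
    using Alt_permute[of "rot k" "k + 1" "tensor k \<alpha> \<theta>" xs] rot_permutes[of k] by (simp add: sign_rot)
  moreover have "Alt (k + 1) (\<lambda>ys. tensor k \<alpha> \<theta> (permute_list (rot k) ys)) xs = Alt (k + 1) (tensor 1 \<theta> \<alpha>) xs"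
  proof (rule Alt_cong)
    fix ys :: "(complex^'n) list" assume "length ys = k + 1"
    then obtain y zs where "ys = y # zs" "length zs = k" by (cases ys) auto
    then show "tensor k \<alpha> \<theta> (permute_list (rot k) ys) = tensor 1 \<theta> \<alpha> ys"
      by (simp add: permute_list_rot tensor_def)
  qed
  ultimately have "Alt (k + 1) (tensor k \<alpha> \<theta>) xs = (-1) ^ k * Alt (1 + k) (tensor 1 \<theta> \<alpha>) xs"
    by (cases "even k") (auto, metis minus_minus)
  then show ?thesis by (simp add: wedge_Alt)
qed

text \<open>By definition an alternating form only vanishes on repeated arguments. Inserting u + v
  in two slots and expanding gives the change of sign under a transposition, and transpositions
  generate all permutations.\<close>

lemma alt_form_permute:
  assumes "alt_form k \<alpha>" "\<sigma> permutes {..<k}" "length xs = k"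
  shows "\<alpha> (permute_list \<sigma> xs) = of_int (sign \<sigma>) * \<alpha> xs"
proof -
  have swap: "\<alpha> (permute_list (Transposition.transpose i j) ys) = - \<alpha> ys" if "i < j" "j < k" "length ys = k" for i j ys
  proof -
    let ?w = "\<lambda>u v. ys[i := u, j := v]"
    have add1: "\<alpha> (?w (u + u') v) = \<alpha> (?w u v) + \<alpha> (?w u' v)" for u u' v
    proof -
      have "\<alpha> ((ys[j := v])[i := 1 *s u + u']) = 1 * \<alpha> ((ys[j := v])[i := u]) + \<alpha> ((ys[j := v])[i := u'])"
        by (rule alt_form_update[OF assms(1)]) (use that in simp_all)
      then show ?thesis using that by (simp add: list_update_swap)
    qed
    have add2: "\<alpha> (?w u (v + v')) = \<alpha> (?w u v) + \<alpha> (?w u v')" for u v v'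
    proof -
      have "\<alpha> ((ys[i := u])[j := 1 *s v + v']) = 1 * \<alpha> ((ys[i := u])[j := v]) + \<alpha> ((ys[i := u])[j := v'])"
        by (rule alt_form_update[OF assms(1)]) (use that in simp_all)
      then show ?thesis by simp
    qed
    have z: "\<alpha> (?w u u) = 0" for u
      by (rule alt_form_repeated[OF assms(1), of _ i j]) (use that in simp_all)
    have "\<alpha> (?w u v) + \<alpha> (?w v u) = 0" for u v
      using z[of "u + v"] unfolding add1 unfolding add2 unfolding z by simp
    then have "\<alpha> (?w v u) = - \<alpha> (?w u v)" for u v by (metis minus_unique)
    moreover have "permute_list (Transposition.transpose i j) ys = ?w (ys ! j) (ys ! i)"
      using that by (intro nth_equalityI) (auto simp: permute_list_def Transposition.transpose_def nth_list_update)
    moreover have "?w (ys ! i) (ys ! j) = ys" using that by simp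
    ultimately show ?thesis by simp
  qed
  have swap': "\<alpha> (permute_list (Transposition.transpose i j) ys) = of_int (sign (Transposition.transpose i j)) * \<alpha> ys"
    if "i < k" "j < k" "length ys = k" for i j ys
  proof -
    consider "i = j" | "i < j" | "j < i" by linarith
    then show ?thesis
    proof cases
      case 3 then show ?thesis using swap[of j i ys] that by (simp add: sign_swap_id transpose_commute)
    qed (use that swap in \<open>auto simp: sign_swap_id\<close>)
  qed
  have "finite {..<k}" by simp
  with assms(2) show ?thesis using assms(3)
  proof (induction \<sigma> arbitrary: xs rule: permutes_induct)
    case (swap a b p)
    have p: "p permutes {..<length xs}" using swap by simp
    show ?case
      unfolding permute_list_compose[OF p] sign_compose[OF permutation_swap_id permutes_permutation[OF p]]
      using swap swap'[of a b xs] swap.IH[of "permute_list (Transposition.transpose a b) xs"] by simp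
  next
    case id
    then show ?case by simp
  qed
qed

lemma permute_list_rot_le:
  "b \<le> length xs \<Longrightarrow> permute_list (rot b) (x # xs) = take b xs @ x # drop b xs"
  by (rule nth_equalityI)
    (auto simp: permute_list_def rot_def nth_append nth_Cons min_def Suc_diff_le split: nat.split, metis le_antisym not_less less_Suc_eq_le)

lemma alt_form_move:
  assumes "alt_form k \<alpha>" "length xs + 1 = k" "b \<le> length xs"
  shows "\<alpha> (take b xs @ x # drop b xs) = (-1) ^ b * \<alpha> (x # xs)"
proof -
  have "rot b permutes {..<k}"
    using permutes_subset[OF rot_permutes, of b "{..<k}"] assms by (auto simp: subset_iff)
  then show ?thesis
    using alt_form_permute[OF assms(1), of "rot b" "x # xs"] assms by (simp add: permute_list_rot_le sign_rot)
qed

text \<open>The permutations are sorted by the argument b that reaches \<theta>. Each is the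
  transposition of 0 and b followed by a permutation of the remaining k slots; \<alpha> absorbs the
  latter together with its sign, and the k! equal terms cancel the denominator.\<close>

lemma wedge_1_eq:
  fixes \<alpha> :: "'n::finite covec"
  assumes "alt_form k \<alpha>"
  shows "wedge 1 k \<theta> \<alpha> xs = (if length xs = Suc k then
    (\<Sum>s<Suc k. (-1) ^ s * \<theta> [xs ! s] * \<alpha> (take s xs @ drop (Suc s) xs)) else 0)"
proof (cases "length xs = Suc k")
  case True
  let ?S = "{1..<Suc k}"
  let ?f = "\<lambda>\<sigma>. of_int (sign \<sigma>) * tensor 1 \<theta> \<alpha> (permute_list \<sigma> xs)"
  have ins: "{..<Suc k} = insert 0 ?S" by auto
  have f: "?f (Transposition.transpose 0 b \<circ> q) = (-1) ^ b * \<theta> [xs ! b] * \<alpha> (take b xs @ drop (Suc b) xs)"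
    if b: "b < Suc k" and q: "q permutes ?S" for b q
  proof -
    let ?ys = "permute_list (Transposition.transpose 0 b) xs"
    have bij: "bij_betw (\<lambda>i. i - 1) ?S {..<k}"
      by (rule bij_betwI[where g = Suc]) auto
    define \<rho> where "\<rho> = map_permutation ?S (\<lambda>i. i - 1) q"
    have \<rho>: "\<rho> permutes {..<k}" unfolding \<rho>_def by (rule map_permutation_permutes[OF bij q])
    have q': "q = shift_perm 1 k \<rho>" unfolding shift_perm_def \<rho>_def
      by (rule map_permutation_compose_inv[OF bij q, symmetric]) auto
    have qk: "q permutes {..<Suc k}" using permutes_subset[OF q] by (auto simp: subset_iff)
    have t: "Transposition.transpose 0 b permutes {..<Suc k}" using b by (intro permutes_transpose_lt) auto
    have sg: "sign (Transposition.transpose 0 b \<circ> q) = sign (Transposition.transpose 0 b) * sign \<rho>"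
      using shift_perm(2)[OF \<rho>, of 1]
      unfolding q'[symmetric] by (simp add: sign_compose permutes_permutation[OF t] permutes_permutation[OF qk])
    have tk: "take 1 (permute_list q ?ys) = [xs ! b]"
    proof -
      have "take 1 (permute_list q ?ys) = take 1 ?ys"
        unfolding q' by (rule permute_list_drop(2)[OF \<rho>]) (simp add: True)
      also have "\<dots> = [?ys ! 0]" using True by (cases ?ys) (auto simp: permute_list_def simp del: upt_Suc)
      also have "?ys ! 0 = xs ! b" using True by (simp add: permute_list_def del: upt_Suc)
      finally show ?thesis .
    qed
    have dr: "\<alpha> (drop 1 (permute_list q ?ys)) = of_int (sign \<rho>) * \<alpha> (drop 1 ?ys)"
      using permute_list_drop(1)[OF \<rho>, of ?ys 1] True alt_form_permute[OF assms \<rho>, of "drop 1 ?ys"]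
      unfolding q'[symmetric] by simp
    \<comment> \<open>After the transposition the old head occupies position b - 1 of the remaining
      list. Moving it back to the front gives (-1)^(b - 1), the transposition itself one more sign;
      for b = 0 there is neither.\<close>
    have "of_int (sign (Transposition.transpose 0 b)) * \<alpha> (drop 1 ?ys) = (-1) ^ b * \<alpha> (take b xs @ drop (Suc b) xs)"
    proof (cases b)
      case 0
      then show ?thesis by (simp add: drop_Suc)
    next
      case (Suc c)
      obtain x zs where xs: "xs = x # zs" using True by (cases xs) auto
      have "drop 1 ?ys = take c (take c zs @ drop (Suc c) zs) @ x # drop c (take c zs @ drop (Suc c) zs)"
      proof -
        have "drop 1 ?ys = zs[c := x]"
          using True Suc b unfolding xs
          by (intro nth_equalityI) (auto simp: permute_list_def Transposition.transpose_def nth_list_update simp del: upt_Suc)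
        also have "\<dots> = take c (take c zs @ drop (Suc c) zs) @ x # drop c (take c zs @ drop (Suc c) zs)"
          using True Suc b unfolding xs by (simp add: upd_conv_take_nth_drop)
        finally show ?thesis .
      qed
      then have "\<alpha> (drop 1 ?ys) = (-1) ^ c * \<alpha> (x # take c zs @ drop (Suc c) zs)"
        using alt_form_move[OF assms, of "take c zs @ drop (Suc c) zs" c x] True Suc b xs by (simp add: min_def)
      then show ?thesis using Suc xs by (simp add: sign_swap_id)
    qed
    then show ?thesis
      unfolding permute_list_compose[OF qk[folded True]] tensor_def tk dr sg
      by (simp add: algebra_simps sign_mult_self)
  qed
  have "(\<Sum>\<sigma> | \<sigma> permutes {..<Suc k}. ?f \<sigma>) = (\<Sum>b\<in>{..<Suc k}. \<Sum>q | q permutes ?S. ?f (Transposition.transpose 0 b \<circ> q))"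
    unfolding ins by (rule sum_over_permutations_insert) auto
  also have "\<dots> = (\<Sum>b\<in>{..<Suc k}. \<Sum>q | q permutes ?S. (-1) ^ b * \<theta> [xs ! b] * \<alpha> (take b xs @ drop (Suc b) xs))"
    by (intro sum.cong refl f) auto
  also have "\<dots> = fact k * (\<Sum>b<Suc k. (-1) ^ b * \<theta> [xs ! b] * \<alpha> (take b xs @ drop (Suc b) xs))"
    using card_permutations[of ?S k] by (simp add: sum_distrib_left del: sum.lessThan_Suc)
  finally show ?thesis using True by (simp add: wedge_Alt Alt_def del: sum.lessThan_Suc)
qed (simp add: wedge_Alt Alt_def)

lemma wedge_11: 
  assumes "alt_form 1 \<beta>" shows "wedge 1 1 \<alpha> \<beta> [x, y] = \<alpha> [x] * \<beta> [y] - \<alpha> [y] * \<beta> [x]"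
  unfolding wedge_1_eq[OF assms] by simp

lemma wedge_length: "length xs \<noteq> k + l \<Longrightarrow> wedge k l \<alpha> \<beta> xs = 0"
  by (simp add: wedge_def)

lemma wedge_sum_left: "wedge k l (\<lambda>ys. \<Sum>p\<in>P. c p * \<alpha> p ys) \<beta> xs = (\<Sum>p\<in>P. c p * wedge k l (\<alpha> p) \<beta> xs)"
proof -
  have "tensor k (\<lambda>ys. \<Sum>p\<in>P. c p * \<alpha> p ys) \<beta> = (\<lambda>ys. \<Sum>p\<in>P. c p * tensor k (\<alpha> p) \<beta> ys)"
    by (auto simp: tensor_def sum_distrib_right mult.assoc)
  then show ?thesis by (simp add: wedge_Alt Alt_sum sum_divide_distrib)
qed

lemma wedge_sum_right: "wedge k l \<alpha> (\<lambda>ys. \<Sum>p\<in>P. c p * \<beta> p ys) xs = (\<Sum>p\<in>P. c p * wedge k l \<alpha> (\<beta> p) xs)"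
proof -
  have "tensor k \<alpha> (\<lambda>ys. \<Sum>p\<in>P. c p * \<beta> p ys) = (\<lambda>ys. \<Sum>p\<in>P. c p * tensor k \<alpha> (\<beta> p) ys)"
    by (auto simp: tensor_def sum_distrib_left mult_ac)
  then show ?thesis by (simp add: wedge_Alt Alt_sum sum_divide_distrib)
qed

lemma wedge_sum_left1: "wedge k l (\<lambda>ys. \<Sum>p\<in>P. \<alpha> p ys) \<beta> xs = (\<Sum>p\<in>P. wedge k l (\<alpha> p) \<beta> xs)"
  using wedge_sum_left[where c = "\<lambda>_. 1"] by simp

lemma wedge_sum_right1: "wedge k l \<alpha> (\<lambda>ys. \<Sum>p\<in>P. \<beta> p ys) xs = (\<Sum>p\<in>P. wedge k l \<alpha> (\<beta> p) xs)"
  using wedge_sum_right[where c = "\<lambda>_. 1"] by simp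

lemma wedge_scale_left: "wedge k l (\<lambda>ys. c * \<alpha> ys) \<beta> xs = c * wedge k l \<alpha> \<beta> xs"
  using wedge_sum_left[where P = "{()}" and c = "\<lambda>_. c"] by simp

lemma wedge_scale_right: "wedge k l \<alpha> (\<lambda>ys. c * \<beta> ys) xs = c * wedge k l \<alpha> \<beta> xs"
  using wedge_sum_right[where P = "{()}" and c = "\<lambda>_. c"] by simp

lemma wedge_add_left: "wedge k l (\<lambda>ys. \<alpha> ys + \<alpha>' ys) \<beta> xs = wedge k l \<alpha> \<beta> xs + wedge k l \<alpha>' \<beta> xs"
  using wedge_sum_left1[where P = UNIV and \<alpha> = "\<lambda>b. if b then \<alpha> else \<alpha>'"] by (simp add: UNIV_bool add.commute)

lemma wedge_add_right: "wedge k l \<alpha> (\<lambda>ys. \<beta> ys + \<beta>' ys) xs = wedge k l \<alpha> \<beta> xs + wedge k l \<alpha> \<beta>' xs"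
  using wedge_sum_right1[where P = UNIV and \<beta> = "\<lambda>b. if b then \<beta> else \<beta>'"] by (simp add: UNIV_bool add.commute)

lemma lists_Suc_sum:
  "(\<Sum>I | length I = Suc k \<and> set I \<subseteq> P. f I) = (\<Sum>p\<in>P. \<Sum>I | length I = k \<and> set I \<subseteq> P. f (p # I))"
proof -
  have "{I. length I = Suc k \<and> set I \<subseteq> P} = (\<lambda>(p, I). p # I) ` (P \<times> {I. length I = k \<and> set I \<subseteq> P})"
    by (auto simp: length_Suc_conv image_iff)
  then have "(\<Sum>I | length I = Suc k \<and> set I \<subseteq> P. f I) = (\<Sum>(p, I)\<in>P \<times> {I. length I = k \<and> set I \<subseteq> P}. f (p # I))"
    by (subst sum.reindex_cong[where B = "P \<times> {I. length I = k \<and> set I \<subseteq> P}" and l = "\<lambda>(p, I). p # I" and h = "\<lambda>(p, I). f (p # I)"])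
       (auto simp: inj_on_def)
  then show ?thesis by (simp add: sum.cartesian_product)
qed

text \<open>Arguments are given by their coefficient functions, so that one expansion serves
  arbitrary vectors, the rows of a matrix and the basis raised by the inverse Gram matrix.\<close>

lemma multilin_expand:
  "multilin k T \<Longrightarrow> length cs = k \<Longrightarrow> T (map (\<lambda>c. \<Sum>p\<in>P. c p *s u p) cs) =
    (\<Sum>I | length I = k \<and> set I \<subseteq> P. (\<Prod>l<k. (cs ! l) (I ! l)) * T (map u I))"
proof (induction cs arbitrary: k T)
  case Nil
  have "{I. length I = 0 \<and> set I \<subseteq> P} = {[]}" by auto
  then show ?case using Nil by simp
next
  case (Cons c cs)
  then obtain q where q: "k = Suc q" "length cs = q" by auto
  have "T (map (\<lambda>c. \<Sum>p\<in>P. c p *s u p) (c # cs)) = (\<Sum>p\<in>P. c p * T (u p # map (\<lambda>c. \<Sum>p\<in>P. c p *s u p) cs))"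
    using multilin_sum[OF Cons.prems(1), of "[]" "map (\<lambda>c. \<Sum>p\<in>P. c p *s u p) cs"] q by simp
  also have "\<dots> = (\<Sum>p\<in>P. c p * (\<Sum>I | length I = q \<and> set I \<subseteq> P. (\<Prod>l<q. (cs ! l) (I ! l)) * T (u p # map u I)))"
    using Cons.IH[OF multilin_Cons] Cons.prems(1) q by simp
  finally show ?case
    unfolding q(1) lists_Suc_sum by (simp add: sum_distrib_left prod.lessThan_Suc_shift mult.assoc del: prod.lessThan_Suc)
qed

lemma vec_axis_sum: "(\<Sum>p\<in>UNIV. (x $ p) *s axis p 1) = (x :: complex^'n::finite)"
  by (simp add: vec_eq_iff axis_def if_distrib cong: if_cong)

text \<open>Too long a list of basis vectors repeats one of them, so the expansion in the standard
  basis has only zero terms.\<close>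

lemma alt_form_above_top:
  fixes \<alpha> :: "'n::finite covec"
  assumes "alt_form k \<alpha>" "CARD('n) < k"
  shows "\<alpha> xs = 0"
proof (cases "length xs = k")
  case True
  have "\<alpha> (map (\<lambda>c. \<Sum>p\<in>UNIV. c p *s axis p 1) (map (\<lambda>x. ($) x) xs)) =
    (\<Sum>I | length I = k \<and> set I \<subseteq> UNIV. (\<Prod>l<k. (map (\<lambda>x. ($) x) xs ! l) (I ! l)) * \<alpha> (map (\<lambda>p. axis p 1) I))"
    using True by (intro multilin_expand alt_form_multilin assms) auto
  also have "\<dots> = 0"
  proof (rule sum.neutral, safe)
    fix I :: "'n list" assume I: "k = length I"
    have "\<not> distinct I"
      using assms(2) I card_mono[of UNIV "set I"] distinct_card[of I] by auto
    then obtain i j where "i < j" "j < length I" "I ! i = I ! j"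
      by (metis distinct_conv_nth linorder_neqE_nat)
    then have "\<alpha> (map (\<lambda>p. axis p 1) I) = 0"
      by (intro alt_form_repeated[OF assms(1), of _ i j]) (use I in simp_all)
    then show "(\<Prod>l<length I. (map (\<lambda>x. ($) x) xs ! l) (I ! l)) * \<alpha> (map (\<lambda>p. axis p 1) I) = 0" by simp
  qed
  finally show ?thesis by (simp add: comp_def vec_axis_sum)
qed (rule alt_form_length[OF assms(1)])

lemma alt_form_contract: assumes "alt_form (Suc k) \<alpha>" shows "alt_form k (\<lambda>xs. \<alpha> (x # xs))"
proof (rule alt_formI)
  fix xs :: "(complex^'a) list" and i j
  assume "length xs = k" "i < j" "j < k" "xs ! i = xs ! j"
  then have "(x # xs) ! Suc i = (x # xs) ! Suc j" "Suc i < Suc j" "Suc j < Suc k" "length (x # xs) = Suc k" by auto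
  then show "\<alpha> (x # xs) = 0" by (intro alt_form_repeated[OF assms, of _ "Suc i" "Suc j"])
qed (auto simp: alt_form_length[OF assms] multilin_Cons alt_form_multilin[OF assms])

section \<open>The exterior derivative\<close>

definition dx :: "'n \<Rightarrow> 'n::finite covec" where
  "dx i xs = (case xs of [v] \<Rightarrow> v $ i | _ \<Rightarrow> 0)"

definition pd :: "'n \<Rightarrow> 'n::finite form \<Rightarrow> 'n form" where
  "pd i \<alpha> z xs = frechet_derivative (\<lambda>y. \<alpha> y xs) (at z) (axis i 1)"

lemma alt_form_dx: "alt_form 1 (dx i)"
proof (rule alt_formI)
  show "multilin 1 (dx i)" by (auto simp: multilin_def dx_def)
qed (auto simp: dx_def split: list.splits)

lemma hol_form_alt: "hol_form k S \<alpha> \<Longrightarrow> z \<in> S \<Longrightarrow> alt_form k (\<alpha> z)"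
  by (simp add: hol_form_def)

lemma hol_form_hol: "hol_form k S \<alpha> \<Longrightarrow> hol S (\<lambda>z. \<alpha> z xs)"
  by (simp add: hol_form_def)

lemma frechet_sum: "(\<And>i. i \<in> I \<Longrightarrow> hol S (f i)) \<Longrightarrow> z \<in> S \<Longrightarrow>
  frechet_derivative (\<lambda>y. \<Sum>i\<in>I. f i y) (at z) v = (\<Sum>i\<in>I. frechet_derivative (f i) (at z) v)"
  using fun_cong[OF frechet_derivative_at[OF has_derivative_sum[OF hol_has_derivative[of S _ z]]], of I f v] by simp

lemma frechet_add: "hol S f \<Longrightarrow> hol S g \<Longrightarrow> z \<in> S \<Longrightarrow>
  frechet_derivative (\<lambda>y. f y + g y) (at z) v = frechet_derivative f (at z) v + frechet_derivative g (at z) v"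
  using fun_cong[OF frechet_derivative_at[OF has_derivative_add[OF hol_has_derivative hol_has_derivative], of S f z S g], of v] by simp

lemma frechet_mult: "hol S f \<Longrightarrow> hol S g \<Longrightarrow> z \<in> S \<Longrightarrow>
  frechet_derivative (\<lambda>y. f y * g y) (at z) v = f z * frechet_derivative g (at z) v + frechet_derivative f (at z) v * g z"
  using fun_cong[OF frechet_derivative_at[OF has_derivative_mult[OF hol_has_derivative hol_has_derivative], of S f z S g], of v] by simp

lemma frechet_cmult: "hol S f \<Longrightarrow> z \<in> S \<Longrightarrow>
  frechet_derivative (\<lambda>y. c * f y) (at z) v = c * frechet_derivative f (at z) v"
  using frechet_mult[OF hol_const[of S c], of f z v] by simp

lemma frechet_cong: "open S \<Longrightarrow> z \<in> S \<Longrightarrow> (\<And>y. y \<in> S \<Longrightarrow> f y = g y) \<Longrightarrow> hol S f \<Longrightarrow>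
  frechet_derivative f (at z) = frechet_derivative g (at z)"
  by (rule frechet_derivative_at[OF has_derivative_transform_within_open[OF hol_has_derivative[of S f]]]) auto

lemma hol_frechet_axis:
  "hol S f \<Longrightarrow> z \<in> S \<Longrightarrow> frechet_derivative f (at z) v = (\<Sum>i\<in>UNIV. v $ i * frechet_derivative f (at z) (axis i 1))"
  for v :: "complex^'n::finite"
proof -
  assume h: "hol S f" "z \<in> S"
  have "frechet_derivative f (at z) (\<Sum>i\<in>UNIV. v $ i *s axis i 1) = (\<Sum>i\<in>UNIV. v $ i * frechet_derivative f (at z) (axis i 1))"
    using linear_sum[OF bounded_linear.linear[OF hol_bounded_linear[OF h]], of "\<lambda>i. v $ i *s axis i 1"] hol_linear[OF h] by simp
  then show ?thesis by (simp add: vec_axis_sum)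
qed

text \<open>The identities that make a covector alternating hold throughout an open set and can
  therefore be differentiated.\<close>

lemma hol_form_pd:
  fixes \<alpha> :: "'n::finite form"
  assumes "open S" "hol_form k S \<alpha>" shows "hol_form k S (pd i \<alpha>)"
  unfolding hol_form_def
proof (intro conjI ballI allI)
  fix z assume z: "z \<in> S"
  note h = hol_form_hol[OF assms(2)]
  show "alt_form k (pd i \<alpha> z)"
  proof (rule alt_formI)
    fix xs :: "(complex^'n) list" assume l: "length xs \<noteq> k"
    have "\<And>y. y \<in> S \<Longrightarrow> \<alpha> y xs = 0" by (rule alt_form_length[OF hol_form_alt[OF assms(2)] l])
    from frechet_cong[OF assms(1) z this h[of xs]]
    show "pd i \<alpha> z xs = 0" unfolding pd_def by simp
  next
    fix xs :: "(complex^'n) list" and j l assume a: "length xs = k" "j < l" "l < k" "xs ! j = xs ! l"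
    have "\<And>y. y \<in> S \<Longrightarrow> \<alpha> y xs = 0" by (rule alt_form_repeated[OF hol_form_alt[OF assms(2)] a])
    from frechet_cong[OF assms(1) z this h[of xs]]
    show "pd i \<alpha> z xs = 0" unfolding pd_def by simp
  next
    show "multilin k (pd i \<alpha> z)" unfolding multilin_def
    proof (intro allI impI)
      fix ys zs :: "(complex^'n) list" and c u v assume l: "length ys + length zs + 1 = k"
      have "\<And>y. y \<in> S \<Longrightarrow> \<alpha> y (ys @ (c *s u + v) # zs) = c * \<alpha> y (ys @ u # zs) + \<alpha> y (ys @ v # zs)"
        by (rule multilinD[OF alt_form_multilin[OF hol_form_alt[OF assms(2)]] l])
      from frechet_cong[OF assms(1) z this h]
      have "pd i \<alpha> z (ys @ (c *s u + v) # zs) = frechet_derivative (\<lambda>y. c * \<alpha> y (ys @ u # zs) + \<alpha> y (ys @ v # zs)) (at z) (axis i 1)"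
        unfolding pd_def by simp
      also have "\<dots> = c * pd i \<alpha> z (ys @ u # zs) + pd i \<alpha> z (ys @ v # zs)"
        unfolding pd_def frechet_add[OF hol_cmult[OF h] h z] frechet_cmult[OF h z] ..
      finally show "pd i \<alpha> z (ys @ (c *s u + v) # zs) = c * pd i \<alpha> z (ys @ u # zs) + pd i \<alpha> z (ys @ v # zs)" .
    qed
  qed
next
  fix xs show "hol S (\<lambda>z. pd i \<alpha> z xs)" unfolding pd_def
    by (rule hol_deriv[OF assms(1) hol_form_hol[OF assms(2)]])
qed

lemma hol_form_sum: "(\<And>i. i \<in> I \<Longrightarrow> hol_form k S (\<alpha> i)) \<Longrightarrow> hol_form k S (\<lambda>z xs. \<Sum>i\<in>I. \<alpha> i z xs)"
  unfolding hol_form_def by (auto intro!: alt_form_sum hol_sum)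

lemma hol_form_add: "hol_form k S \<alpha> \<Longrightarrow> hol_form k S \<beta> \<Longrightarrow> hol_form k S (\<lambda>z xs. \<alpha> z xs + \<beta> z xs)"
  unfolding hol_form_def by (auto intro!: alt_form_add hol_add)

lemma hol_form_scale: "hol S f \<Longrightarrow> hol_form k S \<alpha> \<Longrightarrow> hol_form k S (\<lambda>z xs. f z * \<alpha> z xs)"
  unfolding hol_form_def by (auto intro!: alt_form_scale hol_mult)

lemma hol_form_const: "alt_form k \<alpha> \<Longrightarrow> hol_form k S (\<lambda>z. \<alpha>)"
  unfolding hol_form_def by (auto intro: hol_const)

lemma hol_wedge:
  assumes "\<And>xs. hol S (\<lambda>z. \<alpha> z xs)" "\<And>xs. hol S (\<lambda>z. \<beta> z xs)"
  shows "hol S (\<lambda>z. wedge k l (\<alpha> z) (\<beta> z) xs)"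
proof (cases "length xs = k + l")
  case True then show ?thesis unfolding wedge_def divide_inverse
    by (simp, intro hol_mult hol_sum hol_const assms)
qed (simp add: wedge_def hol_const)

lemma hol_form_wedge:
  assumes "hol_form k S \<alpha>" "hol_form l S \<beta>" shows "hol_form (k + l) S (\<lambda>z. wedge k l (\<alpha> z) (\<beta> z))"
  unfolding hol_form_def
  by (intro conjI ballI allI hol_wedge hol_form_hol[OF assms(1)] hol_form_hol[OF assms(2)]
    alt_form_wedge alt_form_multilin hol_form_alt[OF assms(1)] hol_form_alt[OF assms(2)])

lemma pd_wedge:
  assumes "hol_form k S \<alpha>" "hol_form l S \<beta>" "z \<in> S"
  shows "pd i (\<lambda>y. wedge k l (\<alpha> y) (\<beta> y)) z xs = wedge k l (pd i \<alpha> z) (\<beta> z) xs + wedge k l (\<alpha> z) (pd i \<beta> z) xs"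
proof (cases "length xs = k + l")
  case True
  note h = hol_form_hol[OF assms(1)] and h' = hol_form_hol[OF assms(2)]
  have "pd i (\<lambda>y. wedge k l (\<alpha> y) (\<beta> y)) z xs =
    inverse (fact k * fact l) * frechet_derivative (\<lambda>y. \<Sum>\<sigma> | \<sigma> permutes {..<k + l}. of_int (sign \<sigma>)
            * (\<alpha> y (map (\<lambda>s. xs ! \<sigma> s) [0..<k]) * \<beta> y (map (\<lambda>s. xs ! \<sigma> s) [k..<k + l]))) (at z) (axis i 1)"
    unfolding pd_def wedge_def using True
    by (subst frechet_cmult[OF _ assms(3), symmetric]) (auto intro!: hol_sum hol_cmult hol_mult h h' simp: field_simps)
  also have "\<dots> = inverse (fact k * fact l) * (\<Sum>\<sigma> | \<sigma> permutes {..<k + l}. of_int (sign \<sigma>)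
            * (\<alpha> z (map (\<lambda>s. xs ! \<sigma> s) [0..<k]) * pd i \<beta> z (map (\<lambda>s. xs ! \<sigma> s) [k..<k + l])
             + pd i \<alpha> z (map (\<lambda>s. xs ! \<sigma> s) [0..<k]) * \<beta> z (map (\<lambda>s. xs ! \<sigma> s) [k..<k + l])))"
    by (subst frechet_sum[OF _ assms(3)])
       (auto intro!: hol_cmult hol_mult h h' simp: frechet_cmult[OF hol_mult[OF h h'] assms(3)] frechet_mult[OF h h' assms(3)] pd_def)
  finally show ?thesis
    using True by (simp add: wedge_def field_simps sum.distrib)
next
  case False
  then have "wedge k l a b xs = 0" for a b by (rule wedge_length)
  then show ?thesis by (simp add: pd_def)
qed

text \<open>Complex linearity of the derivative allows splitting it along the complex coordinates.
  The Leibniz rule and d d = 0 then reduce to the algebra of \<open>wedge\<close>, the product rule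
  and the symmetry of second derivatives.\<close>

lemma ext_d_eq:
  assumes "open S" "hol_form k S \<alpha>" "z \<in> S"
  shows "ext_d k \<alpha> z = (\<lambda>xs. \<Sum>i\<in>UNIV. wedge 1 k (dx i) (pd i \<alpha> z) xs)"
proof
  fix xs
  have a: "alt_form k (pd i \<alpha> z)" for i using hol_form_alt[OF hol_form_pd[OF assms(1,2)] assms(3)] .
  have *: "frechet_derivative (\<lambda>y. \<alpha> y ys) (at z) v = (\<Sum>i\<in>UNIV. dx i [v] * pd i \<alpha> z ys)" for v ys
    unfolding hol_frechet_axis[OF hol_form_hol[OF assms(2)] assms(3), of ys v] by (simp add: dx_def pd_def)
  show "ext_d k \<alpha> z xs = (\<Sum>i\<in>UNIV. wedge 1 k (dx i) (pd i \<alpha> z) xs)"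
  proof (cases "length xs = Suc k")
    case True
    have "ext_d k \<alpha> z xs = (\<Sum>s<Suc k. \<Sum>i\<in>UNIV. (-1) ^ s * (dx i [xs ! s] * pd i \<alpha> z (take s xs @ drop (Suc s) xs)))"
      unfolding ext_d_def * using True by (simp only: simp_thms if_True sum_distrib_left)
    also have "\<dots> = (\<Sum>i\<in>UNIV. \<Sum>s<Suc k. (-1) ^ s * (dx i [xs ! s] * pd i \<alpha> z (take s xs @ drop (Suc s) xs)))"
      by (rule sum.swap)
    finally show ?thesis
      unfolding wedge_1_eq[OF a] using True by (simp only: simp_thms if_True mult.assoc)
  qed (simp add: ext_d_def wedge_length)
qed

lemma hol_form_ext_d:
  assumes "open S" "hol_form k S \<alpha>"
  shows "hol_form (Suc k) S (ext_d k \<alpha>)"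
proof -
  have "hol_form (Suc k) S (\<lambda>z xs. \<Sum>i\<in>UNIV. wedge 1 k (dx i) (pd i \<alpha> z) xs)"
    using hol_form_wedge[OF hol_form_const[OF alt_form_dx] hol_form_pd[OF assms]]
    by (intro hol_form_sum) simp
  then show ?thesis
    unfolding hol_form_def using ext_d_eq[OF assms] hol_cong[OF assms(1), of _ "\<lambda>z. ext_d k \<alpha> z xs" for xs] by simp
qed

text \<open>The product rule holds for each \<open>pd\<close>. In the second term
  \<open>dx i\<close> has to pass \<alpha>, which accounts for the sign.\<close>

lemma ext_d_wedge:
  assumes "open S" "hol_form k S \<alpha>" "hol_form l S \<beta>" "z \<in> S"
  shows "ext_d (k + l) (\<lambda>y. wedge k l (\<alpha> y) (\<beta> y)) z xs =
    wedge (Suc k) l (ext_d k \<alpha> z) (\<beta> z) xs + (-1) ^ k * wedge k (Suc l) (\<alpha> z) (ext_d l \<beta> z) xs"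
proof -
  have 1: "wedge 1 (k + l) (dx i) (pd i (\<lambda>y. wedge k l (\<alpha> y) (\<beta> y)) z) xs =
    wedge (Suc k) l (wedge 1 k (dx i) (pd i \<alpha> z)) (\<beta> z) xs +
    (-1) ^ k * wedge k (Suc l) (\<alpha> z) (wedge 1 l (dx i) (pd i \<beta> z)) xs" for i
  proof -
    have p: "pd i (\<lambda>y. wedge k l (\<alpha> y) (\<beta> y)) z = (\<lambda>xs. wedge k l (pd i \<alpha> z) (\<beta> z) xs + wedge k l (\<alpha> z) (pd i \<beta> z) xs)"
      by (rule ext) (rule pd_wedge[OF assms(2-4)])
    have c: "wedge 1 k (dx i) (\<alpha> z) = (\<lambda>xs. (-1) ^ k * wedge k 1 (\<alpha> z) (dx i) xs)"
      by (rule ext) (simp only: wedge_commute_1 mult.assoc[symmetric] power_mult_distrib[symmetric], simp)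
    have "wedge 1 (k + l) (dx i) (wedge k l (\<alpha> z) (pd i \<beta> z)) xs = wedge (1 + k) l (wedge 1 k (dx i) (\<alpha> z)) (pd i \<beta> z) xs"
      by (rule wedge_assoc[symmetric])
    also have "\<dots> = (-1) ^ k * wedge (k + 1) l (wedge k 1 (\<alpha> z) (dx i)) (pd i \<beta> z) xs"
      unfolding c by (simp add: wedge_scale_left)
    also have "\<dots> = (-1) ^ k * wedge k (Suc l) (\<alpha> z) (wedge 1 l (dx i) (pd i \<beta> z)) xs"
      unfolding wedge_assoc by simp
    finally show ?thesis
      unfolding p wedge_add_right by (simp add: wedge_assoc[of 1 k l, simplified, symmetric])
  qed
  have "ext_d (k + l) (\<lambda>y. wedge k l (\<alpha> y) (\<beta> y)) z xs =
    (\<Sum>i\<in>UNIV. wedge 1 (k + l) (dx i) (pd i (\<lambda>y. wedge k l (\<alpha> y) (\<beta> y)) z) xs)"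
    unfolding ext_d_eq[OF assms(1) hol_form_wedge[OF assms(2,3)] assms(4)] ..
  then show ?thesis
    unfolding ext_d_eq[OF assms(1,2,4)] ext_d_eq[OF assms(1,3,4)] wedge_sum_left1 wedge_sum_right1 1
    by (simp add: sum.distrib sum_distrib_left)
qed

lemma pd_commute:
  assumes "open S" "hol_form k S \<alpha>" "z \<in> S"
  shows "pd i (pd j \<alpha>) z xs = pd j (pd i \<alpha>) z xs"
  unfolding pd_def by (rule hol_deriv_commute[OF assms(1) hol_form_hol[OF assms(2)] assms(3)])

lemma wedge_dx_anti: "wedge 1 (Suc k) (dx i) (wedge 1 k (dx j) \<gamma>) xs = - wedge 1 (Suc k) (dx j) (wedge 1 k (dx i) \<gamma>) xs"
proof -
  have c: "wedge 1 1 (dx i) (dx j) = (\<lambda>xs. (-1) * wedge 1 1 (dx j) (dx i) xs)"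
    by (rule ext) (use wedge_commute_1[of 1 "dx i" "dx j"] in simp)
  show ?thesis
    using wedge_assoc[of 1 1 k "dx i" "dx j" \<gamma> xs] wedge_assoc[of 1 1 k "dx j" "dx i" \<gamma> xs]
    unfolding c wedge_scale_left by simp
qed

text \<open>The double sum pairs second derivatives, symmetric in the two directions, with products
  of coordinate forms, skew in them; it equals its own negative.\<close>

lemma ext_d_ext_d:
  assumes "open S" "hol_form k S \<alpha>" "z \<in> S"
  shows "ext_d (Suc k) (ext_d k \<alpha>) z xs = 0"
proof -
  have p: "pd i (ext_d k \<alpha>) z ys = (\<Sum>j\<in>UNIV. wedge 1 k (dx j) (pd i (pd j \<alpha>) z) ys)" for i ys
  proof -
    have w: "hol_form (1 + k) S (\<lambda>y. wedge 1 k (dx j) (pd j \<alpha> y))" for j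
      by (intro hol_form_wedge hol_form_const alt_form_dx hol_form_pd assms)
    have "pd i (ext_d k \<alpha>) z ys = frechet_derivative (\<lambda>y. \<Sum>j\<in>UNIV. wedge 1 k (dx j) (pd j \<alpha> y) ys) (at z) (axis i 1)"
      unfolding pd_def
      by (subst frechet_cong[OF assms(1,3) _ hol_form_hol[OF hol_form_ext_d[OF assms(1,2)]]])
         (use ext_d_eq[OF assms(1,2)] in \<open>auto simp: pd_def[abs_def]\<close>)
    also have "\<dots> = (\<Sum>j\<in>UNIV. pd i (\<lambda>y. wedge 1 k (dx j) (pd j \<alpha> y)) z ys)"
      by (subst frechet_sum[OF hol_form_hol[OF w] assms(3)]) (simp add: pd_def)
    also have "\<dots> = (\<Sum>j\<in>UNIV. wedge 1 k (dx j) (pd i (pd j \<alpha>) z) ys)"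
    proof (rule sum.cong[OF refl])
      fix j
      \<comment> \<open>The zero form is written as a scalar multiple so that the scaling rule for
        \<open>wedge\<close> applies to it.\<close>
      have "pd i (\<lambda>y. dx j) z = (\<lambda>xs. 0 * 0)" by (auto simp: pd_def)
      then show "pd i (\<lambda>y. wedge 1 k (dx j) (pd j \<alpha> y)) z ys = wedge 1 k (dx j) (pd i (pd j \<alpha>) z) ys"
        using pd_wedge[OF hol_form_const[OF alt_form_dx] hol_form_pd[OF assms(1,2)] assms(3), of i j j ys]
        by (simp only: wedge_scale_left) simp
    qed
    finally show ?thesis .
  qed
  let ?t = "\<lambda>i j. wedge 1 (Suc k) (dx i) (wedge 1 k (dx j) (pd i (pd j \<alpha>) z)) xs"
  have "ext_d (Suc k) (ext_d k \<alpha>) z xs = (\<Sum>i\<in>UNIV. \<Sum>j\<in>UNIV. ?t i j)"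
    unfolding ext_d_eq[OF assms(1) hol_form_ext_d[OF assms(1,2)] assms(3)] p[abs_def] wedge_sum_right1 ..
  moreover have "(\<Sum>i\<in>UNIV. \<Sum>j\<in>UNIV. ?t i j) = - (\<Sum>i\<in>UNIV. \<Sum>j\<in>UNIV. ?t i j)"
  proof -
    have "?t i j = - ?t j i" for i j
      using wedge_dx_anti[of k i j "pd i (pd j \<alpha>) z" xs] ext[where f = "pd i (pd j \<alpha>) z", OF pd_commute[OF assms, of i j]] by simp
    then have "(\<Sum>i\<in>UNIV. \<Sum>j\<in>UNIV. ?t i j) = (\<Sum>i\<in>UNIV. \<Sum>j\<in>UNIV. - ?t j i)" by (intro sum.cong refl)
    also have "\<dots> = - (\<Sum>i\<in>UNIV. \<Sum>j\<in>UNIV. ?t j i)" by (simp add: sum_negf)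
    also have "(\<Sum>i\<in>UNIV. \<Sum>j\<in>UNIV. ?t j i) = (\<Sum>i\<in>UNIV. \<Sum>j\<in>UNIV. ?t i j)" by (rule sum.swap)
    finally show ?thesis .
  qed
  ultimately show ?thesis by simp
qed

lemma ext_d_add:
  assumes "hol_form k S \<alpha>" "hol_form k S \<beta>" "z \<in> S"
  shows "ext_d k (\<lambda>y xs. \<alpha> y xs + \<beta> y xs) z xs = ext_d k \<alpha> z xs + ext_d k \<beta> z xs"
  unfolding ext_d_def
  by (simp add: frechet_add[OF hol_form_hol[OF assms(1)] hol_form_hol[OF assms(2)] assms(3)] sum.distrib algebra_simps del: sum.lessThan_Suc)

lemma ext_d_sum:
  assumes "\<And>i. i \<in> I \<Longrightarrow> hol_form k S (\<alpha> i)" "z \<in> S"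
  shows "ext_d k (\<lambda>y xs. \<Sum>i\<in>I. \<alpha> i y xs) z xs = (\<Sum>i\<in>I. ext_d k (\<alpha> i) z xs)"
  unfolding ext_d_def
  by (simp add: frechet_sum[OF hol_form_hol[OF assms(1)] assms(2)] sum_distrib_left del: sum.lessThan_Suc)
     (intro impI sum.swap)

lemma ext_d_cmult:
  assumes "hol_form k S \<alpha>" "z \<in> S"
  shows "ext_d k (\<lambda>y xs. c * \<alpha> y xs) z xs = c * ext_d k \<alpha> z xs"
  unfolding ext_d_def
  by (simp add: frechet_cmult[OF hol_form_hol[OF assms(1)] assms(2)] sum_distrib_left mult_ac del: sum.lessThan_Suc)

lemma ext_d_cong:
  assumes "open S" "z \<in> S" "hol_form k S \<alpha>" "\<And>y. y \<in> S \<Longrightarrow> \<alpha> y = \<beta> y"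
  shows "ext_d k \<alpha> z xs = ext_d k \<beta> z xs"
proof -
  have "frechet_derivative (\<lambda>y. \<alpha> y ys) (at z) = frechet_derivative (\<lambda>y. \<beta> y ys) (at z)" for ys
    by (rule frechet_cong[OF assms(1,2) _ hol_form_hol[OF assms(3)]]) (simp add: assms(4))
  then show ?thesis unfolding ext_d_def by simp
qed

section \<open>The Hodge operator\<close>

text \<open>In the expansion of a wedge with a one-form, the index belonging to the one-form may
  stand at any position s of the list; it has to be summed separately there.\<close>

lemma lists_insert_sum:
  fixes f :: "'n::finite list \<Rightarrow> complex"
  assumes "s \<le> k"
  shows "(\<Sum>I | length I = Suc k. f I) = (\<Sum>p\<in>UNIV. \<Sum>J | length J = k. f (take s J @ p # drop s J))"
proof -
  have "(\<Sum>p\<in>UNIV. \<Sum>J | length J = k. f (take s J @ p # drop s J)) =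
    (\<Sum>(p, J)\<in>UNIV \<times> {J. length J = k}. f (take s J @ p # drop s J))"
    by (rule sum.cartesian_product)
  also have "\<dots> = (\<Sum>I | length I = Suc k. f I)"
  proof (rule sum.reindex_bij_witness[where i = "\<lambda>I. (I ! s, take s I @ drop (Suc s) I)"
        and j = "\<lambda>(p, J). take s J @ p # drop s J"])
    fix a :: "'n \<times> 'n list" assume "a \<in> UNIV \<times> {J. length J = k}"
    then obtain p J where a: "a = (p, J)" "length J = k" by auto
    then show "((case a of (p, J) \<Rightarrow> take s J @ p # drop s J) ! s,
      take s (case a of (p, J) \<Rightarrow> take s J @ p # drop s J) @ drop (Suc s) (case a of (p, J) \<Rightarrow> take s J @ p # drop s J)) = a"
      using assms by (simp add: nth_append)
    show "(case a of (p, J) \<Rightarrow> take s J @ p # drop s J) \<in> {I. length I = Suc k}"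
      using a assms by simp
    show "f (case a of (p, J) \<Rightarrow> take s J @ p # drop s J) = (case a of (p, J) \<Rightarrow> f (take s J @ p # drop s J))"
      using a by simp
  next
    fix I :: "'n list" assume I: "I \<in> {I. length I = Suc k}"
    then show "(case (I ! s, take s I @ drop (Suc s) I) of (p, J) \<Rightarrow> take s J @ p # drop s J) = I"
      using assms by (simp add: id_take_nth_drop[symmetric])
    show "(I ! s, take s I @ drop (Suc s) I) \<in> UNIV \<times> {J. length J = k}"
      using I assms by simp
  qed
  finally show ?thesis by (rule sym)
qed

lemma alt_form_contract_list:
  "alt_form (length ys + k) \<alpha> \<Longrightarrow> alt_form k (\<lambda>xs. \<alpha> (ys @ xs))"
proof (induction ys arbitrary: \<alpha>)
  case (Cons y ys)
  have "alt_form (length ys + k) (\<lambda>xs. \<alpha> (y # xs))"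
    by (rule alt_form_contract) (use Cons.prems in simp)
  from Cons.IH[OF this] show ?case by simp
qed simp

text \<open>A bridge from the index lists in \<open>hodge\<close> to the permutations in
  \<open>det\<close>: lists of full length without repetition are the rearrangements of one
  enumeration, each obtained once.\<close>

lemma sum_distinct_lists:
  fixes f :: "'n::finite list \<Rightarrow> complex"
  assumes "distinct I0" "set I0 = UNIV" "length I0 = n"
    and z: "\<And>J. length J = n \<Longrightarrow> \<not> distinct J \<Longrightarrow> f J = 0"
  shows "(\<Sum>J | length J = n. f J) = (\<Sum>\<sigma> | \<sigma> permutes {..<n}. f (permute_list \<sigma> I0))"
proof -
  have fin: "finite {J :: 'n list. length J = n}"
    using finite_lists_length_eq[of "UNIV :: 'n set" n] by simp
  have card: "n = CARD('n)" using assms distinct_card[of I0] by simp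
  have "(\<Sum>J | length J = n. f J) = (\<Sum>J | length J = n \<and> distinct J. f J)"
    by (rule sum.mono_neutral_right[OF fin]) (auto intro: z)
  also have "{J. length J = n \<and> distinct J} = (\<lambda>\<sigma>. permute_list \<sigma> I0) ` {\<sigma>. \<sigma> permutes {..<n}}"
  proof (intro subset_antisym subsetI)
    fix J :: "'n list" assume J: "J \<in> {J. length J = n \<and> distinct J}"
    then have "card (set J) = CARD('n)" using card distinct_card[of J] by simp
    then have "set J = UNIV" by (intro card_subset_eq) auto
    then have "mset J = mset I0" using J assms set_eq_iff_mset_eq_distinct[of J I0] by simp
    then show "J \<in> (\<lambda>\<sigma>. permute_list \<sigma> I0) ` {\<sigma>. \<sigma> permutes {..<n}}"
      by (rule mset_eq_permutation) (use assms in auto)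
  next
    fix J assume "J \<in> (\<lambda>\<sigma>. permute_list \<sigma> I0) ` {\<sigma>. \<sigma> permutes {..<n}}"
    then show "J \<in> {J. length J = n \<and> distinct J}" using assms by auto
  qed
  also have "sum f \<dots> = (\<Sum>\<sigma> | \<sigma> permutes {..<n}. f (permute_list \<sigma> I0))"
  proof (rule sum.reindex_cong)
    show "inj_on (\<lambda>\<sigma>. permute_list \<sigma> I0) {\<sigma>. \<sigma> permutes {..<n}}"
    proof (rule inj_onI)
      fix \<sigma> \<tau> assume s: "\<sigma> \<in> {\<sigma>. \<sigma> permutes {..<n}}" and t: "\<tau> \<in> {\<sigma>. \<sigma> permutes {..<n}}"
        and eq: "permute_list \<sigma> I0 = permute_list \<tau> I0"
      show "\<sigma> = \<tau>"
      proof
        fix i show "\<sigma> i = \<tau> i"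
        proof (cases "i < n")
          case True
          have "I0 ! \<sigma> i = I0 ! \<tau> i"
            using arg_cong[OF eq, of "\<lambda>l. l ! i"] True assms by (simp add: permute_list_def)
          moreover have "\<sigma> i < n" "\<tau> i < n" using s t True permutes_in_image[of _ "{..<n}" i] by auto
          ultimately show ?thesis using assms nth_eq_iff_index_eq by blast
        next
          case False
          then show ?thesis using s t permutes_not_in[of \<sigma> "{..<n}" i] permutes_not_in[of \<tau> "{..<n}" i] by simp
        qed
      qed
    qed
  qed simp_all
  finally show ?thesis .
qed

text \<open>Expansion in the basis leaves the rearrangements of the enumeration, and skewness
  replaces each rearrangement by its sign, which is the Leibniz formula.\<close>

lemma alt_form_det:
  fixes vol :: "'n::finite covec" and A :: "complex^'n^'n"
  assumes vol: "alt_form n vol" and I0: "distinct I0" "set I0 = UNIV" "length I0 = n"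
  shows "vol (map (\<lambda>p. \<Sum>q\<in>UNIV. (A $ p $ q) *s axis q 1) I0) = det A * vol (map (\<lambda>p. axis p 1) I0)"
proof -
  let ?e = "map (\<lambda>p. axis p (1::complex))"
  have bij: "bij_betw ((!) I0) {..<n} UNIV"
    using I0 bij_betw_nth[of I0 "{..<n}" UNIV] by simp
  have "vol (map (\<lambda>p. \<Sum>q\<in>UNIV. (A $ p $ q) *s axis q 1) I0)
    = vol (map (\<lambda>c. \<Sum>q\<in>UNIV. c q *s axis q 1) (map (\<lambda>p q. A $ p $ q) I0))" by (simp add: comp_def)
  also have "\<dots> = (\<Sum>J | length J = n \<and> set J \<subseteq> UNIV. (\<Prod>l<n. (map (\<lambda>p q. A $ p $ q) I0 ! l) (J ! l)) * vol (?e J))"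
    by (rule multilin_expand) (simp_all add: alt_form_multilin vol I0)
  also have "\<dots> = (\<Sum>J | length J = n. (\<Prod>l<n. A $ (I0 ! l) $ (J ! l)) * vol (?e J))"
    using I0 by (intro sum.cong) auto
  also have "\<dots> = (\<Sum>\<sigma> | \<sigma> permutes {..<n}. (\<Prod>l<n. A $ (I0 ! l) $ (permute_list \<sigma> I0 ! l)) * vol (?e (permute_list \<sigma> I0)))"
  proof (rule sum_distinct_lists[OF I0])
    fix J :: "'n list" assume J: "length J = n" "\<not> distinct J"
    then obtain i j where ij: "i < j" "j < length J" "J ! i = J ! j"
      by (metis distinct_conv_nth linorder_neqE_nat)
    then have "vol (?e J) = 0" by (intro alt_form_repeated[OF vol, of _ i j]) (use J in simp_all)
    then show "(\<Prod>l<n. A $ (I0 ! l) $ (J ! l)) * vol (?e J) = 0" by simp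
  qed
  also have "\<dots> = (\<Sum>\<sigma> | \<sigma> permutes {..<n}. (of_int (sign \<sigma>) * (\<Prod>l<n. A $ (I0 ! l) $ (I0 ! \<sigma> l))) * vol (?e I0))"
  proof (rule sum.cong[OF refl])
    fix \<sigma> assume s: "\<sigma> \<in> {\<sigma>. \<sigma> permutes {..<n}}"
    have "?e (permute_list \<sigma> I0) = permute_list \<sigma> (?e I0)"
      using s I0 by (intro permute_list_map[symmetric]) auto
    then have "vol (?e (permute_list \<sigma> I0)) = of_int (sign \<sigma>) * vol (?e I0)"
      using alt_form_permute[OF vol, of \<sigma> "?e I0"] s I0 by simp
    then show "(\<Prod>l<n. A $ (I0 ! l) $ (permute_list \<sigma> I0 ! l)) * vol (?e (permute_list \<sigma> I0)) =
      (of_int (sign \<sigma>) * (\<Prod>l<n. A $ (I0 ! l) $ (I0 ! \<sigma> l))) * vol (?e I0)"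
      using I0 by (simp add: permute_list_def)
  qed
  also have "\<dots> = (\<Sum>\<sigma> | \<sigma> permutes {..<n}. of_int (sign \<sigma>) * (\<Prod>l<n. A $ (I0 ! l) $ (I0 ! \<sigma> l))) * vol (?e I0)"
    by (rule sum_distrib_right[symmetric])
  \<comment> \<open>The determinant sums over permutations of the index type, the lists over
    permutations of positions. They correspond along the enumeration \<open>I0\<close>, with equal
    signs.\<close>
  also have "(\<Sum>\<sigma> | \<sigma> permutes {..<n}. of_int (sign \<sigma>) * (\<Prod>l<n. A $ (I0 ! l) $ (I0 ! \<sigma> l))) = det A"
    unfolding det_def
    unfolding sum.reindex_bij_betw[OF bij_betw_permutations[OF bij], symmetric]
  proof -
    show "(\<Sum>\<sigma> | \<sigma> permutes {..<n}. of_int (sign \<sigma>) * (\<Prod>l<n. A $ (I0 ! l) $ (I0 ! \<sigma> l))) =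
     (\<Sum>\<sigma> | \<sigma> permutes {..<n}. of_int (sign (\<lambda>x. if x \<in> UNIV then I0 ! \<sigma> (inv_into {..<n} ((!) I0) x) else x)) *
        (\<Prod>i\<in>UNIV. A $ i $ (if i \<in> UNIV then I0 ! \<sigma> (inv_into {..<n} ((!) I0) i) else i)))"
    proof (rule sum.cong[OF refl])
      fix \<sigma> assume s: "\<sigma> \<in> {\<sigma>. \<sigma> permutes {..<n}}"
      have m: "(\<lambda>x. if x \<in> UNIV then I0 ! \<sigma> (inv_into {..<n} ((!) I0) x) else x) = map_permutation {..<n} ((!) I0) \<sigma>"
        using bij by (auto simp: map_permutation_def restrict_id_def bij_betw_def)
      have sg: "sign (map_permutation {..<n} ((!) I0) \<sigma>) = sign \<sigma>"
        by (rule sign_map_permutation) (use s bij in \<open>auto simp: bij_betw_def\<close>)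
      have "(\<Prod>i\<in>UNIV. A $ i $ (map_permutation {..<n} ((!) I0) \<sigma> i)) =
        (\<Prod>l<n. A $ (I0 ! l) $ (map_permutation {..<n} ((!) I0) \<sigma> (I0 ! l)))"
        by (rule prod.reindex_bij_betw[OF bij, symmetric])
      also have "\<dots> = (\<Prod>l<n. A $ (I0 ! l) $ (I0 ! \<sigma> l))"
        by (intro prod.cong refl arg_cong[where f = "\<lambda>q. A $ _ $ q"] map_permutation_apply)
           (use s bij in \<open>auto simp: bij_betw_def\<close>)
      finally show "of_int (sign \<sigma>) * (\<Prod>l<n. A $ (I0 ! l) $ (I0 ! \<sigma> l)) =
        of_int (sign (\<lambda>x. if x \<in> UNIV then I0 ! \<sigma> (inv_into {..<n} ((!) I0) x) else x)) *
        (\<Prod>i\<in>UNIV. A $ i $ (if i \<in> UNIV then I0 ! \<sigma> (inv_into {..<n} ((!) I0) i) else i))"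
        using fun_cong[OF m] sg unfolding m by simp
    qed
  qed
  finally show ?thesis .
qed

lemma multilin_1_axis: "multilin 1 \<theta> \<Longrightarrow> \<theta> [x] = (\<Sum>p\<in>UNIV. x $ p * \<theta> [axis p 1])"
  using multilin_sum[of 1 \<theta> "[]" "[]" "($) x" "\<lambda>p. axis p 1" UNIV] by (simp add: vec_axis_sum)

section \<open>Metric duality between covectors and vectors\<close>

locale complex_metric =
  fixes g :: "complex^'n::finite \<Rightarrow> complex^'n \<Rightarrow> complex"
  assumes g_linear: "g (c *s u + v) w = c * g u w + g v w"
    and g_sym: "g u v = g v u"
    and g_nondegenerate: "(\<And>v. g u v = 0) \<Longrightarrow> u = 0"
begin

text \<open>The metric dual of the coordinate form \<open>dx p\<close>, as \<open>g_up\<close>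
  shows; contracting with the inverse Gram matrix amounts to inserting these vectors.\<close>

definition up :: "'n \<Rightarrow> complex^'n" where
  "up p = (\<Sum>q\<in>UNIV. (matrix_inv (gram g) $ p $ q) *s axis q 1)"

definition sharp :: "'n covec \<Rightarrow> complex^'n" where
  "sharp \<theta> = (\<Sum>p\<in>UNIV. \<theta> [axis p 1] *s up p)"

lemma g_add: "g (u + v) w = g u w + g v w"
  using g_linear[of 1 u v w] by simp

lemma g_zero: "g 0 w = 0"
  using g_add[of 0 0 w] by simp

lemma g_scale: "g (c *s u) w = c * g u w"
  using g_linear[of c u 0 w] by (simp add: g_zero)

lemma g_sum: "g (\<Sum>p\<in>P. c p *s u p) w = (\<Sum>p\<in>P. c p * g (u p) w)"
  by (induction P rule: infinite_finite_induct) (simp_all add: g_zero g_add g_scale)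

lemma g_sum_right: "g w (\<Sum>p\<in>P. c p *s u p) = (\<Sum>p\<in>P. c p * g w (u p))"
  unfolding g_sym[of w] by (rule g_sum)

lemma g_axis: "g w x = (\<Sum>s\<in>UNIV. x $ s * g w (axis s 1))"
  using g_sum_right[where P = UNIV and c = "($) x" and u = "\<lambda>s. axis s 1"] by (simp only: vec_axis_sum)

lemma g_nondegenerate_eq: "(\<And>x. g u x = g v x) \<Longrightarrow> u = v"
proof -
  assume "\<And>x. g u x = g v x"
  then have "g (u + (-1) *s v) x = 0" for x unfolding g_add g_scale by simp
  from g_nondegenerate[OF this] have "u + (-1) *s v = 0" .
  then show ?thesis by (simp add: vec_eq_iff)
qed

lemma invertible_gram: "invertible (gram g)"
proof -
  have "x = 0" if x: "gram g *v x = 0" for x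
  proof (rule g_nondegenerate)
    fix v
    have "g (axis k 1) x = 0" for k
    proof -
      have "(gram g *v x) $ k = (\<Sum>l\<in>UNIV. g (axis k 1) (axis l 1) * x $ l)"
        by (simp add: gram_def matrix_vector_mult_def)
      then show ?thesis using x g_axis[of "axis k 1" x] by (simp add: mult.commute)
    qed
    then show "g x v = 0" using g_axis[of x v] g_sym[of x] by simp
  qed
  then show ?thesis unfolding invertible_left_inverse matrix_left_invertible_ker by blast
qed

lemma matrix_inv_gram: "matrix_inv (gram g) ** gram g = mat 1"
  using invertible_gram unfolding matrix_inv_def invertible_def by (metis (mono_tags, lifting) someI_ex)

lemma g_up: "g (up p) x = x $ p"
proof -
  have *: "g (up p) (axis s 1) = (if p = s then 1 else 0)" for s
  proof -
    have "g (up p) (axis s 1) = (matrix_inv (gram g) ** gram g) $ p $ s"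
      unfolding up_def g_sum by (simp add: gram_def matrix_matrix_mult_def)
    then show ?thesis unfolding matrix_inv_gram by (simp add: mat_def)
  qed
  show ?thesis unfolding g_axis[of "up p" x] * by (simp add: if_distrib cong: if_cong)
qed

lemma g_sharp: "multilin 1 \<theta> \<Longrightarrow> g (sharp \<theta>) x = \<theta> [x]"
  unfolding sharp_def g_sum g_up by (simp add: multilin_1_axis[of \<theta> x] mult.commute)

lemma sharp_unique: "multilin 1 \<theta> \<Longrightarrow> (\<And>x. g u x = \<theta> [x]) \<Longrightarrow> u = sharp \<theta>"
  by (rule g_nondegenerate_eq) (simp add: g_sharp)

lemma sum_g_up: "(\<Sum>p\<in>UNIV. g (axis p 1) x *s up p) = x"
proof (rule g_nondegenerate_eq)
  fix y
  have "g (\<Sum>p\<in>UNIV. g (axis p 1) x *s up p) y = (\<Sum>p\<in>UNIV. y $ p * g x (axis p 1))"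
    unfolding g_sum g_up by (simp add: mult.commute g_sym[of x])
  also have "\<dots> = g x y" by (rule g_axis[symmetric])
  finally show "g (\<Sum>p\<in>UNIV. g (axis p 1) x *s up p) y = g x y" .
qed

text \<open>The symmetry of the inverse Gram matrix in another guise: the index may be raised on
  either factor. Both vectors have the same products with all x.\<close>

lemma sharp_eq: "multilin 1 \<theta> \<Longrightarrow> (\<Sum>p\<in>UNIV. \<theta> [up p] *s axis p 1) = sharp \<theta>"
proof (rule sharp_unique)
  fix x assume m: "multilin 1 \<theta>"
  have "g (\<Sum>p\<in>UNIV. \<theta> [up p] *s axis p 1) x = (\<Sum>p\<in>UNIV. g (axis p 1) x * \<theta> [up p])"
    unfolding g_sum by (simp add: mult.commute)
  also have "\<dots> = \<theta> [\<Sum>p\<in>UNIV. g (axis p 1) x *s up p]"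
    using multilin_sum[OF m, of "[]" "[]" "\<lambda>p. g (axis p 1) x" up UNIV] by simp
  finally show "g (\<Sum>p\<in>UNIV. \<theta> [up p] *s axis p 1) x = \<theta> [x]" unfolding sum_g_up .
qed

end

section \<open>The Hodge operator of a metric with a volume element\<close>

locale metric_volume = complex_metric g
  for g :: "complex^'n::finite \<Rightarrow> complex^'n \<Rightarrow> complex" +
  fixes vol :: "'n covec"
  assumes vol_alt: "alt_form CARD('n) vol"
    and vol_square: "distinct I \<Longrightarrow> set I = UNIV \<Longrightarrow> (vol (map (\<lambda>s. axis s 1) I))\<^sup>2 = det (gram g)"
begin

abbreviation es where "es \<equiv> map (\<lambda>p. axis p (1::complex))"
abbreviation ups where "ups \<equiv> map up"

text \<open>Multilinearity of \<open>vol\<close> absorbs the inverse Gram matrix into its arguments,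
  so that only one index list remains.\<close>

lemma hodge_eq:
  assumes "k \<le> CARD('n)"
  shows "hodge g vol k \<beta> = (\<lambda>xs. \<Sum>I | length I = k. (\<beta> (es I) / fact k) * vol (ups I @ xs))"
proof
  fix xs
  show "hodge g vol k \<beta> xs = (\<Sum>I | length I = k. (\<beta> (es I) / fact k) * vol (ups I @ xs))"
  proof (cases "length xs = CARD('n) - k")
    case True
    have "(\<Sum>J | length J = k. (\<Prod>l<k. matrix_inv (gram g) $ (I ! l) $ (J ! l)) * vol (es J @ xs)) = vol (ups I @ xs)"
      if I: "length I = k" for I
    proof -
      have m: "multilin k (\<lambda>ys. vol (ys @ xs))"
        using multilin_append[OF alt_form_multilin[OF vol_alt], of xs] True assms by simp
      have "vol (ups I @ xs) = vol (map (\<lambda>c. \<Sum>q\<in>UNIV. c q *s axis q 1) (map (\<lambda>p q. matrix_inv (gram g) $ p $ q) I) @ xs)"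
        by (simp add: up_def[abs_def] comp_def)
      also have "\<dots> = (\<Sum>J | length J = k \<and> set J \<subseteq> UNIV.
          (\<Prod>l<k. (map (\<lambda>p q. matrix_inv (gram g) $ p $ q) I ! l) (J ! l)) * vol (es J @ xs))"
        by (rule multilin_expand[OF m]) (simp add: I)
      also have "\<dots> = (\<Sum>J | length J = k. (\<Prod>l<k. matrix_inv (gram g) $ (I ! l) $ (J ! l)) * vol (es J @ xs))"
        using I by (intro sum.cong) auto
      finally show ?thesis by (rule sym)
    qed
    note * = this
    have "hodge g vol k \<beta> xs = (\<Sum>I | length I = k. \<beta> (es I) *
        (\<Sum>J | length J = k. (\<Prod>l<k. matrix_inv (gram g) $ (I ! l) $ (J ! l)) * vol (es J @ xs))) / fact k"
      unfolding hodge_def using True by (simp add: sum_distrib_left mult.assoc mult.left_commute)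
    also have "\<dots> = (\<Sum>I | length I = k. \<beta> (es I) * vol (ups I @ xs)) / fact k"
      by (intro arg_cong[where f = "\<lambda>x. x / fact k"] sum.cong refl) (simp add: *)
    finally show ?thesis by (simp add: sum_divide_distrib)
  next
    case False
    have "vol (ups I @ xs) = 0" if "length I = k" for I
      by (rule alt_form_length[OF vol_alt]) (use False that assms in auto)
    then show ?thesis using False by (simp add: hodge_def)
  qed
qed

lemma alt_form_hodge: "k \<le> CARD('n) \<Longrightarrow> alt_form (CARD('n) - k) (hodge g vol k \<beta>)"
  unfolding hodge_eq
  by (intro alt_form_sum alt_form_scale alt_form_contract_list) (use vol_alt in simp)

lemma hodge_sum: "k \<le> CARD('n) \<Longrightarrow> hodge g vol k (\<lambda>xs. \<Sum>p\<in>P. c p * \<beta> p xs) xs = (\<Sum>p\<in>P. c p * hodge g vol k (\<beta> p) xs)"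
proof -
  assume k: "k \<le> CARD('n)"
  have "hodge g vol k (\<lambda>xs. \<Sum>p\<in>P. c p * \<beta> p xs) xs =
    (\<Sum>I | length I = k. \<Sum>p\<in>P. c p * ((\<beta> p (es I) / fact k) * vol (ups I @ xs)))"
    unfolding hodge_eq[OF k] by (simp add: sum_divide_distrib sum_distrib_right mult.assoc)
  also have "\<dots> = (\<Sum>p\<in>P. \<Sum>I | length I = k. c p * ((\<beta> p (es I) / fact k) * vol (ups I @ xs)))"
    by (rule sum.swap)
  finally show ?thesis unfolding hodge_eq[OF k] by (simp only: sum_distrib_left)
qed

lemma hodge_scale: "k \<le> CARD('n) \<Longrightarrow> hodge g vol k (\<lambda>xs. c * \<beta> xs) xs = c * hodge g vol k \<beta> xs"
  using hodge_sum[of k "\<lambda>_. c" "\<lambda>_. \<beta>" "{()}" xs] by simp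

text \<open>The form \<open>\<theta> \<and> vol\<close> of degree \<open>n + 1\<close> vanishes. Evaluated on \<open>ups I @ xs\<close>, it splits into the
  terms \<open>L\<close> with \<open>\<theta>\<close> on \<open>ups I\<close>, which give the left-hand side, and the terms \<open>R\<close> with \<open>\<theta>\<close> on \<open>xs\<close>.\<close>

lemma hodge_contract:
  assumes \<gamma>: "alt_form (Suc k) \<gamma>" and \<theta>: "alt_form 1 \<theta>" and k: "Suc k \<le> CARD('n)"
  shows "hodge g vol k (\<lambda>xs. \<gamma> (sharp \<theta> # xs)) xs = (-1) ^ k * wedge 1 (CARD('n) - Suc k) \<theta> (hodge g vol (Suc k) \<gamma>) xs"
proof (cases "length xs = CARD('n) - k")
  case True
  define R where "R I = (\<Sum>s<Suc (CARD('n) - Suc k). (-1) ^ s * \<theta> [xs ! s] * vol (ups I @ take s xs @ drop (Suc s) xs))" for I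
  define L where "L I = (\<Sum>s<Suc k. (-1) ^ s * \<theta> [up (I ! s)] * vol (ups (take s I @ drop (Suc s) I) @ xs))" for I
  have nk: "Suc (CARD('n) - Suc k) = CARD('n) - k" using k by simp
  have R: "R I = (-1) ^ k * L I" if I: "length I = Suc k" for I
  proof -
    let ?ys = "ups I @ xs"
    let ?t = "\<lambda>s. (-1) ^ s * \<theta> [?ys ! s] * vol (take s ?ys @ drop (Suc s) ?ys)"
    have ly: "length ?ys = Suc CARD('n)" using I True k by simp
    have "alt_form (1 + CARD('n)) (wedge 1 CARD('n) \<theta> vol)"
      by (intro alt_form_wedge alt_form_multilin \<theta> vol_alt)
    then have "0 = wedge 1 CARD('n) \<theta> vol ?ys" by (rule alt_form_above_top[symmetric]) simp
    also have "\<dots> = (\<Sum>s<Suc CARD('n). ?t s)" unfolding wedge_1_eq[OF vol_alt] by (simp only: ly simp_thms if_True)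
    also have "{..<Suc CARD('n)} = {..<Suc k} \<union> (\<lambda>s. Suc k + s) ` {..<CARD('n) - k}"
    proof (intro set_eqI iffI)
      fix x assume "x \<in> {..<Suc CARD('n)}"
      then show "x \<in> {..<Suc k} \<union> (\<lambda>s. Suc k + s) ` {..<CARD('n) - k}"
        using k by (cases "x < Suc k") (auto intro!: image_eqI[of _ _ "x - Suc k"])
    qed (use k in auto)
    also have "sum ?t \<dots> = (\<Sum>s<Suc k. ?t s) + (\<Sum>s<CARD('n) - k. ?t (Suc k + s))"
    proof -
      have inj: "inj_on (\<lambda>s. Suc k + s) {..<CARD('n) - k}" by (simp add: inj_on_def)
      have "sum ?t ({..<Suc k} \<union> (\<lambda>s. Suc k + s) ` {..<CARD('n) - k}) = sum ?t {..<Suc k} + sum ?t ((\<lambda>s. Suc k + s) ` {..<CARD('n) - k})"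
        by (rule sum.union_disjoint) auto
      then show ?thesis unfolding sum.reindex[OF inj] by (simp only: comp_def)
    qed
    also have "(\<Sum>s<Suc k. ?t s) = L I"
      unfolding L_def
    proof (rule sum.cong[OF refl])
      fix s assume "s \<in> {..<Suc k}"
      then show "?t s = (-1) ^ s * \<theta> [up (I ! s)] * vol (ups (take s I @ drop (Suc s) I) @ xs)"
        using I by (simp add: nth_append take_map drop_map)
    qed
    also have "(\<Sum>s<CARD('n) - k. ?t (Suc k + s)) = (-1) ^ Suc k * R I"
      unfolding R_def sum_distrib_left nk
      by (rule sum.cong[OF refl]) (use I in \<open>simp add: nth_append power_add\<close>)
    finally have "L I = (-1) ^ k * R I" by simp
    then show ?thesis by (simp flip: power_add mult.assoc)
  qed
  \<comment> \<open>Skewness of \<gamma> moves the index at position s to the front, and the sign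
    cancels (-1)^s. All s thus give the same sum, and the k + 1 of them turn the denominator (k +
    1)! into k!.\<close>
  have Ls: "(\<Sum>I | length I = Suc k. \<gamma> (es I) * ((-1) ^ s * \<theta> [up (I ! s)] * vol (ups (take s I @ drop (Suc s) I) @ xs)))
      = (\<Sum>J | length J = k. \<gamma> (sharp \<theta> # es J) * vol (ups J @ xs))" if s: "s < Suc k" for s
  proof -
    have "(\<Sum>I | length I = Suc k. \<gamma> (es I) * ((-1) ^ s * \<theta> [up (I ! s)] * vol (ups (take s I @ drop (Suc s) I) @ xs))) =
      (\<Sum>p\<in>UNIV. \<Sum>J | length J = k. \<theta> [up p] * \<gamma> (axis p 1 # es J) * vol (ups J @ xs))"
    proof (subst lists_insert_sum[of s k], use s in simp, intro sum.cong refl)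
      fix p and J :: "'n list" assume "J \<in> {J. length J = k}"
      then have J: "length J = k" by simp
      have "\<gamma> (es (take s J @ p # drop s J)) = (-1) ^ s * \<gamma> (axis p 1 # es J)"
        using alt_form_move[OF \<gamma>, of "es J" s "axis p 1"] J s by (simp add: take_map drop_map)
      moreover have "vol (ups (take s J) @ ups (drop s J) @ xs) = vol (ups J @ xs)"
        by (metis append.assoc append_take_drop_id map_append)
      ultimately show "\<gamma> (es (take s J @ p # drop s J)) * ((-1) ^ s * \<theta> [up ((take s J @ p # drop s J) ! s)] *
         vol (ups (take s (take s J @ p # drop s J) @ drop (Suc s) (take s J @ p # drop s J)) @ xs))
         = \<theta> [up p] * \<gamma> (axis p 1 # es J) * vol (ups J @ xs)"
        using J s by (simp add: nth_append min_def flip: power_add mult.assoc)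
    qed
    also have "\<dots> = (\<Sum>J | length J = k. \<Sum>p\<in>UNIV. \<theta> [up p] * \<gamma> (axis p 1 # es J) * vol (ups J @ xs))"
      by (rule sum.swap)
    also have "\<dots> = (\<Sum>J | length J = k. \<gamma> (sharp \<theta> # es J) * vol (ups J @ xs))"
    proof (rule sum.cong[OF refl])
      fix J :: "'n list" assume "J \<in> {J. length J = k}"
      then have "\<gamma> (sharp \<theta> # es J) = (\<Sum>p\<in>UNIV. \<theta> [up p] * \<gamma> (axis p 1 # es J))"
        using multilin_sum[OF alt_form_multilin[OF \<gamma>], of "[]" "es J" "\<lambda>p. \<theta> [up p]" "\<lambda>p. axis p 1" UNIV]
        by (simp add: sharp_eq[OF alt_form_multilin[OF \<theta>]])
      then show "(\<Sum>p\<in>UNIV. \<theta> [up p] * \<gamma> (axis p 1 # es J) * vol (ups J @ xs)) = \<gamma> (sharp \<theta> # es J) * vol (ups J @ xs)"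
        by (simp add: sum_distrib_right)
    qed
    finally show ?thesis .
  qed
  have "wedge 1 (CARD('n) - Suc k) \<theta> (hodge g vol (Suc k) \<gamma>) xs =
    (\<Sum>s<Suc (CARD('n) - Suc k). \<Sum>I | length I = Suc k. (\<gamma> (es I) / fact (Suc k)) * ((-1) ^ s * \<theta> [xs ! s] * vol (ups I @ take s xs @ drop (Suc s) xs)))"
    unfolding wedge_1_eq[OF alt_form_hodge[OF k]] unfolding hodge_eq[OF k] True nk
    by (simp only: simp_thms if_True sum_distrib_left mult_ac)
  also have "\<dots> = (\<Sum>I | length I = Suc k. \<Sum>s<Suc (CARD('n) - Suc k). (\<gamma> (es I) / fact (Suc k)) * ((-1) ^ s * \<theta> [xs ! s] * vol (ups I @ take s xs @ drop (Suc s) xs)))"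
    by (rule sum.swap)
  also have "\<dots> = (\<Sum>I | length I = Suc k. (\<gamma> (es I) / fact (Suc k)) * ((-1) ^ k * L I))"
    by (rule sum.cong[OF refl]) (simp only: mem_Collect_eq R[symmetric] R_def sum_distrib_left)
  also have "\<dots> = (-1) ^ k / fact (Suc k) * (\<Sum>I | length I = Suc k. \<Sum>s<Suc k. \<gamma> (es I) * ((-1) ^ s * \<theta> [up (I ! s)] * vol (ups (take s I @ drop (Suc s) I) @ xs)))"
    unfolding L_def sum_distrib_left by (intro sum.cong refl) simp
  also have "\<dots> = (-1) ^ k / fact (Suc k) * (\<Sum>s<Suc k. \<Sum>I | length I = Suc k. \<gamma> (es I) * ((-1) ^ s * \<theta> [up (I ! s)] * vol (ups (take s I @ drop (Suc s) I) @ xs)))"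
    by (subst sum.swap) (rule refl)
  also have "\<dots> = (-1) ^ k / fact (Suc k) * (\<Sum>s<Suc k. \<Sum>J | length J = k. \<gamma> (sharp \<theta> # es J) * vol (ups J @ xs))"
    by (intro arg_cong[where f = "\<lambda>x. (-1) ^ k / fact (Suc k) * x"] sum.cong[OF refl] Ls) simp
  also have "\<dots> = (-1) ^ k * (\<Sum>J | length J = k. (\<gamma> (sharp \<theta> # es J) / fact k) * vol (ups J @ xs))"
  proof -
    have "of_nat (Suc k) / fact (Suc k) = (1 / fact k :: complex)" by (simp add: fact_Suc del: of_nat_Suc)
    then show ?thesis
      by (simp add: sum_divide_distrib[symmetric] del: sum.lessThan_Suc fact_Suc of_nat_Suc)
         (metis (no_types, lifting) mult.commute times_divide_eq_left times_divide_eq_right mult.right_neutral)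
  qed
  finally show ?thesis
    unfolding hodge_eq[OF Suc_leD[OF k]] by (simp flip: mult.assoc power_add)
next
  case False
  have "CARD('n) - k = 1 + (CARD('n) - Suc k)" using k by simp
  with False have "wedge 1 (CARD('n) - Suc k) \<theta> (hodge g vol (Suc k) \<gamma>) xs = 0" by (intro wedge_length) simp
  then show ?thesis using False by (simp add: hodge_def)
qed

text \<open>Summing the slot of \<theta> against the raised basis puts \<open>sharp \<theta>\<close>
  into \<open>vol\<close>, in front of the k remaining raised vectors. Moving it behind them, where
  \<open>hodge\<close> expects its arguments, gives the sign.\<close>

lemma hodge_wedge_1:
  assumes \<delta>: "alt_form k \<delta>" and \<theta>: "alt_form 1 \<theta>" and k: "Suc k \<le> CARD('n)"
  shows "hodge g vol (Suc k) (wedge 1 k \<theta> \<delta>) xs = (-1) ^ k * hodge g vol k \<delta> (sharp \<theta> # xs)"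
proof (cases "length xs = CARD('n) - Suc k")
  case True
  have Ls: "(\<Sum>I | length I = Suc k. (-1) ^ s * \<theta> [axis (I ! s) 1] * \<delta> (es (take s I @ drop (Suc s) I)) * vol (ups I @ xs))
      = (\<Sum>J | length J = k. \<delta> (es J) * vol (sharp \<theta> # ups J @ xs))" if s: "s < Suc k" for s
  proof -
    have sq: "(-1) ^ s * ((-1) ^ s * x) = x" for x :: complex
      by (simp flip: power_add mult.assoc)
    have "(\<Sum>I | length I = Suc k. (-1) ^ s * \<theta> [axis (I ! s) 1] * \<delta> (es (take s I @ drop (Suc s) I)) * vol (ups I @ xs)) =
      (\<Sum>p\<in>UNIV. \<Sum>J | length J = k. \<delta> (es J) * (\<theta> [axis p 1] * vol (up p # ups J @ xs)))"
    proof (subst lists_insert_sum[of s k], use s in simp, intro sum.cong refl)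
      fix p and J :: "'n list" assume "J \<in> {J. length J = k}"
      then have J: "length J = k" by simp
      have "vol (ups (take s J @ p # drop s J) @ xs) = (-1) ^ s * vol (up p # ups J @ xs)"
        using alt_form_move[OF vol_alt, of "ups J @ xs" s "up p"] J s k True by (simp add: take_map drop_map)
      moreover have "es (take s J) @ es (drop s J) = es J"
        by (metis append_take_drop_id map_append)
      ultimately show "(-1) ^ s * \<theta> [axis ((take s J @ p # drop s J) ! s) 1] *
         \<delta> (es (take s (take s J @ p # drop s J) @ drop (Suc s) (take s J @ p # drop s J))) * vol (ups (take s J @ p # drop s J) @ xs)
         = \<delta> (es J) * (\<theta> [axis p 1] * vol (up p # ups J @ xs))"
        using J s sq by (simp add: nth_append min_def mult_ac)
    qed
    also have "\<dots> = (\<Sum>J | length J = k. \<Sum>p\<in>UNIV. \<delta> (es J) * (\<theta> [axis p 1] * vol (up p # ups J @ xs)))"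
      by (rule sum.swap)
    also have "\<dots> = (\<Sum>J | length J = k. \<delta> (es J) * vol (sharp \<theta> # ups J @ xs))"
    proof (rule sum.cong[OF refl])
      fix J :: "'n list" assume "J \<in> {J. length J = k}"
      then have "vol (sharp \<theta> # ups J @ xs) = (\<Sum>p\<in>UNIV. \<theta> [axis p 1] * vol (up p # ups J @ xs))"
        using multilin_sum[OF alt_form_multilin[OF vol_alt], of "[]" "ups J @ xs" "\<lambda>p. \<theta> [axis p 1]" up UNIV] True k
        by (simp add: sharp_def)
      then show "(\<Sum>p\<in>UNIV. \<delta> (es J) * (\<theta> [axis p 1] * vol (up p # ups J @ xs))) = \<delta> (es J) * vol (sharp \<theta> # ups J @ xs)"
        by (simp only: sum_distrib_left)
    qed
    finally show ?thesis .
  qed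
  have "hodge g vol (Suc k) (wedge 1 k \<theta> \<delta>) xs = (\<Sum>I | length I = Suc k. 1 / fact (Suc k) *
      (\<Sum>s<Suc k. (-1) ^ s * \<theta> [axis (I ! s) 1] * \<delta> (es (take s I @ drop (Suc s) I)) * vol (ups I @ xs)))"
    unfolding hodge_eq[OF k] wedge_1_eq[OF \<delta>]
  proof (rule sum.cong[OF refl])
    fix I :: "'n list" assume "I \<in> {I. length I = Suc k}"
    then have I: "length I = Suc k" by simp
    have "(\<Sum>s<Suc k. (-1) ^ s * \<theta> [es I ! s] * \<delta> (take s (es I) @ drop (Suc s) (es I))) =
      (\<Sum>s<Suc k. (-1) ^ s * \<theta> [axis (I ! s) 1] * \<delta> (es (take s I @ drop (Suc s) I)))"
      by (rule sum.cong[OF refl]) (use I in \<open>simp add: take_map drop_map\<close>)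
    then show "(if length (es I) = Suc k then \<Sum>s<Suc k. (-1) ^ s * \<theta> [es I ! s] * \<delta> (take s (es I) @ drop (Suc s) (es I)) else 0) / fact (Suc k) * vol (ups I @ xs)
      = 1 / fact (Suc k) * (\<Sum>s<Suc k. (-1) ^ s * \<theta> [axis (I ! s) 1] * \<delta> (es (take s I @ drop (Suc s) I)) * vol (ups I @ xs))"
      using I by (simp add: sum_distrib_right[symmetric] del: sum.lessThan_Suc fact_Suc)
  qed
  also have "\<dots> = 1 / fact (Suc k) * (\<Sum>s<Suc k. \<Sum>I | length I = Suc k. (-1) ^ s * \<theta> [axis (I ! s) 1] * \<delta> (es (take s I @ drop (Suc s) I)) * vol (ups I @ xs))"
    unfolding sum_distrib_left[symmetric] by (subst sum.swap) (rule refl)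
  also have "\<dots> = 1 / fact (Suc k) * (\<Sum>s<Suc k. \<Sum>J | length J = k. \<delta> (es J) * vol (sharp \<theta> # ups J @ xs))"
    by (intro arg_cong[where f = "\<lambda>x. 1 / fact (Suc k) * x"] sum.cong[OF refl] Ls) simp
  also have "\<dots> = (\<Sum>J | length J = k. (\<delta> (es J) / fact k) * vol (sharp \<theta> # ups J @ xs))"
  proof -
    have f: "of_nat (Suc k) / fact (Suc k) = (1 / fact k :: complex)" by (simp add: fact_Suc del: of_nat_Suc)
    have "1 / fact (Suc k) * (\<Sum>s<Suc k. S) = (of_nat (Suc k) / fact (Suc k)) * S" for S :: complex by simp
    then show ?thesis unfolding f by (simp add: sum_divide_distrib)
  qed
  also have "\<dots> = (-1) ^ k * hodge g vol k \<delta> (sharp \<theta> # xs)"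
    unfolding hodge_eq[OF Suc_leD[OF k]] sum_distrib_left
  proof (rule sum.cong[OF refl])
    fix J :: "'n list" assume "J \<in> {J. length J = k}"
    then have "vol (ups J @ sharp \<theta> # xs) = (-1) ^ k * vol (sharp \<theta> # ups J @ xs)"
      using alt_form_move[OF vol_alt, of "ups J @ xs" k "sharp \<theta>"] k True by simp
    then show "\<delta> (es J) / fact k * vol (sharp \<theta> # ups J @ xs) = (-1) ^ k * (\<delta> (es J) / fact k * vol (ups J @ sharp \<theta> # xs))"
      by (simp add: mult.left_commute flip: power_add mult.assoc)
  qed
  finally show ?thesis .
next
  case False
  then show ?thesis using k by (simp add: hodge_def)
qed

text \<open>The constant 1 as a form of degree 0, the starting point for computing the double Hodge
  star by wedging with one-forms.\<close>

definition unit_form :: "'n covec" where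
  "unit_form xs = (if xs = [] then 1 else 0)"

lemma alt_form_one: "alt_form 0 unit_form"
  by (rule alt_formI) (auto simp: unit_form_def multilin_def)

lemma wedge_one: "alt_form 1 \<theta> \<Longrightarrow> wedge 1 0 \<theta> unit_form = \<theta>"
proof
  fix xs assume t: "alt_form 1 \<theta>"
  show "wedge 1 0 \<theta> unit_form xs = \<theta> xs"
    unfolding wedge_1_eq[OF alt_form_one] using alt_form_length[OF t, of xs]
    by (cases xs) (auto simp: unit_form_def)
qed

lemma exists_enumeration: "\<exists>I :: 'n list. distinct I \<and> set I = UNIV \<and> length I = CARD('n)"
  using finite_distinct_list[of "UNIV :: 'n set"] distinct_card by fastforce

text \<open>The normalisation of the volume element enters here: raising all indices multiplies it
  by the determinant of the inverse Gram matrix, so the product of the two values is 1 on an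
  enumeration. Rearrangements change both signs, and the n! equal terms cancel the
  factorial.\<close>

lemma hodge_vol: "hodge g vol CARD('n) vol = unit_form"
proof
  fix xs
  obtain I0 :: "'n list" where I0: "distinct I0" "set I0 = UNIV" "length I0 = CARD('n)"
    using exists_enumeration by blast
  show "hodge g vol CARD('n) vol xs = unit_form xs"
  proof (cases "xs = []")
    case True
    have d: "vol (ups I0) = det (matrix_inv (gram g)) * vol (es I0)"
      using alt_form_det[OF vol_alt I0, of "matrix_inv (gram g)"] by (simp add: up_def[abs_def])
    have "det (matrix_inv (gram g)) * det (gram g) = 1"
      unfolding det_mul[symmetric] matrix_inv_gram by simp
    then have p: "vol (es I0) * vol (ups I0) = 1"
      unfolding d using vol_square[OF I0(1,2)] by (simp add: power2_eq_square mult.left_commute)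
    have "(\<Sum>I | length I = CARD('n). vol (es I) * vol (ups I)) =
      (\<Sum>\<sigma> | \<sigma> permutes {..<CARD('n)}. vol (es (permute_list \<sigma> I0)) * vol (ups (permute_list \<sigma> I0)))"
    proof (rule sum_distinct_lists[OF I0])
      fix J :: "'n list" assume J: "length J = CARD('n)" "\<not> distinct J"
      then obtain i j where ij: "i < j" "j < length J" "J ! i = J ! j"
        by (metis distinct_conv_nth linorder_neqE_nat)
      then have "vol (es J) = 0" by (intro alt_form_repeated[OF vol_alt, of _ i j]) (use J in simp_all)
      then show "vol (es J) * vol (ups J) = 0" by simp
    qed
    also have "\<dots> = (\<Sum>\<sigma> | \<sigma> permutes {..<CARD('n)}. 1)"
    proof (rule sum.cong[OF refl])
      fix \<sigma> assume "\<sigma> \<in> {\<sigma>. \<sigma> permutes {..<CARD('n)}}"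
      then have s: "\<sigma> permutes {..<CARD('n)}" by simp
      have "vol (map f (permute_list \<sigma> I0)) = of_int (sign \<sigma>) * vol (map f I0)" for f :: "'n \<Rightarrow> complex^'n"
        using alt_form_permute[OF vol_alt s, of "map f I0"] permute_list_map[of \<sigma> I0 f] s I0 by simp
      then show "vol (es (permute_list \<sigma> I0)) * vol (ups (permute_list \<sigma> I0)) = 1"
        using p sign_mult_self[of \<sigma> 1] by (simp add: mult.left_commute mult.assoc)
    qed
    also have "\<dots> = fact CARD('n)" by (simp add: card_permutes)
    finally show ?thesis unfolding hodge_eq[OF order_refl] True
      by (simp add: unit_form_def sum_divide_distrib[symmetric])
  next
    case False
    then show ?thesis by (simp add: hodge_def unit_form_def)
  qed
qed

text \<open>The first star turns the wedge with \<theta> into a contraction, the second turns it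
  back into a wedge. The signs (-1)^k and (-1)^(n - k - 1) multiply to a sign independent of
  k.\<close>

lemma hodge_hodge_wedge:
  assumes \<delta>: "alt_form k \<delta>" and \<theta>: "alt_form 1 \<theta>" and k: "Suc k \<le> CARD('n)"
  shows "hodge g vol (CARD('n) - Suc k) (hodge g vol (Suc k) (wedge 1 k \<theta> \<delta>)) xs =
    (-1) ^ (CARD('n) - 1) * wedge 1 k \<theta> (hodge g vol (CARD('n) - k) (hodge g vol k \<delta>)) xs"
proof -
  have s: "Suc (CARD('n) - Suc k) = CARD('n) - k" and s': "CARD('n) - (CARD('n) - k) = k" using k by auto
  have a: "alt_form (Suc (CARD('n) - Suc k)) (hodge g vol k \<delta>)"
    unfolding s by (rule alt_form_hodge) (use k in simp)
  have "hodge g vol (Suc k) (wedge 1 k \<theta> \<delta>) = (\<lambda>xs. (-1) ^ k * hodge g vol k \<delta> (sharp \<theta> # xs))"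
    by (rule ext) (rule hodge_wedge_1[OF assms])
  then have "hodge g vol (CARD('n) - Suc k) (hodge g vol (Suc k) (wedge 1 k \<theta> \<delta>)) xs =
    (-1) ^ k * hodge g vol (CARD('n) - Suc k) (\<lambda>xs. hodge g vol k \<delta> (sharp \<theta> # xs)) xs"
    by (simp add: hodge_scale)
  also have "\<dots> = (-1) ^ k * ((-1) ^ (CARD('n) - Suc k) * wedge 1 k \<theta> (hodge g vol (CARD('n) - k) (hodge g vol k \<delta>)) xs)"
    using hodge_contract[OF a \<theta>, of xs] unfolding s s' by simp
  finally show ?thesis using k by (simp flip: power_add mult.assoc)
qed

lemma hodge_0: "hodge g vol 0 unit_form = vol"
proof -
  have "{I :: 'n list. length I = 0} = {[]}" by auto
  then show ?thesis unfolding hodge_eq[of 0 unit_form, OF le0] by (simp add: unit_form_def)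
qed

lemma two_form_expand:
  assumes "alt_form 2 \<beta>"
  shows "\<beta> = (\<lambda>xs. \<Sum>p\<in>UNIV. \<beta> [axis (fst p) 1, axis (snd p) 1] / 2 * wedge 1 1 (dx (fst p)) (dx (snd p)) xs)"
proof
  fix xs
  show "\<beta> xs = (\<Sum>p\<in>UNIV. \<beta> [axis (fst p) 1, axis (snd p) 1] / 2 * wedge 1 1 (dx (fst p)) (dx (snd p)) xs)"
  proof (cases "length xs = 2")
    case True
    then obtain x y where xs: "xs = [x, y]" by (metis (no_types) length_0_conv length_Suc_conv numeral_2_eq_2)
    let ?b = "\<lambda>i j. \<beta> [axis i 1, axis j 1]"
    have anti: "?b i j = - ?b j i" for i j
      using alt_form_move[OF assms, of "[axis i 1]" 1 "axis j 1"] by simp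
    have e: "\<beta> [u, v] = (\<Sum>i\<in>UNIV. \<Sum>j\<in>UNIV. u $ i * (v $ j * ?b i j))" for u v
    proof -
      have "\<beta> [u, v] = (\<Sum>i\<in>UNIV. u $ i * \<beta> [axis i 1, v])"
        using multilin_sum[OF alt_form_multilin[OF assms], of "[]" "[v]" "($) u" "\<lambda>p. axis p 1" UNIV] by (simp add: vec_axis_sum)
      also have "\<dots> = (\<Sum>i\<in>UNIV. u $ i * (\<Sum>j\<in>UNIV. v $ j * ?b i j))"
        using multilin_sum[OF alt_form_multilin[OF assms], of "[axis _ 1]" "[]" "($) v" "\<lambda>p. axis p 1" UNIV] by (simp add: vec_axis_sum)
      finally show ?thesis by (simp only: sum_distrib_left)
    qed
    have "\<beta> [y, x] = - \<beta> [x, y]" using alt_form_move[OF assms, of "[y]" 1 x] by simp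
    then have "\<beta> [x, y] = (\<beta> [x, y] - \<beta> [y, x]) / 2" by simp
    also have "\<dots> = (\<Sum>i\<in>UNIV. \<Sum>j\<in>UNIV. ?b i j / 2 * (x $ i * y $ j - y $ i * x $ j))"
    proof -
      have "(\<beta> [x, y] - \<beta> [y, x]) / 2 = (\<Sum>i\<in>UNIV. \<Sum>j\<in>UNIV. (x $ i * (y $ j * ?b i j) - y $ i * (x $ j * ?b i j)) / 2)"
        by (simp only: e[of x y] e[of y x] sum_subtractf[symmetric] sum_divide_distrib)
      also have "\<dots> = (\<Sum>i\<in>UNIV. \<Sum>j\<in>UNIV. ?b i j / 2 * (x $ i * y $ j - y $ i * x $ j))"
        by (intro sum.cong refl) (simp add: right_diff_distrib diff_divide_distrib mult_ac)
      finally show ?thesis .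
    qed
    finally show ?thesis
      unfolding xs wedge_11[OF alt_form_dx] by (simp add: dx_def sum.cartesian_product split_beta UNIV_Times_UNIV)
  next
    case False
    then show ?thesis using alt_form_length[OF assms False] by (simp add: wedge_length)
  qed
qed

text \<open>In even dimension every one-form factor contributes -1 to the double star. It is 1 on
  constants, hence -1 on one-forms and again 1 on products of two; linearity does the rest.\<close>

lemma hodge_hodge_2:
  assumes \<beta>: "alt_form 2 \<beta>" and n: "even CARD('n)"
  shows "hodge g vol (CARD('n) - 2) (hodge g vol 2 \<beta>) xs = \<beta> xs"
proof -
  have n2: "2 \<le> CARD('n)" using n by (metis One_nat_def Suc_leI dvd_imp_le zero_less_card_finite)
  have sg: "(-1) ^ (CARD('n) - 1) = (-1 :: complex)"
    by (rule neg_one_odd_power) (use n n2 in simp)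
  have 1: "hodge g vol (CARD('n) - 1) (hodge g vol 1 \<theta>) = (\<lambda>xs. - \<theta> xs)" if t: "alt_form 1 \<theta>" for \<theta>
    using hodge_hodge_wedge[OF alt_form_one t] n2 sg
    by (intro ext) (simp add: wedge_one[OF t, simplified] hodge_0 hodge_vol)
  have 2: "hodge g vol (CARD('n) - 2) (hodge g vol 2 (wedge 1 1 \<theta> \<eta>)) xs = wedge 1 1 \<theta> \<eta> xs"
    if t: "alt_form 1 \<theta>" and e: "alt_form 1 \<eta>" for \<theta> \<eta> xs
    using hodge_hodge_wedge[OF e t, of xs] n2 sg 1[OF e] wedge_scale_right[of 1 1 \<theta> "-1" \<eta> xs]
    by (simp add: numeral_2_eq_2)
  let ?s = "\<lambda>xs. \<Sum>p\<in>UNIV. \<beta> [axis (fst p) 1, axis (snd p) 1] / 2 * wedge 1 1 (dx (fst p)) (dx (snd p)) xs"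
  have "hodge g vol (CARD('n) - 2) (hodge g vol 2 \<beta>) xs = hodge g vol (CARD('n) - 2) (hodge g vol 2 ?s) xs"
    by (rule arg_cong[where f = "\<lambda>b. hodge g vol (CARD('n) - 2) (hodge g vol 2 b) xs"], rule two_form_expand[OF \<beta>])
  also have "\<dots> = ?s xs"
  proof -
    let ?c = "\<lambda>p. \<beta> [axis (fst p) 1, axis (snd p) 1] / 2" and ?w = "\<lambda>p. wedge 1 1 (dx (fst p)) (dx (snd p))"
    have "hodge g vol 2 ?s = (\<lambda>xs. \<Sum>p\<in>UNIV. ?c p * hodge g vol 2 (?w p) xs)"
      by (rule ext) (rule hodge_sum[OF n2])
    then have "hodge g vol (CARD('n) - 2) (hodge g vol 2 ?s) xs =
      (\<Sum>p\<in>UNIV. ?c p * hodge g vol (CARD('n) - 2) (hodge g vol 2 (?w p)) xs)"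
      by (simp only: hodge_sum[OF diff_le_self])
    then show ?thesis by (simp only: 2[OF alt_form_dx alt_form_dx])
  qed
  also have "?s xs = \<beta> xs" by (rule fun_cong[OF two_form_expand[OF \<beta>], symmetric])
  finally show ?thesis .
qed

text \<open>Two applications of \<open>hodge_contract\<close>: with \<eta> the sign is (-1)^3, with
  \<theta> it is (-1)^2. The degree n - 4 is even, so the one-forms pass the dual of \<Omega>
  without further signs; the order of the two contractions reflects that \<theta> is moved to the
  front before \<eta>.\<close>

lemma hodge_wedge_contract:
  assumes \<Omega>: "alt_form 4 \<Omega>" and \<theta>: "alt_form 1 \<theta>" and \<eta>: "alt_form 1 \<eta>"
    and n: "even CARD('n)" "4 \<le> CARD('n)"
  shows "wedge (CARD('n) - 4) 2 (hodge g vol 4 \<Omega>) (wedge 1 1 \<theta> \<eta>) xs =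
    - hodge g vol 2 (\<lambda>xs. \<Omega> (sharp \<eta> # sharp \<theta> # xs)) xs"
proof -
  let ?n = "CARD('n) - 4" and ?h = "hodge g vol 4 \<Omega>"
  have sg: "(-1) ^ ?n = (1 :: complex)" using n by simp
  have com: "wedge ?n 1 \<alpha> \<epsilon> = wedge 1 ?n \<epsilon> \<alpha>" for \<alpha> \<epsilon> :: "'n covec"
    by (rule ext) (simp only: wedge_commute_1 sg mult_1)
  have "wedge ?n 2 ?h (wedge 1 1 \<theta> \<eta>) xs = wedge (?n + 1) 1 (wedge ?n 1 ?h \<theta>) \<eta> xs"
    using wedge_assoc[of ?n 1 1 ?h \<theta> \<eta> xs] by (simp only: one_add_one)
  also have "\<dots> = wedge (1 + ?n) 1 (wedge 1 ?n \<theta> ?h) \<eta> xs" unfolding com by (simp only: add.commute)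
  also have "\<dots> = wedge 1 (?n + 1) \<theta> (wedge ?n 1 ?h \<eta>) xs" by (rule wedge_assoc)
  also have "wedge ?n 1 ?h \<eta> = (\<lambda>xs. - hodge g vol 3 (\<lambda>xs. \<Omega> (sharp \<eta> # xs)) xs)"
  proof
    fix xs
    have "alt_form (Suc 3) \<Omega>" using \<Omega> by simp
    from hodge_contract[OF this \<eta>, of xs] n show "wedge ?n 1 ?h \<eta> xs = - hodge g vol 3 (\<lambda>xs. \<Omega> (sharp \<eta> # xs)) xs"
      unfolding com by simp
  qed
  also have "wedge 1 (?n + 1) \<theta> (\<lambda>xs. - hodge g vol 3 (\<lambda>xs. \<Omega> (sharp \<eta> # xs)) xs) xs =
      - wedge 1 (?n + 1) \<theta> (hodge g vol 3 (\<lambda>xs. \<Omega> (sharp \<eta> # xs))) xs"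
    using wedge_scale_right[of 1 "?n + 1" \<theta> "-1"] by simp
  also have "wedge 1 (?n + 1) \<theta> (hodge g vol 3 (\<lambda>xs. \<Omega> (sharp \<eta> # xs))) xs =
      hodge g vol 2 (\<lambda>xs. \<Omega> (sharp \<eta> # sharp \<theta> # xs)) xs"
  proof -
    have "alt_form (Suc 2) (\<lambda>xs. \<Omega> (sharp \<eta> # xs))" by (rule alt_form_contract) (use \<Omega> in simp)
    moreover have "CARD('n) - 3 = ?n + 1" using n by simp
    ultimately show ?thesis using hodge_contract[of 2 "\<lambda>xs. \<Omega> (sharp \<eta> # xs)" \<theta> xs] \<theta> n by simp
  qed
  finally show ?thesis .
qed

end

section \<open>Symmetric powers of a symplectic plane\<close>

lemma length_word: "j \<le> m \<Longrightarrow> length (word m j) = m"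
  by (simp add: word_def)

lemma word_nth: "j \<le> m \<Longrightarrow> l < m \<Longrightarrow> word m j ! l = (if l < m - j then 0 else 1)"
  by (simp add: word_def nth_append)

lemma word_lt2: "j \<le> m \<Longrightarrow> l < m \<Longrightarrow> word m j ! l < 2"
  by (simp add: word_nth)

text \<open>The form \<open>omega_pow\<close> extended to arbitrary words, in which linear substitutions can be
  expanded letter by letter; a word enters only through its number of ones.\<close>

definition pair_form :: "nat \<Rightarrow> cmat \<Rightarrow> nat list \<Rightarrow> nat list \<Rightarrow> complex" where
  "pair_form m \<omega> \<alpha> \<beta> = (\<Sum>\<sigma> | \<sigma> permutes {..<m}. \<Sum>\<tau> | \<tau> permutes {..<m}. \<Prod>l<m. \<omega> (\<alpha> ! \<sigma> l) (\<beta> ! \<tau> l))"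

lemma omega_pow_pair_form: "omega_pow m \<omega> j k = pair_form m \<omega> (word m j) (word m k)"
  by (simp add: omega_pow_def pair_form_def)

definition words :: "nat \<Rightarrow> nat list set" where
  "words m = {\<beta>. length \<beta> = m \<and> set \<beta> \<subseteq> {0, 1}}"

lemma finite_words: "finite (words m)"
proof -
  have "words m = {\<beta>. set \<beta> \<subseteq> {0, 1} \<and> length \<beta> = m}" by (auto simp: words_def)
  then show ?thesis using finite_lists_length_eq[of "{0::nat, 1}" m] by simp
qed

lemma words_Suc: "words (Suc m) = Cons 0 ` words m \<union> Cons 1 ` words m"
proof (intro set_eqI iffI)
  fix x assume "x \<in> words (Suc m)"
  then show "x \<in> Cons 0 ` words m \<union> Cons 1 ` words m"
    by (cases x) (auto simp: words_def)
qed (auto simp: words_def)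

lemma prod_sum_words:
  "(\<Prod>l<m. (\<Sum>a<2. f l a)) = (\<Sum>\<beta>\<in>words m. \<Prod>l<m. (f l (\<beta> ! l) :: complex))"
proof (induction m arbitrary: f)
  case 0
  have "words 0 = {[]}" by (auto simp: words_def)
  then show ?case by simp
next
  case (Suc m)
  have "(\<Sum>\<beta>\<in>words (Suc m). \<Prod>l<Suc m. f l (\<beta> ! l)) =
    (\<Sum>\<beta>\<in>Cons 0 ` words m. \<Prod>l<Suc m. f l (\<beta> ! l)) + (\<Sum>\<beta>\<in>Cons 1 ` words m. \<Prod>l<Suc m. f l (\<beta> ! l))"
    unfolding words_Suc by (rule sum.union_disjoint) (auto simp: finite_words)
  also have "\<dots> = (\<Sum>\<beta>\<in>words m. f 0 0 * (\<Prod>l<m. f (Suc l) (\<beta> ! l))) + (\<Sum>\<beta>\<in>words m. f 0 1 * (\<Prod>l<m. f (Suc l) (\<beta> ! l)))"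
    by (simp add: sum.reindex prod.lessThan_Suc_shift del: prod.lessThan_Suc)
  also have "\<dots> = (\<Sum>a<2. f 0 a) * (\<Prod>l<m. \<Sum>a<2. f (Suc l) a)"
    unfolding Suc.IH by (simp add: sum_distrib_left[symmetric] algebra_simps numeral_2_eq_2)
  finally show ?case by (simp add: prod.lessThan_Suc_shift del: prod.lessThan_Suc)
qed

lemma sum_list_le_words: "\<beta> \<in> words m \<Longrightarrow> sum_list \<beta> \<le> m"
proof -
  assume "\<beta> \<in> words m"
  then have "sum_list (map id \<beta>) \<le> sum_list (map (\<lambda>_. 1) \<beta>)" by (intro sum_list_mono) (auto simp: words_def)
  then show ?thesis using \<open>\<beta> \<in> words m\<close> by (simp add: words_def sum_list_triv)
qed

lemma mset_word:
  assumes "\<beta> \<in> words m" shows "mset \<beta> = mset (word m (sum_list \<beta>))"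
proof -
  have b: "set \<beta> \<subseteq> {0, 1} \<Longrightarrow> mset \<beta> = replicate_mset (length \<beta> - sum_list \<beta>) 0 + replicate_mset (sum_list \<beta>) 1 \<and> sum_list \<beta> \<le> length \<beta>" for \<beta> :: "nat list"
    by (induction \<beta>) (auto simp: Suc_diff_le)
  then show ?thesis using assms by (auto simp: words_def word_def)
qed

lemma pair_form_permute_left:
  assumes "\<rho> permutes {..<m}" "length \<alpha> = m"
  shows "pair_form m \<omega> (permute_list \<rho> \<alpha>) \<beta> = pair_form m \<omega> \<alpha> \<beta>"
proof -
  have "pair_form m \<omega> \<alpha> \<beta> = (\<Sum>\<sigma> | \<sigma> permutes {..<m}. \<Sum>\<tau> | \<tau> permutes {..<m}. \<Prod>l<m. \<omega> (\<alpha> ! (\<rho> \<circ> \<sigma>) l) (\<beta> ! \<tau> l))"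
    unfolding pair_form_def by (rule setum_permutations_compose_left[OF assms(1)])
  also have "\<dots> = pair_form m \<omega> (permute_list \<rho> \<alpha>) \<beta>"
    unfolding pair_form_def
  proof (intro sum.cong refl prod.cong)
    fix \<sigma> \<tau> l assume s: "\<sigma> \<in> {\<sigma>. \<sigma> permutes {..<m}}" and l: "l \<in> {..<m}"
    then have "\<sigma> l < m" using permutes_in_image[of \<sigma> "{..<m}" l] by simp
    then show "\<omega> (\<alpha> ! (\<rho> \<circ> \<sigma>) l) (\<beta> ! \<tau> l) = \<omega> (permute_list \<rho> \<alpha> ! \<sigma> l) (\<beta> ! \<tau> l)"
      using assms by (simp add: permute_list_def)
  qed
  finally show ?thesis by (rule sym)
qed

lemma pair_form_permute_right:
  assumes "\<rho> permutes {..<m}" "length \<beta> = m"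
  shows "pair_form m \<omega> \<alpha> (permute_list \<rho> \<beta>) = pair_form m \<omega> \<alpha> \<beta>"
proof -
  have "pair_form m \<omega> \<alpha> \<beta> = (\<Sum>\<sigma> | \<sigma> permutes {..<m}. \<Sum>\<tau> | \<tau> permutes {..<m}. \<Prod>l<m. \<omega> (\<alpha> ! \<sigma> l) (\<beta> ! (\<rho> \<circ> \<tau>) l))"
    unfolding pair_form_def by (intro sum.cong refl setum_permutations_compose_left[OF assms(1)])
  also have "\<dots> = pair_form m \<omega> \<alpha> (permute_list \<rho> \<beta>)"
    unfolding pair_form_def
  proof (intro sum.cong refl prod.cong)
    fix \<sigma> \<tau> l assume s: "\<tau> \<in> {\<sigma>. \<sigma> permutes {..<m}}" and l: "l \<in> {..<m}"
    then have "\<tau> l < m" using permutes_in_image[of \<tau> "{..<m}" l] by simp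
    then show "\<omega> (\<alpha> ! \<sigma> l) (\<beta> ! (\<rho> \<circ> \<tau>) l) = \<omega> (\<alpha> ! \<sigma> l) (permute_list \<rho> \<beta> ! \<tau> l)"
      using assms by (simp add: permute_list_def)
  qed
  finally show ?thesis by (rule sym)
qed

lemma pair_form_word:
  assumes "\<alpha> \<in> words m" "\<beta> \<in> words m"
  shows "pair_form m \<omega> \<alpha> \<beta> = omega_pow m \<omega> (sum_list \<alpha>) (sum_list \<beta>)"
proof -
  have l: "length (word m (sum_list \<alpha>)) = m" "length (word m (sum_list \<beta>)) = m"
    using assms sum_list_le_words length_word by auto
  obtain \<rho> where r: "\<rho> permutes {..<m}" "permute_list \<rho> (word m (sum_list \<alpha>)) = \<alpha>"
    using mset_eq_permutation[OF mset_word[OF assms(1)]] l by metis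
  obtain \<pi> where p: "\<pi> permutes {..<m}" "permute_list \<pi> (word m (sum_list \<beta>)) = \<beta>"
    using mset_eq_permutation[OF mset_word[OF assms(2)]] l by metis
  show ?thesis
    unfolding omega_pow_pair_form
    using pair_form_permute_left[OF r(1) l(1), of \<omega> \<beta>] pair_form_permute_right[OF p(1) l(2), of \<omega>] r(2) p(2) by simp
qed

lemma sym_pow_words: "sym_pow m t k j = (\<Sum>\<beta> | \<beta> \<in> words m \<and> sum_list \<beta> = k. \<Prod>l<m. t (\<beta> ! l) (word m j ! l))"
  unfolding sym_pow_def words_def by (rule sum.cong) auto

lemma sum_words_group:
  "(\<Sum>\<beta>\<in>words m. f \<beta>) = (\<Sum>k\<le>m. \<Sum>\<beta> | \<beta> \<in> words m \<and> sum_list \<beta> = k. (f \<beta> :: complex))"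
proof -
  have "sum_list ` words m \<subseteq> {..m}" using sum_list_le_words by auto
  from sum.group[OF finite_words finite_atMost this, of f] show ?thesis by simp
qed

lemma sum_swap2: "(\<Sum>a\<in>A. \<Sum>b\<in>B. \<Sum>c\<in>C. \<Sum>d\<in>D. F a b c d) = (\<Sum>c\<in>C. \<Sum>d\<in>D. \<Sum>a\<in>A. \<Sum>b\<in>B. F a b c d)"
proof -
  have "(\<Sum>a\<in>A. \<Sum>b\<in>B. \<Sum>c\<in>C. \<Sum>d\<in>D. F a b c d) = (\<Sum>a\<in>A. \<Sum>c\<in>C. \<Sum>b\<in>B. \<Sum>d\<in>D. F a b c d)"
    by (intro sum.cong refl sum.swap)
  also have "\<dots> = (\<Sum>c\<in>C. \<Sum>a\<in>A. \<Sum>b\<in>B. \<Sum>d\<in>D. F a b c d)" by (rule sum.swap)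
  also have "\<dots> = (\<Sum>c\<in>C. \<Sum>a\<in>A. \<Sum>d\<in>D. \<Sum>b\<in>B. F a b c d)" by (intro sum.cong refl sum.swap)
  also have "\<dots> = (\<Sum>c\<in>C. \<Sum>d\<in>D. \<Sum>a\<in>A. \<Sum>b\<in>B. F a b c d)" by (intro sum.cong refl sum.swap)
  finally show ?thesis .
qed

text \<open>Functoriality of the induced form. The monomial indices are replaced by free words, the
  words are rearranged along \<sigma> and \<tau>, and the sum over all words then factors into one
  sum per letter by the distributive law.\<close>

lemma sym_pow_transform:
  assumes "j \<le> m" "j' \<le> m"
  shows "(\<Sum>k\<le>m. \<Sum>k'\<le>m. sym_pow m t k j * sym_pow m t k' j' * omega_pow m \<omega> k k') =
    omega_pow m (\<lambda>a b. \<Sum>c<2. \<Sum>d<2. t c a * t d b * \<omega> c d) j j'"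
proof -
  let ?T = "\<lambda>\<alpha> j. \<Prod>l<m. t (\<alpha> ! l) (word m j ! l)"
  let ?W = "words m" and ?P = "{\<sigma>. \<sigma> permutes {..<m}}"
  have "(\<Sum>k\<le>m. \<Sum>k'\<le>m. sym_pow m t k j * sym_pow m t k' j' * omega_pow m \<omega> k k') =
    (\<Sum>k\<le>m. \<Sum>k'\<le>m. \<Sum>\<alpha> | \<alpha> \<in> ?W \<and> sum_list \<alpha> = k. \<Sum>\<beta> | \<beta> \<in> ?W \<and> sum_list \<beta> = k'. ?T \<alpha> j * ?T \<beta> j' * pair_form m \<omega> \<alpha> \<beta>)"
  proof (intro sum.cong refl)
    fix k k'
    have "sym_pow m t k j * sym_pow m t k' j' * omega_pow m \<omega> k k' =
      (\<Sum>\<alpha> | \<alpha> \<in> ?W \<and> sum_list \<alpha> = k. \<Sum>\<beta> | \<beta> \<in> ?W \<and> sum_list \<beta> = k'. ?T \<alpha> j * ?T \<beta> j' * omega_pow m \<omega> k k')"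
      unfolding sym_pow_words sum_product unfolding sum_distrib_right ..
    also have "\<dots> = (\<Sum>\<alpha> | \<alpha> \<in> ?W \<and> sum_list \<alpha> = k. \<Sum>\<beta> | \<beta> \<in> ?W \<and> sum_list \<beta> = k'. ?T \<alpha> j * ?T \<beta> j' * pair_form m \<omega> \<alpha> \<beta>)"
      by (intro sum.cong refl) (simp add: pair_form_word)
    finally show "sym_pow m t k j * sym_pow m t k' j' * omega_pow m \<omega> k k' = (\<Sum>\<alpha> | \<alpha> \<in> ?W \<and> sum_list \<alpha> = k. \<Sum>\<beta> | \<beta> \<in> ?W \<and> sum_list \<beta> = k'. ?T \<alpha> j * ?T \<beta> j' * pair_form m \<omega> \<alpha> \<beta>)" .
  qed
  also have "\<dots> = (\<Sum>k\<le>m. \<Sum>\<alpha> | \<alpha> \<in> ?W \<and> sum_list \<alpha> = k. \<Sum>k'\<le>m. \<Sum>\<beta> | \<beta> \<in> ?W \<and> sum_list \<beta> = k'. ?T \<alpha> j * ?T \<beta> j' * pair_form m \<omega> \<alpha> \<beta>)"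
    by (intro sum.cong refl sum.swap)
  also have "\<dots> = (\<Sum>\<alpha>\<in>?W. \<Sum>\<beta>\<in>?W. ?T \<alpha> j * ?T \<beta> j' * pair_form m \<omega> \<alpha> \<beta>)"
    unfolding sum_words_group[symmetric] ..
  also have "\<dots> = (\<Sum>\<alpha>\<in>?W. \<Sum>\<beta>\<in>?W. \<Sum>\<sigma>\<in>?P. \<Sum>\<tau>\<in>?P. ?T \<alpha> j * ?T \<beta> j' * (\<Prod>l<m. \<omega> (\<alpha> ! \<sigma> l) (\<beta> ! \<tau> l)))"
    unfolding pair_form_def by (simp only: sum_distrib_left)
  also have "\<dots> = (\<Sum>\<sigma>\<in>?P. \<Sum>\<tau>\<in>?P. \<Sum>\<alpha>\<in>?W. \<Sum>\<beta>\<in>?W. ?T \<alpha> j * ?T \<beta> j' * (\<Prod>l<m. \<omega> (\<alpha> ! \<sigma> l) (\<beta> ! \<tau> l)))"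
    by (rule sum_swap2)
  also have "\<dots> = (\<Sum>\<sigma>\<in>?P. \<Sum>\<tau>\<in>?P. \<Prod>l<m. \<Sum>c<2. \<Sum>d<2. t c (word m j ! \<sigma> l) * t d (word m j' ! \<tau> l) * \<omega> c d)"
  proof (intro sum.cong refl)
    fix \<sigma> \<tau> assume s: "\<sigma> \<in> ?P" and t: "\<tau> \<in> ?P"
    let ?G = "\<lambda>\<alpha> \<beta>. (\<Prod>l<m. t (\<alpha> ! l) (word m j ! \<sigma> l)) * (\<Prod>l<m. t (\<beta> ! l) (word m j' ! \<tau> l)) * (\<Prod>l<m. \<omega> (\<alpha> ! l) (\<beta> ! l))"
    have reindex: "(\<Sum>\<alpha>\<in>?W. f (permute_list \<rho> \<alpha>)) = (\<Sum>\<alpha>\<in>?W. f \<alpha>)" if r: "\<rho> permutes {..<m}" for \<rho> and f :: "nat list \<Rightarrow> complex"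
    proof (rule sum.reindex_bij_witness[where i = "permute_list (inv \<rho>)" and j = "permute_list \<rho>"])
      fix \<alpha> assume a: "\<alpha> \<in> ?W"
      then have la: "length \<alpha> = m" by (simp add: words_def)
      have r': "inv \<rho> permutes {..<m}" by (rule permutes_inv[OF r])
      show "permute_list (inv \<rho>) (permute_list \<rho> \<alpha>) = \<alpha>"
        using permute_list_compose[of "inv \<rho>" \<alpha> \<rho>] r r' la permutes_inv_o[OF r] by simp
      show "permute_list \<rho> (permute_list (inv \<rho>) \<alpha>) = \<alpha>"
        using permute_list_compose[of \<rho> \<alpha> "inv \<rho>"] r r' la permutes_inv_o[OF r] by simp
      show "permute_list \<rho> \<alpha> \<in> ?W" "permute_list (inv \<rho>) \<alpha> \<in> ?W"
        using a r r' la by (auto simp: words_def)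
    qed simp
    have T: "?T \<alpha> i = (\<Prod>l<m. t (permute_list \<rho> \<alpha> ! l) (word m i ! \<rho> l))"
      if "\<alpha> \<in> ?W" "\<rho> permutes {..<m}" for \<alpha> i \<rho>
      using prod.permute[OF that(2), of "\<lambda>l. t (\<alpha> ! l) (word m i ! l)"] that
      by (simp add: comp_def permute_list_def words_def)
    have "(\<Sum>\<alpha>\<in>?W. \<Sum>\<beta>\<in>?W. ?T \<alpha> j * ?T \<beta> j' * (\<Prod>l<m. \<omega> (\<alpha> ! \<sigma> l) (\<beta> ! \<tau> l))) =
      (\<Sum>\<alpha>\<in>?W. \<Sum>\<beta>\<in>?W. ?G (permute_list \<sigma> \<alpha>) (permute_list \<tau> \<beta>))"
    proof (intro sum.cong refl)
      fix \<alpha> \<beta> assume a: "\<alpha> \<in> ?W" and b: "\<beta> \<in> ?W"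
      have "(\<Prod>l<m. \<omega> (\<alpha> ! \<sigma> l) (\<beta> ! \<tau> l)) = (\<Prod>l<m. \<omega> (permute_list \<sigma> \<alpha> ! l) (permute_list \<tau> \<beta> ! l))"
        using a b by (simp add: permute_list_def words_def)
      then show "?T \<alpha> j * ?T \<beta> j' * (\<Prod>l<m. \<omega> (\<alpha> ! \<sigma> l) (\<beta> ! \<tau> l)) =
       ?G (permute_list \<sigma> \<alpha>) (permute_list \<tau> \<beta>)"
        using T[OF a, of \<sigma> j] T[OF b, of \<tau> j'] s t by simp
    qed
    also have "\<dots> = (\<Sum>\<alpha>\<in>?W. \<Sum>\<beta>\<in>?W. ?G (permute_list \<sigma> \<alpha>) \<beta>)"
      using t by (intro sum.cong refl reindex) simp
    also have "\<dots> = (\<Sum>\<alpha>\<in>?W. \<Sum>\<beta>\<in>?W. ?G \<alpha> \<beta>)"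
      using s by (intro reindex[where f = "\<lambda>\<alpha>. \<Sum>\<beta>\<in>?W. ?G \<alpha> \<beta>"]) simp
    also have "\<dots> = (\<Sum>\<alpha>\<in>?W. \<Sum>\<beta>\<in>?W. \<Prod>l<m. t (\<alpha> ! l) (word m j ! \<sigma> l) * t (\<beta> ! l) (word m j' ! \<tau> l) * \<omega> (\<alpha> ! l) (\<beta> ! l))"
      by (simp only: prod.distrib)
    also have "\<dots> = (\<Prod>l<m. \<Sum>c<2. \<Sum>d<2. t c (word m j ! \<sigma> l) * t d (word m j' ! \<tau> l) * \<omega> c d)"
      by (simp only: prod_sum_words)
    finally show "(\<Sum>\<alpha>\<in>?W. \<Sum>\<beta>\<in>?W. ?T \<alpha> j * ?T \<beta> j' * (\<Prod>l<m. \<omega> (\<alpha> ! \<sigma> l) (\<beta> ! \<tau> l))) =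
      (\<Prod>l<m. \<Sum>c<2. \<Sum>d<2. t c (word m j ! \<sigma> l) * t d (word m j' ! \<tau> l) * \<omega> c d)" .
  qed
  finally show ?thesis unfolding omega_pow_def .
qed

lemma omega_pow_cong:
  assumes "\<And>a b. a < 2 \<Longrightarrow> b < 2 \<Longrightarrow> \<omega> a b = \<omega>' a b" "j \<le> m" "k \<le> m"
  shows "omega_pow m \<omega> j k = omega_pow m \<omega>' j k"
  unfolding omega_pow_def
proof (intro sum.cong refl prod.cong)
  fix \<sigma> \<tau> l assume s: "\<sigma> \<in> {\<sigma>. \<sigma> permutes {..<m}}" "\<tau> \<in> {\<sigma>. \<sigma> permutes {..<m}}" and l: "l \<in> {..<m}"
  then have "\<sigma> l < m" "\<tau> l < m" using permutes_in_image[of _ "{..<m}" l] by auto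
  then show "\<omega> (word m j ! \<sigma> l) (word m k ! \<tau> l) = \<omega>' (word m j ! \<sigma> l) (word m k ! \<tau> l)"
    using assms word_lt2 by simp
qed

text \<open>Each of the m factors contributes a sign, and an odd number of them leaves one; the
  roles of the two permutations are exchanged.\<close>

lemma omega_pow_skew:
  assumes "\<And>a b. a < 2 \<Longrightarrow> b < 2 \<Longrightarrow> \<omega> b a = - \<omega> a b" "j \<le> m" "k \<le> m" "odd m"
  shows "omega_pow m \<omega> k j = - omega_pow m \<omega> j k"
proof -
  have "omega_pow m \<omega> k j = (\<Sum>\<sigma> | \<sigma> permutes {..<m}. \<Sum>\<tau> | \<tau> permutes {..<m}. \<Prod>l<m. - \<omega> (word m j ! \<tau> l) (word m k ! \<sigma> l))"
    unfolding omega_pow_def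
  proof (intro sum.cong refl prod.cong)
    fix \<sigma> \<tau> l assume s: "\<sigma> \<in> {\<sigma>. \<sigma> permutes {..<m}}" "\<tau> \<in> {\<sigma>. \<sigma> permutes {..<m}}" and l: "l \<in> {..<m}"
    then have "\<sigma> l < m" "\<tau> l < m" using permutes_in_image[of _ "{..<m}" l] by auto
    then show "\<omega> (word m k ! \<sigma> l) (word m j ! \<tau> l) = - \<omega> (word m j ! \<tau> l) (word m k ! \<sigma> l)"
      by (intro assms(1) word_lt2[OF assms(2)] word_lt2[OF assms(3)])
  qed
  also have "\<dots> = - (\<Sum>\<sigma> | \<sigma> permutes {..<m}. \<Sum>\<tau> | \<tau> permutes {..<m}. \<Prod>l<m. \<omega> (word m j ! \<tau> l) (word m k ! \<sigma> l))"
    using assms(4) by (simp add: prod_uminus sum_negf)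
  also have "\<dots> = - omega_pow m \<omega> j k" unfolding omega_pow_def by (subst sum.swap) (rule refl)
  finally show ?thesis .
qed

text \<open>A skew form in rank two pairs only different letters. A nonzero product therefore has
  complementary letters at all places, and the numbers of ones add up to m. Conversely all nonzero
  products have the same value, so they cannot cancel and it suffices to exhibit one.\<close>

lemma omega_pow_antidiagonal:
  assumes "symplectic_mat 2 \<omega>" "j \<le> m" "k \<le> m"
  shows "omega_pow m \<omega> j k \<noteq> 0 \<longleftrightarrow> j + k = m"
proof -
  have skew: "\<omega> b a = - \<omega> a b" if "a < 2" "b < 2" for a b
    using assms(1) that unfolding symplectic_mat_def by blast
  have "\<omega> 0 0 = - \<omega> 0 0" "\<omega> 1 1 = - \<omega> 1 1" by (rule skew; simp)+
  moreover have "x = - x \<Longrightarrow> x = 0" for x :: complex by (simp add: complex_eq_iff)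
  ultimately have d: "\<omega> 0 0 = 0" "\<omega> 1 1 = 0" by blast+
  have d': "\<omega> 1 0 = - \<omega> 0 1" by (rule skew) simp_all
  have w: "\<omega> 0 1 \<noteq> 0"
  proof
    assume "\<omega> 0 1 = 0"
    then have "\<forall>b<2. (\<Sum>a<2. (\<lambda>_. 1) a * \<omega> a b) = 0" using d d' by (auto simp: numeral_2_eq_2 less_Suc_eq)
    moreover have "\<forall>x. (\<forall>b<2. (\<Sum>a<2. x a * \<omega> a b) = 0) \<longrightarrow> (\<forall>a<2. x a = 0)"
      using assms(1) unfolding symplectic_mat_def by (rule conjunct2)
    ultimately have "\<forall>a<2::nat. (\<lambda>_. 1) a = (0::complex)" by (blast dest: spec[where x = "\<lambda>_. 1"])
    from spec[OF this, of 0] show False by simp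
  qed
  have lt: "\<sigma> l < m" if "\<sigma> permutes {..<m}" "l < m" for \<sigma> l using permutes_in_image[OF that(1), of l] that by simp
  have nz: "(\<Prod>l<m. \<omega> (word m j ! \<sigma> l) (word m k ! \<tau> l)) \<noteq> 0 \<longleftrightarrow> (\<forall>l<m. word m j ! \<sigma> l \<noteq> word m k ! \<tau> l)"
    if p: "\<sigma> permutes {..<m}" "\<tau> permutes {..<m}" for \<sigma> \<tau>
  proof -
    have "\<omega> (word m j ! \<sigma> l) (word m k ! \<tau> l) \<noteq> 0 \<longleftrightarrow> word m j ! \<sigma> l \<noteq> word m k ! \<tau> l" if "l < m" for l
      using d d' w lt[OF p(1) that] lt[OF p(2) that] assms by (simp add: word_nth)
    then show ?thesis by auto
  qed
  have cnt: "(\<Sum>l<m. word m i ! \<sigma> l) = i" if "\<sigma> permutes {..<m}" "i \<le> m" for \<sigma> i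
  proof -
    have "(\<Sum>l<m. word m i ! \<sigma> l) = (\<Sum>l<m. word m i ! l)"
      using sum.permute[OF that(1), of "(!) (word m i)"] by (simp add: comp_def)
    also have "\<dots> = sum_list (word m i)" using length_word[OF that(2)] by (simp add: sum_list_sum_nth atLeast0LessThan)
    also have "\<dots> = i" by (simp add: word_def sum_list_replicate)
    finally show ?thesis .
  qed
  show ?thesis
  proof
    assume "omega_pow m \<omega> j k \<noteq> 0"
    then obtain \<sigma> where s: "\<sigma> permutes {..<m}" "(\<Sum>\<tau> | \<tau> permutes {..<m}. \<Prod>l<m. \<omega> (word m j ! \<sigma> l) (word m k ! \<tau> l)) \<noteq> 0"
      unfolding omega_pow_def using sum.not_neutral_contains_not_neutral by blast
    then obtain \<tau> where t: "\<tau> permutes {..<m}" "(\<Prod>l<m. \<omega> (word m j ! \<sigma> l) (word m k ! \<tau> l)) \<noteq> 0"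
      using sum.not_neutral_contains_not_neutral by blast
    have "word m j ! \<sigma> l + word m k ! \<tau> l = 1" if "l < m" for l
      using nz[OF s(1) t(1)] t(2) that lt[OF s(1) that] lt[OF t(1) that] assms by (auto simp: word_nth split: if_splits)
    then have "(\<Sum>l<m. word m j ! \<sigma> l + word m k ! \<tau> l) = m" by simp
    then show "j + k = m" using cnt[OF s(1) assms(2)] cnt[OF t(1) assms(3)] by (simp add: sum.distrib)
  next
    assume jk: "j + k = m"
    let ?v = "\<omega> 0 1 ^ (m - j) * \<omega> 1 0 ^ j"
    let ?S = "\<lambda>\<sigma> \<tau>. \<forall>l<m. word m j ! \<sigma> l \<noteq> word m k ! \<tau> l"
    let ?P = "{\<sigma>. \<sigma> permutes {..<m}}"
    have v: "(\<Prod>l<m. \<omega> (word m j ! \<sigma> l) (word m k ! \<tau> l)) = (if ?S \<sigma> \<tau> then ?v else 0)"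
      if p: "\<sigma> permutes {..<m}" "\<tau> permutes {..<m}" for \<sigma> \<tau>
    proof (cases "?S \<sigma> \<tau>")
      case True
      have "(\<Prod>l<m. \<omega> (word m j ! \<sigma> l) (word m k ! \<tau> l)) = (\<Prod>l<m. \<omega> (word m j ! \<sigma> l) (1 - word m j ! \<sigma> l))"
      proof (intro prod.cong refl)
        fix l assume "l \<in> {..<m}"
        then show "\<omega> (word m j ! \<sigma> l) (word m k ! \<tau> l) = \<omega> (word m j ! \<sigma> l) (1 - word m j ! \<sigma> l)"
          using True lt[OF p(1), of l] lt[OF p(2), of l] assms by (auto simp: word_nth split: if_splits)
      qed
      also have "\<dots> = (\<Prod>l<m. \<omega> (word m j ! l) (1 - word m j ! l))"
        using prod.permute[OF p(1), of "\<lambda>l. \<omega> (word m j ! l) (1 - word m j ! l)"] by (simp add: comp_def)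
      also have "\<dots> = (\<Prod>l<m. if l < m - j then \<omega> 0 1 else \<omega> 1 0)"
        using assms by (intro prod.cong refl) (simp add: word_nth)
      also have "\<dots> = ?v"
      proof -
        have "{..<m} \<inter> {l. l < m - j} = {..<m - j}" "{..<m} \<inter> - {l. l < m - j} = {m - j..<m}" by auto
        then show ?thesis using assms by (simp add: prod.If_cases)
      qed
      finally show ?thesis using True by simp
    next
      case False
      then show ?thesis using nz[OF p] by auto
    qed
    have "omega_pow m \<omega> j k = (\<Sum>\<sigma>\<in>?P. \<Sum>\<tau>\<in>?P. if ?S \<sigma> \<tau> then ?v else 0)"
      unfolding omega_pow_def by (intro sum.cong refl) (simp add: v)
    also have "\<dots> = of_nat (\<Sum>\<sigma>\<in>?P. card {\<tau> \<in> ?P. ?S \<sigma> \<tau>}) * ?v"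
      using finite_permutations[of "{..<m}"] by (simp add: sum_distrib_right sum.If_cases Int_def)
    finally have e: "omega_pow m \<omega> j k = of_nat (\<Sum>\<sigma>\<in>?P. card {\<tau> \<in> ?P. ?S \<sigma> \<tau>}) * ?v" .
    \<comment> \<open>Reversing the positions turns the word with k = m - j ones into the complement
      of the word with j ones, so this \<tau> together with \<open>id\<close> gives a nonzero
      product.\<close>
    define \<tau> where "\<tau> l = (if l < m then m - 1 - l else l)" for l
    have \<tau>: "\<tau> permutes {..<m}"
      by (rule bij_imp_permutes, rule bij_betwI[where g = \<tau>]) (auto simp: \<tau>_def)
    have "?S id \<tau>" using assms jk by (auto simp: word_nth \<tau>_def)
    then have "\<tau> \<in> {\<tau> \<in> ?P. ?S id \<tau>}" using \<tau> by simp
    then have ne: "{\<tau> \<in> ?P. ?S id \<tau>} \<noteq> {}" by blast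
    have fin: "finite ?P" by (rule finite_permutations) simp
    have "0 < card {\<tau> \<in> ?P. ?S id \<tau>}"
      unfolding card_gt_0_iff by (intro conjI ne finite_subset[OF _ fin]) (rule Collect_restrict)
    also have "\<dots> \<le> (\<Sum>\<sigma>\<in>?P. card {\<tau> \<in> ?P. ?S \<sigma> \<tau>})"
      by (rule member_le_sum[where f = "\<lambda>\<sigma>. card {\<tau> \<in> ?P. ?S \<sigma> \<tau>}"]) (simp_all add: permutes_id fin del: id_apply)
    finally have "(of_nat (\<Sum>\<sigma>\<in>?P. card {\<tau> \<in> ?P. ?S \<sigma> \<tau>}) :: complex) \<noteq> 0"
      unfolding of_nat_eq_0_iff by (rule gr_implies_not0)
    moreover have "?v \<noteq> 0" using w d' by simp
    ultimately show "omega_pow m \<omega> j k \<noteq> 0" unfolding e by (rule no_zero_divisors)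
  qed
qed

section \<open>The metric and the four-form at a point\<close>

definition pair_E :: "nat \<Rightarrow> cmat \<Rightarrow> (nat \<Rightarrow> complex) \<Rightarrow> (nat \<Rightarrow> complex) \<Rightarrow> complex" where
  "pair_E r \<epsilon> \<xi> \<zeta> = (\<Sum>a<r. \<Sum>b<r. \<epsilon> a b * \<xi> a * \<zeta> b)"

definition pair_F :: "nat \<Rightarrow> cmat \<Rightarrow> (nat \<Rightarrow> complex) \<Rightarrow> (nat \<Rightarrow> complex) \<Rightarrow> complex" where
  "pair_F m f \<xi> \<zeta> = (\<Sum>j\<le>m. \<Sum>k\<le>m. f j k * \<xi> j * \<zeta> k)"

text \<open>Coframe and matrices are plain data here, detached from charts and from the point. The E
  indices are hidden in \<open>pair_E\<close>, so that only F indices have to be moved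
  around.\<close>

definition metric_at :: "nat \<Rightarrow> nat \<Rightarrow> cmat \<Rightarrow> cmat \<Rightarrow> (nat \<Rightarrow> nat \<Rightarrow> 'n::finite covec) \<Rightarrow> complex^'n \<Rightarrow> complex^'n \<Rightarrow> complex" where
  "metric_at m r \<epsilon> f \<theta> u v =
     (\<Sum>j\<le>m. \<Sum>k\<le>m. f j k * pair_E r \<epsilon> (\<lambda>a. \<theta> a j [u]) (\<lambda>b. \<theta> b k [v]))"

definition tensor_at :: "nat \<Rightarrow> nat \<Rightarrow> cmat \<Rightarrow> cmat \<Rightarrow> (nat \<Rightarrow> nat \<Rightarrow> 'n::finite covec) \<Rightarrow> complex^'n \<Rightarrow> complex^'n \<Rightarrow> complex^'n \<Rightarrow> complex^'n \<Rightarrow> complex" where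
  "tensor_at m r \<epsilon> f \<theta> x0 x1 x2 x3 =
     (\<Sum>A\<le>m. \<Sum>B\<le>m. \<Sum>C\<le>m. \<Sum>D\<le>m. f A C * f B D *
        (pair_E r \<epsilon> (\<lambda>a. \<theta> a A [x0]) (\<lambda>b. \<theta> b B [x1]) * pair_E r \<epsilon> (\<lambda>a. \<theta> a C [x2]) (\<lambda>b. \<theta> b D [x3])))"

text \<open>Alternating once, after all index sums, keeps iterated wedge products out of the later
  computations.\<close>

definition form_at :: "nat \<Rightarrow> nat \<Rightarrow> cmat \<Rightarrow> cmat \<Rightarrow> (nat \<Rightarrow> nat \<Rightarrow> 'n::finite covec) \<Rightarrow> 'n covec" where
  "form_at m r \<epsilon> f \<theta> = Alt 4 (\<lambda>ys. tensor_at m r \<epsilon> f \<theta> (ys ! 0) (ys ! 1) (ys ! 2) (ys ! 3))"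

lemma gr_metric_at: "gr_metric m r \<omega>E \<omega>H \<theta> i z u v =
   metric_at m r (\<omega>E i z) (omega_pow m (\<omega>H i z)) (\<lambda>a j. \<theta> i a j z) u v"
proof -
  have "gr_metric m r \<omega>E \<omega>H \<theta> i z u v = (\<Sum>j\<le>m. \<Sum>k\<le>m. \<Sum>a<r. \<Sum>b<r.
        \<omega>E i z a b * omega_pow m (\<omega>H i z) j k * \<theta> i a j z [u] * \<theta> i b k z [v])"
    unfolding gr_metric_def by (rule sum_swap2)
  also have "\<dots> = metric_at m r (\<omega>E i z) (omega_pow m (\<omega>H i z)) (\<lambda>a j. \<theta> i a j z) u v"
    unfolding metric_at_def pair_E_def sum_distrib_left by (intro sum.cong refl) (simp add: mult_ac)
  finally show ?thesis .
qed

lemma wedge_Alt_right: "wedge 1 k \<theta> (Alt k S) xs = Alt (Suc k) (tensor 1 \<theta> S) xs"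
  using Alt_tensor_right[of 1 k \<theta> S xs] by (simp add: wedge_Alt)

text \<open>At each stage \<open>wedge\<close> divides by exactly the factorial that the alternation
  of its right factor produces, so no constant is left.\<close>

lemma wedge_4:
  "wedge 1 3 \<theta>1 (wedge 1 2 \<theta>2 (wedge 1 1 \<theta>3 \<theta>4)) xs =
   Alt 4 (\<lambda>ys. \<theta>1 [ys ! 0] * \<theta>2 [ys ! 1] * \<theta>3 [ys ! 2] * \<theta>4 [ys ! 3]) xs"
proof -
  have 1: "wedge 1 1 \<theta>3 \<theta>4 = Alt 2 (tensor 1 \<theta>3 \<theta>4)"
    by (rule ext) (simp add: wedge_Alt numeral_2_eq_2)
  have 2: "wedge 1 2 \<theta>2 (Alt 2 (tensor 1 \<theta>3 \<theta>4)) = Alt 3 (tensor 1 \<theta>2 (tensor 1 \<theta>3 \<theta>4))"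
    by (rule ext) (use wedge_Alt_right[of 2] in \<open>simp add: numeral_3_eq_3 numeral_2_eq_2\<close>)
  have "wedge 1 3 \<theta>1 (Alt 3 (tensor 1 \<theta>2 (tensor 1 \<theta>3 \<theta>4))) xs = Alt (Suc 3) (tensor 1 \<theta>1 (tensor 1 \<theta>2 (tensor 1 \<theta>3 \<theta>4))) xs"
    by (rule wedge_Alt_right)
  also have "Suc 3 = 4" by simp
  also have "Alt 4 (tensor 1 \<theta>1 (tensor 1 \<theta>2 (tensor 1 \<theta>3 \<theta>4))) xs =
    Alt 4 (\<lambda>ys. \<theta>1 [ys ! 0] * \<theta>2 [ys ! 1] * \<theta>3 [ys ! 2] * \<theta>4 [ys ! 3]) xs"
  proof (rule Alt_cong)
    fix ys :: "(complex^'a) list" assume "length ys = 4"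
    then obtain a b c d where "ys = [a, b, c, d]" by (auto simp: numeral_eq_Suc length_Suc_conv)
    then show "tensor 1 \<theta>1 (tensor 1 \<theta>2 (tensor 1 \<theta>3 \<theta>4)) ys = \<theta>1 [ys ! 0] * \<theta>2 [ys ! 1] * \<theta>3 [ys ! 2] * \<theta>4 [ys ! 3]"
      by (simp add: tensor_def numeral_eq_Suc)
  qed
  finally show ?thesis unfolding 1 2 .
qed

lemma Alt_sum1: "Alt n (\<lambda>ys. \<Sum>p\<in>P. T p ys) xs = (\<Sum>p\<in>P. Alt n (T p) xs)"
  using Alt_sum[where c = "\<lambda>_. 1"] by simp

lemma gr_form_at: "gr_form m r \<omega>E \<omega>H \<theta> i z xs =
   form_at m r (\<omega>E i z) (omega_pow m (\<omega>H i z)) (\<lambda>a j. \<theta> i a j z) xs"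
proof -
  let ?e = "\<omega>E i z" and ?f = "omega_pow m (\<omega>H i z)" and ?t = "\<lambda>a A x. \<theta> i a A z [x]"
  have "gr_form m r \<omega>E \<omega>H \<theta> i z xs = Alt 4 (\<lambda>ys. \<Sum>a<r. \<Sum>b<r. \<Sum>c<r. \<Sum>d<r. \<Sum>A\<le>m. \<Sum>B\<le>m. \<Sum>C\<le>m. \<Sum>D\<le>m.
     ?e a b * ?e c d * ?f A C * ?f B D * (?t a A (ys ! 0) * ?t b B (ys ! 1) * ?t c C (ys ! 2) * ?t d D (ys ! 3))) xs"
    unfolding gr_form_def wedge_4 Alt_scale[symmetric] Alt_sum1[symmetric] ..
  also have "\<dots> = form_at m r ?e ?f (\<lambda>a j. \<theta> i a j z) xs"
    unfolding form_at_def
  proof (rule Alt_cong)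
    fix ys :: "(complex^'b) list"
    let ?F = "\<lambda>a b c d A B C D. ?e a b * ?e c d * ?f A C * ?f B D * (?t a A (ys ! 0) * ?t b B (ys ! 1) * ?t c C (ys ! 2) * ?t d D (ys ! 3))"
    have "(\<Sum>a<r. \<Sum>b<r. \<Sum>c<r. \<Sum>d<r. \<Sum>A\<le>m. \<Sum>B\<le>m. \<Sum>C\<le>m. \<Sum>D\<le>m. ?F a b c d A B C D)
      = (\<Sum>a<r. \<Sum>b<r. \<Sum>A\<le>m. \<Sum>B\<le>m. \<Sum>c<r. \<Sum>d<r. \<Sum>C\<le>m. \<Sum>D\<le>m. ?F a b c d A B C D)"
      by (intro sum.cong refl sum_swap2)
    also have "\<dots> = (\<Sum>A\<le>m. \<Sum>B\<le>m. \<Sum>a<r. \<Sum>b<r. \<Sum>c<r. \<Sum>d<r. \<Sum>C\<le>m. \<Sum>D\<le>m. ?F a b c d A B C D)"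
      by (rule sum_swap2)
    also have "\<dots> = (\<Sum>A\<le>m. \<Sum>B\<le>m. \<Sum>a<r. \<Sum>b<r. \<Sum>C\<le>m. \<Sum>D\<le>m. \<Sum>c<r. \<Sum>d<r. ?F a b c d A B C D)"
      by (intro sum.cong refl sum_swap2)
    also have "\<dots> = (\<Sum>A\<le>m. \<Sum>B\<le>m. \<Sum>C\<le>m. \<Sum>D\<le>m. \<Sum>a<r. \<Sum>b<r. \<Sum>c<r. \<Sum>d<r. ?F a b c d A B C D)"
      by (intro sum.cong refl sum_swap2)
    also have "\<dots> = tensor_at m r ?e ?f (\<lambda>a j. \<theta> i a j z) (ys ! 0) (ys ! 1) (ys ! 2) (ys ! 3)"
      unfolding tensor_at_def
    proof (intro sum.cong refl)
      fix A B C D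
      have "(\<Sum>a<r. \<Sum>b<r. \<Sum>c<r. \<Sum>d<r. ?F a b c d A B C D) =
        (\<Sum>a<r. \<Sum>b<r. ?f A C * ?f B D * ((?e a b * ?t a A (ys ! 0) * ?t b B (ys ! 1)) * (\<Sum>c<r. \<Sum>d<r. ?e c d * ?t c C (ys ! 2) * ?t d D (ys ! 3))))"
        unfolding sum_distrib_left by (intro sum.cong refl) (simp add: mult_ac)
      also have "\<dots> = ?f A C * ?f B D * (pair_E r ?e (\<lambda>a. ?t a A (ys ! 0)) (\<lambda>b. ?t b B (ys ! 1)) * pair_E r ?e (\<lambda>a. ?t a C (ys ! 2)) (\<lambda>b. ?t b D (ys ! 3)))"
        unfolding pair_E_def sum_distrib_left[symmetric] sum_distrib_right[symmetric] ..
      finally show "(\<Sum>a<r. \<Sum>b<r. \<Sum>c<r. \<Sum>d<r. ?F a b c d A B C D) =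
        ?f A C * ?f B D * (pair_E r ?e (\<lambda>a. ?t a A (ys ! 0)) (\<lambda>b. ?t b B (ys ! 1)) * pair_E r ?e (\<lambda>a. ?t a C (ys ! 2)) (\<lambda>b. ?t b D (ys ! 3)))" .
    qed
    finally show "(\<Sum>a<r. \<Sum>b<r. \<Sum>c<r. \<Sum>d<r. \<Sum>A\<le>m. \<Sum>B\<le>m. \<Sum>C\<le>m. \<Sum>D\<le>m. ?F a b c d A B C D)
      = tensor_at m r ?e ?f (\<lambda>a j. \<theta> i a j z) (ys ! 0) (ys ! 1) (ys ! 2) (ys ! 3)" .
  qed
  finally show ?thesis .
qed

text \<open>The Klein four-group consists of even permutations and leaves each summand unchanged.
  The 24 summands therefore fall into six classes of four, one for each ordered pair of different
  matchings, the first for E and the second for F.\<close>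

lemma permutation_sum_4:
  fixes E F :: "nat \<Rightarrow> nat \<Rightarrow> complex"
  assumes E: "\<And>s t. E t s = - E s t" and F: "\<And>s t. F t s = - F s t"
  shows "(\<Sum>\<sigma> | \<sigma> permutes {..<4}. of_int (sign \<sigma>) *
      (E (\<sigma> 0) (\<sigma> 1) * E (\<sigma> 2) (\<sigma> 3) * F (\<sigma> 0) (\<sigma> 2) * F (\<sigma> 1) (\<sigma> 3))) =
    4 * (E 0 1 * E 2 3 * (F 0 2 * F 1 3 + F 0 3 * F 1 2) - (E 0 2 * E 1 3 + E 0 3 * E 1 2) * (F 0 1 * F 2 3)
      + E 0 2 * E 1 3 * (F 0 3 * F 1 2) - E 0 3 * E 1 2 * (F 0 2 * F 1 3))"
proof -
  have s: "{..<4::nat} = {0, 1, 2, 3}" by auto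
  have f1: "finite {1, 2, 3::nat}" "0 \<notin> {1, 2, 3::nat}" by auto
  have f2: "finite {2, 3::nat}" "1 \<notin> {2, 3::nat}" by auto
  have f3: "finite {3::nat}" "2 \<notin> {3::nat}" by auto
  have E': "E 1 0 = - E 0 1" "E 2 0 = - E 0 2" "E 3 0 = - E 0 3" "E 2 1 = - E 1 2" "E 3 1 = - E 1 3" "E 3 2 = - E 2 3"
    by (rule E)+
  have F': "F 1 0 = - F 0 1" "F 2 0 = - F 0 2" "F 3 0 = - F 0 3" "F 2 1 = - F 1 2" "F 3 1 = - F 1 3" "F 3 2 = - F 2 3"
    by (rule F)+
  show ?thesis
    unfolding s sum_over_permutations_insert[OF f1] sum_over_permutations_insert[OF f2] sum_over_permutations_insert[OF f3] permutes_sing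
    by (simp add: sign_swap_id permutation_swap_id permutation_compose sign_compose transpose_eq_iff Transposition.transpose_def
        E'[unfolded One_nat_def] F'[unfolded One_nat_def] algebra_simps)
qed


section \<open>Behaviour under a change of frame\<close>

lemma pair_E_cong:
  "(\<And>a. a < r \<Longrightarrow> \<xi> a = \<xi>' a) \<Longrightarrow> (\<And>a. a < r \<Longrightarrow> \<zeta> a = \<zeta>' a) \<Longrightarrow> pair_E r \<epsilon> \<xi> \<zeta> = pair_E r \<epsilon> \<xi>' \<zeta>'"
  unfolding pair_E_def by (intro sum.cong refl) simp

lemma pair_E_linear: "pair_E r \<epsilon> (\<lambda>a. c * \<xi> a + \<xi>' a) \<zeta> = c * pair_E r \<epsilon> \<xi> \<zeta> + pair_E r \<epsilon> \<xi>' \<zeta>"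
  unfolding pair_E_def sum_distrib_left sum.distrib[symmetric] by (intro sum.cong refl) (simp add: algebra_simps)

lemma pair_E_sums:
  "pair_E r \<epsilon> (\<lambda>a. \<Sum>i\<in>I. c i * u i a) (\<lambda>a. \<Sum>j\<in>J. d j * v j a) = (\<Sum>i\<in>I. \<Sum>j\<in>J. c i * d j * pair_E r \<epsilon> (u i) (v j))"
proof -
  have "pair_E r \<epsilon> (\<lambda>a. \<Sum>i\<in>I. c i * u i a) (\<lambda>a. \<Sum>j\<in>J. d j * v j a) =
    (\<Sum>a<r. \<Sum>b<r. \<Sum>i\<in>I. \<Sum>j\<in>J. \<epsilon> a b * (c i * u i a) * (d j * v j b))"
    unfolding pair_E_def
    by (simp only: sum_distrib_left sum_distrib_right) (rule sum.cong[OF refl], rule sum.cong[OF refl], rule sum.swap)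
  also have "\<dots> = (\<Sum>i\<in>I. \<Sum>j\<in>J. \<Sum>a<r. \<Sum>b<r. \<epsilon> a b * (c i * u i a) * (d j * v j b))"
    by (rule sum_swap2)
  also have "\<dots> = (\<Sum>i\<in>I. \<Sum>j\<in>J. c i * d j * pair_E r \<epsilon> (u i) (v j))"
    unfolding pair_E_def sum_distrib_left by (intro sum.cong refl) (simp add: mult_ac)
  finally show ?thesis .
qed

lemma pair_E_transform:
  assumes "\<And>b b'. b < r \<Longrightarrow> b' < r \<Longrightarrow> \<epsilon>' b b' = (\<Sum>a<r. \<Sum>a'<r. s a b * s a' b' * \<epsilon> a a')"
  shows "pair_E r \<epsilon> (\<lambda>a. \<Sum>b<r. s a b * \<xi> b) (\<lambda>a. \<Sum>b<r. s a b * \<zeta> b) = pair_E r \<epsilon>' \<xi> \<zeta>"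
proof -
  have "pair_E r \<epsilon> (\<lambda>a. \<Sum>b<r. s a b * \<xi> b) (\<lambda>a. \<Sum>b<r. s a b * \<zeta> b) =
    (\<Sum>b<r. \<Sum>b'<r. \<xi> b * \<zeta> b' * pair_E r \<epsilon> (\<lambda>a. s a b) (\<lambda>a. s a b'))"
    unfolding pair_E_sums[symmetric] by (simp only: mult.commute)
  also have "\<dots> = pair_E r \<epsilon>' \<xi> \<zeta>"
    unfolding pair_E_def[of r \<epsilon>']
  proof (intro sum.cong refl)
    fix b b' assume "b \<in> {..<r}" "b' \<in> {..<r}"
    then show "\<xi> b * \<zeta> b' * pair_E r \<epsilon> (\<lambda>a. s a b) (\<lambda>a. s a b') = \<epsilon>' b b' * \<xi> b * \<zeta> b'"
      by (simp add: assms pair_E_def mult_ac sum_distrib_left)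
  qed
  finally show ?thesis .
qed

lemma pair_E_tensor_transform:
  assumes "\<And>b b'. b < r \<Longrightarrow> b' < r \<Longrightarrow> \<epsilon>' b b' = (\<Sum>a<r. \<Sum>a'<r. s a b * s a' b' * \<epsilon> a a')"
    and "\<And>a. a < r \<Longrightarrow> \<theta> a A [x] = (\<Sum>b<r. \<Sum>B\<le>m. s a b * S A B * \<theta>' b B [x'])"
    and "\<And>a. a < r \<Longrightarrow> \<theta> a A' [y] = (\<Sum>b<r. \<Sum>B\<le>m. s a b * S A' B * \<theta>' b B [y'])"
  shows "pair_E r \<epsilon> (\<lambda>a. \<theta> a A [x]) (\<lambda>a. \<theta> a A' [y]) =
    (\<Sum>B\<le>m. \<Sum>B'\<le>m. S A B * S A' B' * pair_E r \<epsilon>' (\<lambda>b. \<theta>' b B [x']) (\<lambda>b. \<theta>' b B' [y']))"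
proof -
  have e: "(\<Sum>b<r. \<Sum>B\<le>m. s a b * S A B * \<theta>' b B [x']) = (\<Sum>B\<le>m. S A B * (\<Sum>b<r. s a b * \<theta>' b B [x']))" for a A x'
    unfolding sum_distrib_left by (subst sum.swap) (simp add: mult_ac)
  have "pair_E r \<epsilon> (\<lambda>a. \<theta> a A [x]) (\<lambda>a. \<theta> a A' [y]) =
    pair_E r \<epsilon> (\<lambda>a. \<Sum>B\<le>m. S A B * (\<Sum>b<r. s a b * \<theta>' b B [x'])) (\<lambda>a. \<Sum>B\<le>m. S A' B * (\<Sum>b<r. s a b * \<theta>' b B [y']))"
    by (rule pair_E_cong) (simp_all only: assms(2,3) e)
  moreover have "pair_E r \<epsilon> (\<lambda>a. \<Sum>b<r. s a b * \<xi> b) (\<lambda>a. \<Sum>b<r. s a b * \<zeta> b) = pair_E r \<epsilon>' \<xi> \<zeta>" for \<xi> \<zeta>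
    by (rule pair_E_transform) (rule assms(1))
  ultimately show ?thesis unfolding pair_E_sums by simp
qed

text \<open>Serves two purposes: with transition matrices for s and S it glues the local
  expressions, with symplectic matrices it yields the invariance under the structure group.\<close>

lemma metric_at_transform:
  assumes "\<And>b b'. b < r \<Longrightarrow> b' < r \<Longrightarrow> \<epsilon>' b b' = (\<Sum>a<r. \<Sum>a'<r. s a b * s a' b' * \<epsilon> a a')"
    and f: "\<And>B B'. B \<le> m \<Longrightarrow> B' \<le> m \<Longrightarrow> f' B B' = (\<Sum>A\<le>m. \<Sum>A'\<le>m. S A B * S A' B' * f A A')"
    and "\<And>a A. a < r \<Longrightarrow> A \<le> m \<Longrightarrow> \<theta> a A [x] = (\<Sum>b<r. \<Sum>B\<le>m. s a b * S A B * \<theta>' b B [x'])"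
    and "\<And>a A. a < r \<Longrightarrow> A \<le> m \<Longrightarrow> \<theta> a A [y] = (\<Sum>b<r. \<Sum>B\<le>m. s a b * S A B * \<theta>' b B [y'])"
  shows "metric_at m r \<epsilon> f \<theta> x y = metric_at m r \<epsilon>' f' \<theta>' x' y'"
proof -
  let ?P = "\<lambda>B B'. pair_E r \<epsilon>' (\<lambda>b. \<theta>' b B [x']) (\<lambda>b. \<theta>' b B' [y'])"
  have "metric_at m r \<epsilon> f \<theta> x y = (\<Sum>A\<le>m. \<Sum>A'\<le>m. \<Sum>B\<le>m. \<Sum>B'\<le>m. f A A' * (S A B * S A' B' * ?P B B'))"
    unfolding metric_at_def
  proof (intro sum.cong refl)
    fix A A' assume A: "A \<in> {..m}" "A' \<in> {..m}"
    have "pair_E r \<epsilon> (\<lambda>a. \<theta> a A [x]) (\<lambda>a. \<theta> a A' [y]) = (\<Sum>B\<le>m. \<Sum>B'\<le>m. S A B * S A' B' * ?P B B')"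
      by (rule pair_E_tensor_transform[OF assms(1)]) (use A assms(3,4) in simp_all)
    then show "f A A' * pair_E r \<epsilon> (\<lambda>a. \<theta> a A [x]) (\<lambda>b. \<theta> b A' [y]) = (\<Sum>B\<le>m. \<Sum>B'\<le>m. f A A' * (S A B * S A' B' * ?P B B'))"
      by (simp only: sum_distrib_left)
  qed
  also have "\<dots> = (\<Sum>B\<le>m. \<Sum>B'\<le>m. \<Sum>A\<le>m. \<Sum>A'\<le>m. f A A' * (S A B * S A' B' * ?P B B'))"
    by (rule sum_swap2)
  also have "\<dots> = metric_at m r \<epsilon>' f' \<theta>' x' y'"
    unfolding metric_at_def
  proof (intro sum.cong refl)
    fix B B' assume B: "B \<in> {..m}" "B' \<in> {..m}"
    then have "f' B B' * ?P B B' = (\<Sum>A\<le>m. \<Sum>A'\<le>m. S A B * S A' B' * f A A' * ?P B B')"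
      using f[of B B'] by (simp only: sum_distrib_right atMost_iff)
    also have "\<dots> = (\<Sum>A\<le>m. \<Sum>A'\<le>m. f A A' * (S A B * S A' B' * ?P B B'))"
      by (intro sum.cong refl) (simp add: mult_ac)
    finally show "(\<Sum>A\<le>m. \<Sum>A'\<le>m. f A A' * (S A B * S A' B' * ?P B B')) = f' B B' * ?P B B'" by (rule sym)
  qed
  finally show ?thesis .
qed

lemma sum_product_split:
  "(\<Sum>A\<in>P. \<Sum>B\<in>Q. \<Sum>C\<in>R. \<Sum>D\<in>S. g1 A C * g2 B D) = (\<Sum>A\<in>P. \<Sum>C\<in>R. g1 A C) * (\<Sum>B\<in>Q. \<Sum>D\<in>S. (g2 B D :: complex))"
proof -
  have "(\<Sum>A\<in>P. \<Sum>B\<in>Q. \<Sum>C\<in>R. \<Sum>D\<in>S. g1 A C * g2 B D) = (\<Sum>A\<in>P. \<Sum>C\<in>R. \<Sum>B\<in>Q. \<Sum>D\<in>S. g1 A C * g2 B D)"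
    by (intro sum.cong refl sum.swap)
  then show ?thesis unfolding sum_distrib_right unfolding sum_distrib_left .
qed

text \<open>The E form pairs the slots 01 and 23, the F form pairs 02 and 13. The interchanges of
  sums collect the old F indices inside, where they separate into the two F pairs.\<close>

lemma tensor_at_transform:
  assumes "\<And>b b'. b < r \<Longrightarrow> b' < r \<Longrightarrow> \<epsilon>' b b' = (\<Sum>a<r. \<Sum>a'<r. s a b * s a' b' * \<epsilon> a a')"
    and f: "\<And>B B'. B \<le> m \<Longrightarrow> B' \<le> m \<Longrightarrow> f' B B' = (\<Sum>A\<le>m. \<Sum>A'\<le>m. S A B * S A' B' * f A A')"
    and x: "\<And>i a A. i < 4 \<Longrightarrow> a < r \<Longrightarrow> A \<le> m \<Longrightarrow> \<theta> a A [x i] = (\<Sum>b<r. \<Sum>B\<le>m. s a b * S A B * \<theta>' b B [x' i])"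
  shows "tensor_at m r \<epsilon> f \<theta> (x 0) (x 1) (x 2) (x (3::nat)) = tensor_at m r \<epsilon>' f' \<theta>' (x' 0) (x' 1) (x' 2) (x' 3)"
proof -
  let ?P = "\<lambda>B B'. pair_E r \<epsilon>' (\<lambda>b. \<theta>' b B [x' 0]) (\<lambda>b. \<theta>' b B' [x' 1])"
  let ?Q = "\<lambda>B B'. pair_E r \<epsilon>' (\<lambda>b. \<theta>' b B [x' 2]) (\<lambda>b. \<theta>' b B' [x' 3])"
  let ?F = "\<lambda>A B C D A' B' C' D'. (f A C * S A A' * S C C') * (f B D * S B B' * S D D') * (?P A' B' * ?Q C' D')"
  have "tensor_at m r \<epsilon> f \<theta> (x 0) (x 1) (x 2) (x 3) =
    (\<Sum>A\<le>m. \<Sum>B\<le>m. \<Sum>C\<le>m. \<Sum>D\<le>m. \<Sum>A'\<le>m. \<Sum>B'\<le>m. \<Sum>C'\<le>m. \<Sum>D'\<le>m. ?F A B C D A' B' C' D')"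
    unfolding tensor_at_def
  proof (intro sum.cong refl)
    fix A B C D assume A: "A \<in> {..m}" "B \<in> {..m}" "C \<in> {..m}" "D \<in> {..m}"
    have 1: "pair_E r \<epsilon> (\<lambda>a. \<theta> a A [x 0]) (\<lambda>a. \<theta> a B [x 1]) = (\<Sum>A'\<le>m. \<Sum>B'\<le>m. S A A' * S B B' * ?P A' B')"
      by (rule pair_E_tensor_transform[OF assms(1)]) (use A x in simp_all)
    have 2: "pair_E r \<epsilon> (\<lambda>a. \<theta> a C [x 2]) (\<lambda>a. \<theta> a D [x 3]) = (\<Sum>C'\<le>m. \<Sum>D'\<le>m. S C C' * S D D' * ?Q C' D')"
      by (rule pair_E_tensor_transform[OF assms(1)]) (use A x in simp_all)
    show "f A C * f B D * (pair_E r \<epsilon> (\<lambda>a. \<theta> a A [x 0]) (\<lambda>b. \<theta> b B [x 1]) * pair_E r \<epsilon> (\<lambda>a. \<theta> a C [x 2]) (\<lambda>b. \<theta> b D [x 3]))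
      = (\<Sum>A'\<le>m. \<Sum>B'\<le>m. \<Sum>C'\<le>m. \<Sum>D'\<le>m. ?F A B C D A' B' C' D')"
      unfolding 1 2 sum_distrib_right unfolding sum_distrib_left by (intro sum.cong refl) (simp only: mult_ac)
  qed
  also have "\<dots> = (\<Sum>A\<le>m. \<Sum>B\<le>m. \<Sum>A'\<le>m. \<Sum>B'\<le>m. \<Sum>C\<le>m. \<Sum>D\<le>m. \<Sum>C'\<le>m. \<Sum>D'\<le>m. ?F A B C D A' B' C' D')"
    by (intro sum.cong refl sum_swap2)
  also have "\<dots> = (\<Sum>A'\<le>m. \<Sum>B'\<le>m. \<Sum>A\<le>m. \<Sum>B\<le>m. \<Sum>C\<le>m. \<Sum>D\<le>m. \<Sum>C'\<le>m. \<Sum>D'\<le>m. ?F A B C D A' B' C' D')"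
    by (rule sum_swap2)
  also have "\<dots> = (\<Sum>A'\<le>m. \<Sum>B'\<le>m. \<Sum>A\<le>m. \<Sum>B\<le>m. \<Sum>C'\<le>m. \<Sum>D'\<le>m. \<Sum>C\<le>m. \<Sum>D\<le>m. ?F A B C D A' B' C' D')"
    by (intro sum.cong refl sum_swap2)
  also have "\<dots> = (\<Sum>A'\<le>m. \<Sum>B'\<le>m. \<Sum>C'\<le>m. \<Sum>D'\<le>m. \<Sum>A\<le>m. \<Sum>B\<le>m. \<Sum>C\<le>m. \<Sum>D\<le>m. ?F A B C D A' B' C' D')"
    by (intro sum.cong refl sum_swap2)
  also have "\<dots> = tensor_at m r \<epsilon>' f' \<theta>' (x' 0) (x' 1) (x' 2) (x' 3)"
    unfolding tensor_at_def
  proof (intro sum.cong refl)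
    fix A' B' C' D' assume A: "A' \<in> {..m}" "B' \<in> {..m}" "C' \<in> {..m}" "D' \<in> {..m}"
    have g: "(\<Sum>A\<le>m. \<Sum>C\<le>m. f A C * S A B * S C B') = f' B B'" if "B \<in> {..m}" "B' \<in> {..m}" for B B'
      using that by (simp add: f mult_ac)
    have "(\<Sum>A\<le>m. \<Sum>B\<le>m. \<Sum>C\<le>m. \<Sum>D\<le>m. ?F A B C D A' B' C' D') =
      (\<Sum>A\<le>m. \<Sum>B\<le>m. \<Sum>C\<le>m. \<Sum>D\<le>m. (f A C * S A A' * S C C') * (f B D * S B B' * S D D')) * (?P A' B' * ?Q C' D')"
      by (simp only: sum_distrib_right)
    then show "(\<Sum>A\<le>m. \<Sum>B\<le>m. \<Sum>C\<le>m. \<Sum>D\<le>m. ?F A B C D A' B' C' D') = f' A' C' * f' B' D' * (?P A' B' * ?Q C' D')"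
      unfolding sum_product_split g[OF A(1,3)] g[OF A(2,4)] .
  qed
  finally show ?thesis .
qed

lemma permute_list_map_nth:
  assumes "\<sigma> permutes {..<n}" "length xs = n" "i < n"
  shows "permute_list \<sigma> (map G xs) ! i = G (xs ! \<sigma> i)"
  using permutes_in_image[OF assms(1), of i] assms(2,3) by (simp add: permute_list_def)

lemma form_at_transform:
  assumes "\<And>b b'. b < r \<Longrightarrow> b' < r \<Longrightarrow> \<epsilon>' b b' = (\<Sum>a<r. \<Sum>a'<r. s a b * s a' b' * \<epsilon> a a')"
    and f: "\<And>B B'. B \<le> m \<Longrightarrow> B' \<le> m \<Longrightarrow> f' B B' = (\<Sum>A\<le>m. \<Sum>A'\<le>m. S A B * S A' B' * f A A')"
    and x: "\<And>x a A. a < r \<Longrightarrow> A \<le> m \<Longrightarrow> \<theta> a A [L x] = (\<Sum>b<r. \<Sum>B\<le>m. s a b * S A B * \<theta>' b B [L' x])"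
  shows "form_at m r \<epsilon> f \<theta> (map L xs) = form_at m r \<epsilon>' f' \<theta>' (map L' xs)"
proof (cases "length xs = 4")
  case True
  have eq: "tensor_at m r \<epsilon> f \<theta> (permute_list \<sigma> (map L xs) ! 0) (permute_list \<sigma> (map L xs) ! 1) (permute_list \<sigma> (map L xs) ! 2) (permute_list \<sigma> (map L xs) ! 3) =
    tensor_at m r \<epsilon>' f' \<theta>' (permute_list \<sigma> (map L' xs) ! 0) (permute_list \<sigma> (map L' xs) ! 1) (permute_list \<sigma> (map L' xs) ! 2) (permute_list \<sigma> (map L' xs) ! 3)"
    if s: "\<sigma> permutes {..<4}" for \<sigma>
  proof -
    note n = permute_list_map_nth[OF s True]
    show ?thesis
      using tensor_at_transform[of r \<epsilon>' s \<epsilon> m f' S f \<theta> "\<lambda>i. L (xs ! \<sigma> i)" \<theta>' "\<lambda>i. L' (xs ! \<sigma> i)", OF assms(1,2) x]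
      by (simp add: n)
  qed
  show ?thesis
    unfolding form_at_def Alt_def length_map True simp_thms if_True
    by (rule sum.cong[OF refl]) (simp only: mem_Collect_eq eq)
qed (simp add: form_at_def Alt_def)

section \<open>The eigenvalue of the four-form\<close>

lemma multilin_1_sum: "multilin 1 \<theta> \<Longrightarrow> \<theta> [\<Sum>p\<in>P. c p *s u p] = (\<Sum>p\<in>P. c p * \<theta> [u p])"
  using multilin_sum[of 1 \<theta> "[]" "[]" c u P] by simp

lemma sum_delta2:
  assumes "finite P" "finite Q" "c \<in> P" "d \<in> Q"
  shows "(\<Sum>a\<in>P. \<Sum>b\<in>Q. if a = c then (if b = d then F a b else 0) else 0) = (F c d :: complex)"
proof -
  have "(\<Sum>a\<in>P. \<Sum>b\<in>Q. if a = c then (if b = d then F a b else 0) else 0) = (\<Sum>a\<in>P. if a = c then F a d else 0)"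
    by (rule sum.cong[OF refl]) (use assms in simp)
  then show ?thesis using assms by simp
qed

text \<open>The data at one point of one chart. Up to the eigenvalue all arguments are linear
  algebra in this setting.\<close>

locale frame_at =
  fixes m r :: nat and \<epsilon> h :: cmat and \<theta> :: "nat \<Rightarrow> nat \<Rightarrow> 'n::finite covec" and X :: "nat \<Rightarrow> nat \<Rightarrow> complex^'n"
  assumes theta_alt: "a < r \<Longrightarrow> j \<le> m \<Longrightarrow> alt_form 1 (\<theta> a j)"
    and theta_X: "a < r \<Longrightarrow> j \<le> m \<Longrightarrow> b < r \<Longrightarrow> k \<le> m \<Longrightarrow> \<theta> a j [X b k] = (if a = b \<and> j = k then 1 else 0)"
    and frame: "(\<Sum>a<r. \<Sum>j\<le>m. \<theta> a j [v] *s X a j) = v"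
    and symplectic_E: "symplectic_mat r \<epsilon>"
    and symplectic_H: "symplectic_mat 2 h"
    and odd_m: "odd m"
begin

abbreviation f :: cmat where "f \<equiv> omega_pow m h"
abbreviation g :: "complex^'n \<Rightarrow> complex^'n \<Rightarrow> complex" where "g \<equiv> metric_at m r \<epsilon> f \<theta>"
abbreviation \<Omega> :: "'n covec" where "\<Omega> \<equiv> form_at m r \<epsilon> f \<theta>"

lemma eps_skew: "a < r \<Longrightarrow> b < r \<Longrightarrow> \<epsilon> b a = - \<epsilon> a b"
  using symplectic_E unfolding symplectic_mat_def by blast

lemma eps_nondegenerate:
  assumes "\<And>b. b < r \<Longrightarrow> (\<Sum>a<r. x a * \<epsilon> a b) = 0" "a < r"
  shows "x a = 0"
proof -
  have "\<forall>x. (\<forall>b<r. (\<Sum>a<r. x a * \<epsilon> a b) = 0) \<longrightarrow> (\<forall>a<r. x a = 0)"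
    using symplectic_E unfolding symplectic_mat_def by (rule conjunct2)
  from spec[OF this, of x] assms show ?thesis by simp
qed

lemma f_skew: "j \<le> m \<Longrightarrow> k \<le> m \<Longrightarrow> f k j = - f j k"
proof (rule omega_pow_skew[OF _ _ _ odd_m])
  show "\<And>a b. a < 2 \<Longrightarrow> b < 2 \<Longrightarrow> h b a = - h a b"
    using symplectic_H unfolding symplectic_mat_def by blast
qed

lemma f_nonzero: "j \<le> m \<Longrightarrow> k \<le> m \<Longrightarrow> f j k \<noteq> 0 \<longleftrightarrow> j + k = m"
  by (rule omega_pow_antidiagonal[OF symplectic_H])

lemma theta_multilin: "a < r \<Longrightarrow> j \<le> m \<Longrightarrow> multilin 1 (\<theta> a j)"
  by (rule alt_form_multilin[OF theta_alt])

lemma theta_linear: "a < r \<Longrightarrow> j \<le> m \<Longrightarrow> \<theta> a j [c *s u + v] = c * \<theta> a j [u] + \<theta> a j [v]"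
  using multilinD[OF theta_multilin, of a j "[]" "[]" c u v] by simp

lemma theta_combination:
  assumes "b < r" "k \<le> m"
  shows "\<theta> b k [\<Sum>a<r. \<Sum>j\<le>m. c a j *s X a j] = c b k"
proof -
  have "\<theta> b k [\<Sum>a<r. 1 *s (\<Sum>j\<le>m. c a j *s X a j)] = (\<Sum>a<r. \<Sum>j\<le>m. c a j * \<theta> b k [X a j])"
    unfolding multilin_1_sum[OF theta_multilin[OF assms]] by simp
  also have "\<dots> = (\<Sum>a<r. \<Sum>j\<le>m. if a = b then if j = k then c a j else 0 else 0)"
    by (intro sum.cong refl) (use assms in \<open>auto simp: theta_X\<close>)
  also have "\<dots> = (\<Sum>a<r. if a = b then c a k else 0)"
    by (intro sum.cong refl) (use assms in simp)
  also have "\<dots> = c b k" using assms by simp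
  finally show ?thesis by simp
qed

lemma theta_eq_imp_eq:
  assumes "\<And>a j. a < r \<Longrightarrow> j \<le> m \<Longrightarrow> \<theta> a j [u] = \<theta> a j [v]" shows "u = v"
proof -
  have "(\<Sum>a<r. \<Sum>j\<le>m. \<theta> a j [u] *s X a j) = (\<Sum>a<r. \<Sum>j\<le>m. \<theta> a j [v] *s X a j)"
    by (intro sum.cong refl) (simp add: assms)
  then show ?thesis unfolding frame .
qed

lemma pair_E_skew: "pair_E r \<epsilon> \<zeta> \<xi> = - pair_E r \<epsilon> \<xi> \<zeta>"
proof -
  have "pair_E r \<epsilon> \<zeta> \<xi> = (\<Sum>b<r. \<Sum>a<r. \<epsilon> a b * \<zeta> a * \<xi> b)" unfolding pair_E_def by (rule sum.swap)
  also have "\<dots> = (\<Sum>b<r. \<Sum>a<r. - (\<epsilon> b a * \<xi> b * \<zeta> a))"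
  proof (intro sum.cong refl)
    fix a b assume "a \<in> {..<r}" "b \<in> {..<r}"
    then show "\<epsilon> a b * \<zeta> a * \<xi> b = - (\<epsilon> b a * \<xi> b * \<zeta> a)" using eps_skew[of b a] by simp
  qed
  finally show ?thesis unfolding pair_E_def sum_negf .
qed

lemma pair_F_skew: "pair_F m f \<zeta> \<xi> = - pair_F m f \<xi> \<zeta>"
proof -
  have "pair_F m f \<zeta> \<xi> = (\<Sum>b\<le>m. \<Sum>a\<le>m. f a b * \<zeta> a * \<xi> b)" unfolding pair_F_def by (rule sum.swap)
  also have "\<dots> = (\<Sum>b\<le>m. \<Sum>a\<le>m. - (f b a * \<xi> b * \<zeta> a))"
  proof (intro sum.cong refl)
    fix a b assume "a \<in> {..m}" "b \<in> {..m}"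
    then show "f a b * \<zeta> a * \<xi> b = - (f b a * \<xi> b * \<zeta> a)" using f_skew[of b a] by simp
  qed
  finally show ?thesis unfolding pair_F_def sum_negf .
qed

lemma pair_E_theta_linear:
  "j \<le> m \<Longrightarrow> pair_E r \<epsilon> (\<lambda>a. \<theta> a j [c *s u + v]) \<zeta> = c * pair_E r \<epsilon> (\<lambda>a. \<theta> a j [u]) \<zeta> + pair_E r \<epsilon> (\<lambda>a. \<theta> a j [v]) \<zeta>"
  unfolding pair_E_linear[symmetric] by (rule pair_E_cong) (simp_all add: theta_linear)

lemma g_linear': "g (c *s u + v) w = c * g u w + g v w"
  unfolding metric_at_def sum_distrib_left sum.distrib[symmetric]
  by (intro sum.cong refl) (simp add: pair_E_theta_linear distrib_left mult.left_commute)

lemma g_sym': "g u v = g v u"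
proof -
  have "g u v = (\<Sum>k\<le>m. \<Sum>j\<le>m. f j k * pair_E r \<epsilon> (\<lambda>a. \<theta> a j [u]) (\<lambda>b. \<theta> b k [v]))"
    unfolding metric_at_def by (rule sum.swap)
  also have "\<dots> = g v u"
    unfolding metric_at_def
  proof (intro sum.cong refl)
    fix j k assume "j \<in> {..m}" "k \<in> {..m}"
    then show "f j k * pair_E r \<epsilon> (\<lambda>a. \<theta> a j [u]) (\<lambda>b. \<theta> b k [v]) = f k j * pair_E r \<epsilon> (\<lambda>a. \<theta> a k [v]) (\<lambda>b. \<theta> b j [u])"
      using f_skew[of j k] pair_E_skew[of "\<lambda>b. \<theta> b k [v]" "\<lambda>a. \<theta> a j [u]"] by simp
  qed
  finally show ?thesis .
qed

text \<open>The matrix f is antidiagonal, so a frame vector with index C only sees the components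
  with index m - C. Products with X c (m - j) thus isolate the j-th components of u, which is how
  nondegeneracy is reduced to that of \<epsilon>.\<close>

lemma g_X:
  assumes "c < r" "C \<le> m"
  shows "g u (X c C) = f (m - C) C * (\<Sum>a<r. \<theta> a (m - C) [u] * \<epsilon> a c)"
proof -
  have p: "pair_E r \<epsilon> \<xi> (\<lambda>b. \<theta> b k [X c C]) = (if k = C then \<Sum>a<r. \<xi> a * \<epsilon> a c else 0)" if "k \<le> m" for \<xi> k
  proof -
    have "pair_E r \<epsilon> \<xi> (\<lambda>b. \<theta> b k [X c C]) = (\<Sum>a<r. \<Sum>b<r. if b = c then (if k = C then \<xi> a * \<epsilon> a b else 0) else 0)"
      unfolding pair_E_def by (intro sum.cong refl) (use assms that in \<open>auto simp: theta_X\<close>)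
    then show ?thesis using assms by simp
  qed
  have "g u (X c C) = (\<Sum>j\<le>m. \<Sum>k\<le>m. if k = C then f j k * (\<Sum>a<r. \<theta> a j [u] * \<epsilon> a c) else 0)"
    unfolding metric_at_def by (intro sum.cong refl) (simp add: p)
  also have "\<dots> = (\<Sum>j\<le>m. f j C * (\<Sum>a<r. \<theta> a j [u] * \<epsilon> a c))"
    by (intro sum.cong refl) (use assms in simp)
  also have "\<dots> = (\<Sum>j\<le>m. if j = m - C then f j C * (\<Sum>a<r. \<theta> a j [u] * \<epsilon> a c) else 0)"
  proof (intro sum.cong refl)
    fix j assume "j \<in> {..m}"
    then show "f j C * (\<Sum>a<r. \<theta> a j [u] * \<epsilon> a c) = (if j = m - C then f j C * (\<Sum>a<r. \<theta> a j [u] * \<epsilon> a c) else 0)"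
      using f_nonzero[of j C] assms by auto
  qed
  also have "\<dots> = f (m - C) C * (\<Sum>a<r. \<theta> a (m - C) [u] * \<epsilon> a c)" by simp
  finally show ?thesis .
qed

lemma g_nondegenerate':
  assumes "\<And>v. g u v = 0" shows "u = 0"
proof (rule theta_eq_imp_eq)
  fix a j assume a: "a < r" "j \<le> m"
  have "(\<Sum>a<r. \<theta> a j [u] * \<epsilon> a c) = 0" if "c < r" for c
    using assms[of "X c (m - j)"] g_X[OF that, of "m - j" u] f_nonzero[of j "m - j"] a by simp
  from eps_nondegenerate[of "\<lambda>a. \<theta> a j [u]", OF this a(1)]
  show "\<theta> a j [u] = \<theta> a j [0]" using multilin_zero[OF theta_multilin[OF a], of "[]" "[]"] by simp
qed

sublocale complex_metric g
  by standard (rule g_linear', rule g_sym', rule g_nondegenerate')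

text \<open>Both sides are the trace of the identity, computed in the standard basis and in the
  frame.\<close>

lemma dimension: "CARD('n) = r * (m + 1)"
proof -
  have "of_nat CARD('n) = (\<Sum>k\<in>(UNIV :: 'n set). (axis k (1::complex) :: complex^'n) $ k)" by simp
  also have "\<dots> = (\<Sum>k\<in>UNIV. \<Sum>a<r. \<Sum>j\<le>m. \<theta> a j [axis k 1] * X a j $ k)"
  proof (rule sum.cong[OF refl])
    fix k :: 'n
    have "(\<Sum>a<r. \<Sum>j\<le>m. \<theta> a j [axis k 1] *s X a j) $ k = (\<Sum>a<r. \<Sum>j\<le>m. \<theta> a j [axis k 1] * X a j $ k)" by simp
    then show "(axis k (1::complex) :: complex^'n) $ k = (\<Sum>a<r. \<Sum>j\<le>m. \<theta> a j [axis k 1] * X a j $ k)" unfolding frame .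
  qed
  also have "\<dots> = (\<Sum>a<r. \<Sum>k\<in>UNIV. \<Sum>j\<le>m. \<theta> a j [axis k 1] * X a j $ k)" by (rule sum.swap)
  also have "\<dots> = (\<Sum>a<r. \<Sum>j\<le>m. \<Sum>k\<in>UNIV. \<theta> a j [axis k 1] * X a j $ k)"
    by (rule sum.cong[OF refl]) (rule sum.swap)
  also have "\<dots> = (\<Sum>a<r. \<Sum>j\<le>m. 1)"
  proof (intro sum.cong refl)
    fix a j assume "a \<in> {..<r}" "j \<in> {..m}"
    then show "(\<Sum>k\<in>UNIV. \<theta> a j [axis k 1] * X a j $ k) = 1"
      using multilin_1_axis[OF theta_multilin, of a j "X a j"] theta_X[of a j a j] by (simp add: mult.commute)
  qed
  also have "\<dots> = of_nat (r * (m + 1))" by (simp add: distrib_left)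
  finally show ?thesis by (simp only: of_nat_eq_iff)
qed

text \<open>The index type of the coordinates is nonempty, which excludes r = 0, and a skew matrix
  of size one is zero, hence degenerate.\<close>

lemma r_ge_2: "2 \<le> r"
proof -
  have "r \<noteq> 0" using dimension by (metis mult_0 zero_less_card_finite less_irrefl)
  moreover have "r \<noteq> 1"
  proof
    assume r: "r = 1"
    have "\<epsilon> 0 0 = - \<epsilon> 0 0" by (rule eps_skew) (simp_all add: r)
    then have "\<epsilon> 0 0 = 0" by (simp add: complex_eq_iff)
    then have "(1::complex) = 0" using eps_nondegenerate[of "\<lambda>_. 1" 0] r by simp
    then show False by simp
  qed
  ultimately show ?thesis by linarith
qed

lemma dimension_even: "even CARD('n)" and dimension_ge_4: "4 \<le> CARD('n)"
proof -
  show "even CARD('n)" unfolding dimension using odd_m by simp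
  have "2 * 2 \<le> r * (m + 1)" using r_ge_2 odd_m by (intro mult_le_mono) (auto elim: oddE)
  then show "4 \<le> CARD('n)" unfolding dimension by simp
qed

text \<open>The inverse matrices of \<open>\<epsilon>\<close> and \<open>f\<close>. That of \<open>\<epsilon>\<close> is read off from the metric duals of the
  coframe, which exist because the Gram matrix is invertible.\<close>

definition eta :: cmat where "eta a b = \<theta> b m [sharp (\<theta> a 0)] * f m 0"
definition phi :: cmat where "phi A B = (if A + B = m then 1 / f B A else 0)"

text \<open>By \<open>g_X\<close> the product of \<open>sharp (\<theta> a 0)\<close> with
  \<open>X c 0\<close> involves only the components with index m, weighted by f m 0; these are the
  entries of \<open>eta\<close>. On the other hand the product is the value of the coframe on the
  frame.\<close>

lemma eta_left_inverse: "a < r \<Longrightarrow> c < r \<Longrightarrow> (\<Sum>b<r. eta a b * \<epsilon> b c) = (if a = c then 1 else 0)"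
  using g_X[of c 0 "sharp (\<theta> a 0)"] g_sharp[OF theta_multilin, of a 0 "X c 0"] theta_X[of a 0 c 0]
  unfolding eta_def by (simp add: sum_distrib_left mult_ac)

lemma phi_left_inverse:
  assumes "A \<le> m" "C \<le> m" shows "(\<Sum>B\<le>m. phi A B * f B C) = (if A = C then 1 else 0)"
proof -
  have "(\<Sum>B\<le>m. phi A B * f B C) = (\<Sum>B\<le>m. if B = m - A then f B C / f B A else 0)"
    by (intro sum.cong refl) (use assms in \<open>auto simp: phi_def\<close>)
  also have "\<dots> = f (m - A) C / f (m - A) A" by simp
  also have "\<dots> = (if A = C then 1 else 0)"
    using f_nonzero[of "m - A" C] f_nonzero[of "m - A" A] assms by auto
  finally show ?thesis .
qed

lemma pair_E_delta_left: "c < r \<Longrightarrow> pair_E r \<epsilon> (\<lambda>a. if a = c then 1 else 0) \<zeta> = (\<Sum>b<r. \<epsilon> c b * \<zeta> b)"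
proof -
  assume c: "c < r"
  have "pair_E r \<epsilon> (\<lambda>a. if a = c then 1 else 0) \<zeta> = (\<Sum>a<r. if a = c then \<Sum>b<r. \<epsilon> a b * \<zeta> b else 0)"
    unfolding pair_E_def by (intro sum.cong refl) simp
  then show ?thesis using c by simp
qed

lemma pair_E_eta: "b < r \<Longrightarrow> pair_E r \<epsilon> (eta b) \<zeta> = \<zeta> b"
proof -
  assume b: "b < r"
  have "pair_E r \<epsilon> (eta b) \<zeta> = (\<Sum>c<r. \<Sum>a<r. \<epsilon> a c * eta b a * \<zeta> c)" unfolding pair_E_def by (rule sum.swap)
  also have "\<dots> = (\<Sum>c<r. (\<Sum>a<r. eta b a * \<epsilon> a c) * \<zeta> c)"
    unfolding sum_distrib_right by (intro sum.cong refl) (simp add: mult_ac)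
  also have "\<dots> = (\<Sum>c<r. if b = c then \<zeta> c else 0)" by (intro sum.cong refl) (simp add: eta_left_inverse b)
  finally show ?thesis using b by simp
qed

lemma pair_F_phi: "B \<le> m \<Longrightarrow> pair_F m f (phi B) \<zeta> = \<zeta> B"
proof -
  assume b: "B \<le> m"
  have "pair_F m f (phi B) \<zeta> = (\<Sum>c\<le>m. \<Sum>a\<le>m. f a c * phi B a * \<zeta> c)" unfolding pair_F_def by (rule sum.swap)
  also have "\<dots> = (\<Sum>c\<le>m. (\<Sum>a\<le>m. phi B a * f a c) * \<zeta> c)"
    unfolding sum_distrib_right by (intro sum.cong refl) (simp add: mult_ac)
  also have "\<dots> = (\<Sum>c\<le>m. if B = c then \<zeta> c else 0)" by (intro sum.cong refl) (simp add: phi_left_inverse b)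
  finally show ?thesis using b by simp
qed

lemma pair_E_delta: "c < r \<Longrightarrow> d < r \<Longrightarrow> pair_E r \<epsilon> (\<lambda>a. if a = c then 1 else 0) (\<lambda>b. if b = d then 1 else 0) = \<epsilon> c d"
  by (simp add: pair_E_delta_left if_distrib cong: if_cong)

lemma pair_F_delta: "C \<le> m \<Longrightarrow> D \<le> m \<Longrightarrow> pair_F m f (\<lambda>a. if a = C then 1 else 0) (\<lambda>b. if b = D then 1 else 0) = f C D"
proof -
  assume c: "C \<le> m" "D \<le> m"
  have "pair_F m f (\<lambda>a. if a = C then 1 else 0) (\<lambda>b. if b = D then 1 else 0) = (\<Sum>a\<le>m. \<Sum>b\<le>m. if a = C then (if b = D then f a b else 0) else 0)"
    unfolding pair_F_def by (intro sum.cong refl) simp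
  also have "\<dots> = (\<Sum>a\<le>m. if a = C then f a D else 0)"
    by (intro sum.cong refl) (use c in simp)
  finally show ?thesis using c by simp
qed

lemma eta_skew: "a < r \<Longrightarrow> b < r \<Longrightarrow> eta b a = - eta a b"
  using pair_E_eta[of a "eta b"] pair_E_eta[of b "eta a"] pair_E_skew[of "eta a" "eta b"] by simp

text \<open>The metric is a tensor product, and so is its inverse. The vector with the claimed
  components is shown to represent the covector, and metric duals are unique.\<close>

lemma theta_sharp:
  assumes "a < r" "A \<le> m" "b < r" "B \<le> m"
  shows "\<theta> b B [sharp (\<theta> a A)] = eta a b * phi A B"
proof -
  let ?u = "\<Sum>b<r. \<Sum>B\<le>m. (eta a b * phi A B) *s X b B"
  have "?u = sharp (\<theta> a A)"
  proof (rule sharp_unique[OF theta_multilin[OF assms(1,2)]])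
    fix x
    have "pair_E r \<epsilon> (\<lambda>b. \<theta> b j [?u]) (\<lambda>b. \<theta> b k [x]) = phi A j * \<theta> a k [x]" if "j \<le> m" for j k
    proof -
      have "pair_E r \<epsilon> (\<lambda>b. \<theta> b j [?u]) (\<lambda>b. \<theta> b k [x]) = pair_E r \<epsilon> (\<lambda>b. phi A j * eta a b + 0) (\<lambda>b. \<theta> b k [x])"
        by (rule pair_E_cong) (simp_all add: theta_combination that mult.commute)
      also have "\<dots> = phi A j * pair_E r \<epsilon> (eta a) (\<lambda>b. \<theta> b k [x]) + pair_E r \<epsilon> (\<lambda>_. 0) (\<lambda>b. \<theta> b k [x])"
        by (rule pair_E_linear)
      also have "\<dots> = phi A j * \<theta> a k [x]" using assms(1) by (simp add: pair_E_eta) (simp add: pair_E_def)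
      finally show ?thesis .
    qed
    then have "g ?u x = pair_F m f (phi A) (\<lambda>k. \<theta> a k [x])"
      unfolding metric_at_def pair_F_def by (intro sum.cong refl) (simp add: mult_ac)
    then show "g ?u x = \<theta> a A [x]" using assms by (simp add: pair_F_phi)
  qed
  then show ?thesis using theta_combination[OF assms(3,4), of "\<lambda>b B. eta a b * phi A B"] by simp
qed

text \<open>On decomposable vectors the sums over E and F indices separate. Frame vectors and metric
  duals of the coframe are of this kind, so this evaluation suffices for all that follows.\<close>

lemma tensor_at_decomposable:
  assumes "\<And>i a A. i < 4 \<Longrightarrow> a < r \<Longrightarrow> A \<le> m \<Longrightarrow> \<theta> a A [x i] = \<xi> i a * \<zeta> i A"
  shows "tensor_at m r \<epsilon> f \<theta> (x 0) (x 1) (x 2) (x (3::nat)) =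
    pair_E r \<epsilon> (\<xi> 0) (\<xi> 1) * pair_E r \<epsilon> (\<xi> 2) (\<xi> 3) * pair_F m f (\<zeta> 0) (\<zeta> 2) * pair_F m f (\<zeta> 1) (\<zeta> 3)"
proof -
  have p: "pair_E r \<epsilon> (\<lambda>a. \<theta> a A [x i]) (\<lambda>b. \<theta> b B [x j]) = \<zeta> i A * \<zeta> j B * pair_E r \<epsilon> (\<xi> i) (\<xi> j)"
    if "i < 4" "j < 4" "A \<le> m" "B \<le> m" for i j A B
  proof -
    have "pair_E r \<epsilon> (\<lambda>a. \<theta> a A [x i]) (\<lambda>b. \<theta> b B [x j]) = pair_E r \<epsilon> (\<lambda>a. \<Sum>_\<in>{()}. \<zeta> i A * \<xi> i a) (\<lambda>a. \<Sum>_\<in>{()}. \<zeta> j B * \<xi> j a)"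
      by (rule pair_E_cong) (simp_all add: assms that mult.commute)
    also have "\<dots> = \<zeta> i A * \<zeta> j B * pair_E r \<epsilon> (\<xi> i) (\<xi> j)" unfolding pair_E_sums by simp
    finally show ?thesis .
  qed
  have "tensor_at m r \<epsilon> f \<theta> (x 0) (x 1) (x 2) (x 3) = (\<Sum>A\<le>m. \<Sum>B\<le>m. \<Sum>C\<le>m. \<Sum>D\<le>m.
     (f A C * \<zeta> 0 A * \<zeta> 2 C) * (f B D * \<zeta> 1 B * \<zeta> 3 D) * (pair_E r \<epsilon> (\<xi> 0) (\<xi> 1) * pair_E r \<epsilon> (\<xi> 2) (\<xi> 3)))"
    unfolding tensor_at_def by (intro sum.cong refl) (simp add: p mult_ac)
  also have "\<dots> = pair_F m f (\<zeta> 0) (\<zeta> 2) * pair_F m f (\<zeta> 1) (\<zeta> 3) * (pair_E r \<epsilon> (\<xi> 0) (\<xi> 1) * pair_E r \<epsilon> (\<xi> 2) (\<xi> 3))"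
    unfolding sum_distrib_right[symmetric] sum_product_split pair_F_def ..
  finally show ?thesis by (simp add: mult_ac)
qed

lemma form_at_decomposable:
  assumes "length xs = 4" "\<And>i a A. i < 4 \<Longrightarrow> a < r \<Longrightarrow> A \<le> m \<Longrightarrow> \<theta> a A [xs ! i] = \<xi> i a * \<zeta> i A"
    and E: "\<And>i j. E i j = pair_E r \<epsilon> (\<xi> i) (\<xi> j)" and F: "\<And>i j. F i j = pair_F m f (\<zeta> i) (\<zeta> j)"
  shows "\<Omega> xs = 4 * (E 0 1 * E 2 3 * (F 0 2 * F 1 3 + F 0 3 * F 1 2) - (E 0 2 * E 1 3 + E 0 3 * E 1 2) * (F 0 1 * F 2 3)
      + E 0 2 * E 1 3 * (F 0 3 * F 1 2) - E 0 3 * E 1 2 * (F 0 2 * F 1 3))"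
proof -
  have "\<Omega> xs = (\<Sum>\<sigma> | \<sigma> permutes {..<4}. of_int (sign \<sigma>) *
      (E (\<sigma> 0) (\<sigma> 1) * E (\<sigma> 2) (\<sigma> 3) * F (\<sigma> 0) (\<sigma> 2) * F (\<sigma> 1) (\<sigma> 3)))"
    unfolding form_at_def Alt_def
  proof (simp only: assms(1) simp_thms if_True, intro sum.cong refl)
    fix \<sigma> :: "nat \<Rightarrow> nat" assume "\<sigma> \<in> {\<sigma>. \<sigma> permutes {..<4}}"
    then have s: "\<sigma> permutes {..<4}" by simp
    have n: "permute_list \<sigma> xs ! i = xs ! \<sigma> i" if "i < 4" for i
      using permute_list_map_nth[OF s assms(1) that, of "\<lambda>x. x"] by simp
    have lt: "\<sigma> i < 4" if "i < 4" for i using permutes_in_image[OF s, of i] that by simp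
    have "tensor_at m r \<epsilon> f \<theta> (xs ! \<sigma> 0) (xs ! \<sigma> 1) (xs ! \<sigma> 2) (xs ! \<sigma> 3) =
      E (\<sigma> 0) (\<sigma> 1) * E (\<sigma> 2) (\<sigma> 3) * F (\<sigma> 0) (\<sigma> 2) * F (\<sigma> 1) (\<sigma> 3)"
      unfolding E F
      by (rule tensor_at_decomposable[of "\<lambda>i. xs ! \<sigma> i" "\<lambda>i. \<xi> (\<sigma> i)" "\<lambda>i. \<zeta> (\<sigma> i)"]) (simp add: assms(2) lt)
    then show "of_int (sign \<sigma>) * tensor_at m r \<epsilon> f \<theta> (permute_list \<sigma> xs ! 0) (permute_list \<sigma> xs ! 1) (permute_list \<sigma> xs ! 2) (permute_list \<sigma> xs ! 3) =
      of_int (sign \<sigma>) * (E (\<sigma> 0) (\<sigma> 1) * E (\<sigma> 2) (\<sigma> 3) * F (\<sigma> 0) (\<sigma> 2) * F (\<sigma> 1) (\<sigma> 3))"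
      by (simp add: n)
  qed
  also have "\<dots> = 4 * (E 0 1 * E 2 3 * (F 0 2 * F 1 3 + F 0 3 * F 1 2) - (E 0 2 * E 1 3 + E 0 3 * E 1 2) * (F 0 1 * F 2 3)
      + E 0 2 * E 1 3 * (F 0 3 * F 1 2) - E 0 3 * E 1 2 * (F 0 2 * F 1 3))"
  proof (rule permutation_sum_4)
    show "E t s = - E s t" for s t unfolding E by (rule pair_E_skew)
    show "F t s = - F s t" for s t unfolding F by (rule pair_F_skew)
  qed
  finally show ?thesis .
qed

text \<open>A row of an inverse matrix represents a component functional, so each pairing of a
  metric dual with a frame vector is a Kronecker symbol. Only the pairings within the first two and
  within the last two arguments remain as matrix entries.\<close>

lemma form_at_sharp:
  assumes "a < r" "A \<le> m" "b < r" "B \<le> m" "c < r" "C \<le> m" "d < r" "D \<le> m"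
  defines "\<delta> \<equiv> \<lambda>i j. if i = (j::nat) then (1::complex) else 0"
  shows "\<Omega> [sharp (\<theta> b B), sharp (\<theta> a A), X c C, X d D] =
    4 * (eta a b * \<epsilon> c d * (\<delta> B C * \<delta> A D + \<delta> B D * \<delta> A C) - (\<delta> b c * \<delta> a d + \<delta> b d * \<delta> a c) * (phi A B * f C D)
      + \<delta> b c * \<delta> a d * (\<delta> B D * \<delta> A C) - \<delta> b d * \<delta> a c * (\<delta> B C * \<delta> A D))"
proof -
  let ?\<xi> = "\<lambda>i. [eta b, eta a, \<lambda>k. \<delta> k c, \<lambda>k. \<delta> k d] ! i"
  let ?\<zeta> = "\<lambda>i. [phi B, phi A, \<lambda>k. \<delta> k C, \<lambda>k. \<delta> k D] ! i"
  have dec: "\<theta> e G [[sharp (\<theta> b B), sharp (\<theta> a A), X c C, X d D] ! i] = ?\<xi> i e * ?\<zeta> i G"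
    if i: "i < 4" "e < r" "G \<le> m" for i e G
  proof -
    consider "i = 0" | "i = 1" | "i = 2" | "i = 3" using i(1) by linarith
    then show ?thesis
      by cases (use i assms(1-8) in \<open>auto simp: theta_sharp theta_X \<delta>_def numeral_2_eq_2 numeral_3_eq_3\<close>)
  qed
  have E: "pair_E r \<epsilon> (eta b) (eta a) = eta a b" "pair_E r \<epsilon> (eta b) (\<lambda>k. \<delta> k c) = \<delta> b c" "pair_E r \<epsilon> (eta b) (\<lambda>k. \<delta> k d) = \<delta> b d"
     "pair_E r \<epsilon> (eta a) (\<lambda>k. \<delta> k c) = \<delta> a c" "pair_E r \<epsilon> (eta a) (\<lambda>k. \<delta> k d) = \<delta> a d"
     "pair_E r \<epsilon> (\<lambda>k. \<delta> k c) (\<lambda>k. \<delta> k d) = \<epsilon> c d"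
    using assms(1-8) by (simp_all add: pair_E_eta) (simp add: \<delta>_def pair_E_delta)
  have F: "pair_F m f (phi B) (phi A) = phi A B" "pair_F m f (phi B) (\<lambda>k. \<delta> k C) = \<delta> B C" "pair_F m f (phi B) (\<lambda>k. \<delta> k D) = \<delta> B D"
     "pair_F m f (phi A) (\<lambda>k. \<delta> k C) = \<delta> A C" "pair_F m f (phi A) (\<lambda>k. \<delta> k D) = \<delta> A D"
     "pair_F m f (\<lambda>k. \<delta> k C) (\<lambda>k. \<delta> k D) = f C D"
    using assms(1-8) by (simp_all add: pair_F_phi) (simp add: \<delta>_def pair_F_delta)
  show ?thesis
    using form_at_decomposable[of "[sharp (\<theta> b B), sharp (\<theta> a A), X c C, X d D]" ?\<xi> ?\<zeta>, OF _ dec refl refl]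
    by (simp add: E F numeral_2_eq_2 numeral_3_eq_3)
qed

lemma alt_form_Omega: "alt_form 4 \<Omega>"
  unfolding form_at_def
proof (rule alt_form_Alt)
  have lin: "tensor_at m r \<epsilon> f \<theta> (c *s u + v) x1 x2 x3 = c * tensor_at m r \<epsilon> f \<theta> u x1 x2 x3 + tensor_at m r \<epsilon> f \<theta> v x1 x2 x3"
    "tensor_at m r \<epsilon> f \<theta> x0 (c *s u + v) x2 x3 = c * tensor_at m r \<epsilon> f \<theta> x0 u x2 x3 + tensor_at m r \<epsilon> f \<theta> x0 v x2 x3"
    "tensor_at m r \<epsilon> f \<theta> x0 x1 (c *s u + v) x3 = c * tensor_at m r \<epsilon> f \<theta> x0 x1 u x3 + tensor_at m r \<epsilon> f \<theta> x0 x1 v x3"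
    "tensor_at m r \<epsilon> f \<theta> x0 x1 x2 (c *s u + v) = c * tensor_at m r \<epsilon> f \<theta> x0 x1 x2 u + tensor_at m r \<epsilon> f \<theta> x0 x1 x2 v"
    for c u v x0 x1 x2 x3
  proof -
    have r: "pair_E r \<epsilon> \<xi> (\<lambda>a. \<theta> a j [c *s u + v]) = c * pair_E r \<epsilon> \<xi> (\<lambda>a. \<theta> a j [u]) + pair_E r \<epsilon> \<xi> (\<lambda>a. \<theta> a j [v])"
      if "j \<le> m" for \<xi> j
      unfolding pair_E_skew[of \<xi>] by (simp add: pair_E_theta_linear that)
    show "tensor_at m r \<epsilon> f \<theta> (c *s u + v) x1 x2 x3 = c * tensor_at m r \<epsilon> f \<theta> u x1 x2 x3 + tensor_at m r \<epsilon> f \<theta> v x1 x2 x3"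
      unfolding tensor_at_def sum_distrib_left sum.distrib[symmetric]
      by (intro sum.cong refl) (simp only: atMost_iff pair_E_theta_linear distrib_left distrib_right mult_ac)
    show "tensor_at m r \<epsilon> f \<theta> x0 (c *s u + v) x2 x3 = c * tensor_at m r \<epsilon> f \<theta> x0 u x2 x3 + tensor_at m r \<epsilon> f \<theta> x0 v x2 x3"
      unfolding tensor_at_def sum_distrib_left sum.distrib[symmetric]
      by (intro sum.cong refl) (simp only: atMost_iff r distrib_left distrib_right mult_ac)
    show "tensor_at m r \<epsilon> f \<theta> x0 x1 (c *s u + v) x3 = c * tensor_at m r \<epsilon> f \<theta> x0 x1 u x3 + tensor_at m r \<epsilon> f \<theta> x0 x1 v x3"
      unfolding tensor_at_def sum_distrib_left sum.distrib[symmetric]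
      by (intro sum.cong refl) (simp only: atMost_iff pair_E_theta_linear distrib_left distrib_right mult_ac)
    show "tensor_at m r \<epsilon> f \<theta> x0 x1 x2 (c *s u + v) = c * tensor_at m r \<epsilon> f \<theta> x0 x1 x2 u + tensor_at m r \<epsilon> f \<theta> x0 x1 x2 v"
      unfolding tensor_at_def sum_distrib_left sum.distrib[symmetric]
      by (intro sum.cong refl) (simp only: atMost_iff r distrib_left distrib_right mult_ac)
  qed
  show "multilin 4 (\<lambda>ys. tensor_at m r \<epsilon> f \<theta> (ys ! 0) (ys ! 1) (ys ! 2) (ys ! 3))"
    unfolding multilin_def
  proof (intro allI impI)
    fix ys zs :: "(complex^'n) list" and c u v
    assume l: "length ys + length zs + 1 = 4"
    consider "length ys = 0" "length zs = 3" | "length ys = 1" "length zs = 2" | "length ys = 2" "length zs = 1" | "length ys = 3" "length zs = 0"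
      using l by linarith
    then show "tensor_at m r \<epsilon> f \<theta> ((ys @ (c *s u + v) # zs) ! 0) ((ys @ (c *s u + v) # zs) ! 1) ((ys @ (c *s u + v) # zs) ! 2) ((ys @ (c *s u + v) # zs) ! 3) =
      c * tensor_at m r \<epsilon> f \<theta> ((ys @ u # zs) ! 0) ((ys @ u # zs) ! 1) ((ys @ u # zs) ! 2) ((ys @ u # zs) ! 3) +
      tensor_at m r \<epsilon> f \<theta> ((ys @ v # zs) ! 0) ((ys @ v # zs) ! 1) ((ys @ v # zs) ! 2) ((ys @ v # zs) ! 3)"
      by cases (simp_all add: nth_append lin)
  qed
qed

text \<open>Every term is a function of E indices times a function of F indices, so the fourfold sum
  is a product of traces \<open>SE\<close> and \<open>SF\<close>. Symmetric q against the skew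
  \<open>eta\<close> gives 0; the Kronecker terms return q in both orders, and f with opposite signs
  in the two orders; f against \<open>phi\<close> gives minus the rank m + 1.\<close>

lemma contraction_frame:
  assumes q: "\<And>a b. a < r \<Longrightarrow> b < r \<Longrightarrow> q b a = q a b"
    and c: "c < r" "C \<le> m" "d < r" "D \<le> m"
  shows "(\<Sum>a<r. \<Sum>A\<le>m. \<Sum>b<r. \<Sum>B\<le>m. q a b * f A B * \<Omega> [sharp (\<theta> b B), sharp (\<theta> a A), X c C, X d D])
    = 8 * (of_nat m + 2) * (q c d * f C D)"
proof -
  let ?\<delta> = "\<lambda>i j. if i = (j::nat) then (1::complex) else 0"
  let ?e1 = "eta" and ?e2 = "\<lambda>a b. ?\<delta> b c * ?\<delta> a d" and ?e3 = "\<lambda>a b. ?\<delta> b d * ?\<delta> a c"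
  let ?f1 = "phi" and ?f2 = "\<lambda>A B. ?\<delta> B C * ?\<delta> A D" and ?f3 = "\<lambda>A B. ?\<delta> B D * ?\<delta> A C"
  define SE where "SE u = (\<Sum>a<r. \<Sum>b<r. q a b * u a b)" for u
  define SF where "SF w = (\<Sum>A\<le>m. \<Sum>B\<le>m. f A B * w A B)" for w
  have split: "(\<Sum>a<r. \<Sum>A\<le>m. \<Sum>b<r. \<Sum>B\<le>m. (q a b * u a b) * (f A B * w A B)) = SE u * SF w" for u w
    unfolding SE_def SF_def by (rule sum_product_split)
  have split': "(\<Sum>a<r. \<Sum>A\<le>m. \<Sum>b<r. \<Sum>B\<le>m. k * ((q a b * u a b) * (f A B * w A B))) = k * (SE u * SF w)" for k u w
    unfolding split[symmetric] sum_distrib_left ..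
  have "(\<Sum>a<r. \<Sum>A\<le>m. \<Sum>b<r. \<Sum>B\<le>m. q a b * f A B * \<Omega> [sharp (\<theta> b B), sharp (\<theta> a A), X c C, X d D]) =
    (\<Sum>a<r. \<Sum>A\<le>m. \<Sum>b<r. \<Sum>B\<le>m.
      4 * \<epsilon> c d * ((q a b * ?e1 a b) * (f A B * ?f2 A B)) + 4 * \<epsilon> c d * ((q a b * ?e1 a b) * (f A B * ?f3 A B))
      - 4 * f C D * ((q a b * ?e2 a b) * (f A B * ?f1 A B)) - 4 * f C D * ((q a b * ?e3 a b) * (f A B * ?f1 A B))
      + 4 * ((q a b * ?e2 a b) * (f A B * ?f3 A B)) - 4 * ((q a b * ?e3 a b) * (f A B * ?f2 A B)))"
  proof (intro sum.cong refl)
    fix a A b B assume "a \<in> {..<r}" "A \<in> {..m}" "b \<in> {..<r}" "B \<in> {..m}"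
    then have a: "a < r" "A \<le> m" "b < r" "B \<le> m" by auto
    show "q a b * f A B * \<Omega> [sharp (\<theta> b B), sharp (\<theta> a A), X c C, X d D] =
      4 * \<epsilon> c d * ((q a b * ?e1 a b) * (f A B * ?f2 A B)) + 4 * \<epsilon> c d * ((q a b * ?e1 a b) * (f A B * ?f3 A B))
      - 4 * f C D * ((q a b * ?e2 a b) * (f A B * ?f1 A B)) - 4 * f C D * ((q a b * ?e3 a b) * (f A B * ?f1 A B))
      + 4 * ((q a b * ?e2 a b) * (f A B * ?f3 A B)) - 4 * ((q a b * ?e3 a b) * (f A B * ?f2 A B))"
      unfolding form_at_sharp[OF a c] by algebra
  qed
  also have "\<dots> = 4 * \<epsilon> c d * (SE ?e1 * SF ?f2) + 4 * \<epsilon> c d * (SE ?e1 * SF ?f3)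
      - 4 * f C D * (SE ?e2 * SF ?f1) - 4 * f C D * (SE ?e3 * SF ?f1)
      + 4 * (SE ?e2 * SF ?f3) - 4 * (SE ?e3 * SF ?f2)"
    unfolding sum.distrib sum_subtractf split'[of _ ?e1 ?f2] split'[of _ ?e1 ?f3] split'[of _ ?e2 ?f1]
      split'[of _ ?e3 ?f1] split'[of _ ?e2 ?f3] split'[of _ ?e3 ?f2] ..
  also have "SE ?e1 = 0"
  proof -
    have "SE ?e1 = (\<Sum>b<r. \<Sum>a<r. q a b * eta a b)" unfolding SE_def by (rule sum.swap)
    also have "\<dots> = (\<Sum>b<r. \<Sum>a<r. - (q b a * eta b a))"
    proof (intro sum.cong refl)
      fix a b assume "a \<in> {..<r}" "b \<in> {..<r}"
      then show "q a b * eta a b = - (q b a * eta b a)" using q[of a b] eta_skew[of b a] by simp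
    qed
    also have "\<dots> = - SE ?e1" unfolding SE_def sum_negf ..
    finally show ?thesis by (simp add: complex_eq_iff)
  qed
  also have "SE ?e2 = q c d"
  proof -
    have "SE ?e2 = (\<Sum>a<r. \<Sum>b<r. if a = d then (if b = c then q a b else 0) else 0)"
      unfolding SE_def by (intro sum.cong refl) simp
    also have "\<dots> = q d c" by (rule sum_delta2) (use c in simp_all)
    finally show ?thesis using c q[of c d] by simp
  qed
  also have "SE ?e3 = q c d"
  proof -
    have "SE ?e3 = (\<Sum>a<r. \<Sum>b<r. if a = c then (if b = d then q a b else 0) else 0)"
      unfolding SE_def by (intro sum.cong refl) simp
    also have "\<dots> = q c d" by (rule sum_delta2) (use c in simp_all)
    finally show ?thesis .
  qed
  also have "SF ?f1 = - (of_nat m + 1)"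
  proof -
    have "SF ?f1 = (\<Sum>A\<le>m. - (\<Sum>B\<le>m. phi A B * f B A))"
      unfolding SF_def sum_negf[symmetric]
    proof (intro sum.cong refl)
      fix A B assume "A \<in> {..m}" "B \<in> {..m}"
      then show "f A B * phi A B = - (phi A B * f B A)" using f_skew[of A B] by simp
    qed
    also have "\<dots> = (\<Sum>A\<le>m. - 1)" by (intro sum.cong refl) (simp add: phi_left_inverse)
    finally show ?thesis by simp
  qed
  also have "SF ?f2 = - f C D"
  proof -
    have "SF ?f2 = (\<Sum>a\<le>m. \<Sum>b\<le>m. if a = D then (if b = C then f a b else 0) else 0)"
      unfolding SF_def by (intro sum.cong refl) simp
    also have "\<dots> = f D C" by (rule sum_delta2) (use c in simp_all)
    finally show ?thesis using c f_skew[of C D] by simp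
  qed
  also have "SF ?f3 = f C D"
  proof -
    have "SF ?f3 = (\<Sum>a\<le>m. \<Sum>b\<le>m. if a = C then (if b = D then f a b else 0) else 0)"
      unfolding SF_def by (intro sum.cong refl) simp
    also have "\<dots> = f C D" by (rule sum_delta2) (use c in simp_all)
    finally show ?thesis .
  qed
  finally show ?thesis by (simp add: algebra_simps)
qed

section \<open>Two-forms in the frame and the contraction with the four-form\<close>

definition idx :: "(nat \<times> nat) set" where "idx = {..<r} \<times> {..m}"
abbreviation th :: "nat \<times> nat \<Rightarrow> 'n covec" where "th p \<equiv> \<theta> (fst p) (snd p)"
abbreviation XX :: "nat \<times> nat \<Rightarrow> complex^'n" where "XX p \<equiv> X (fst p) (snd p)"

lemma frame_idx: "(\<Sum>p\<in>idx. th p [v] *s XX p) = v"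
  using frame[of v] by (simp add: idx_def sum.cartesian_product split_beta)

lemma th_alt: "p \<in> idx \<Longrightarrow> alt_form 1 (th p)"
proof -
  assume "p \<in> idx"
  then have "fst p < r" "snd p \<le> m" by (auto simp: idx_def)
  then show ?thesis by (rule theta_alt)
qed

lemma two_form_frame:
  assumes "alt_form 2 \<beta>"
  shows "\<beta> [x, y] = (\<Sum>p\<in>idx. \<Sum>q\<in>idx. th p [x] * (th q [y] * \<beta> [XX p, XX q]))"
proof -
  have "\<beta> [x, y] = \<beta> [\<Sum>p\<in>idx. th p [x] *s XX p, y]" unfolding frame_idx ..
  also have "\<dots> = (\<Sum>p\<in>idx. th p [x] * \<beta> [XX p, y])"
    using multilin_sum[OF alt_form_multilin[OF assms], of "[]" "[y]" "\<lambda>p. th p [x]" XX idx] by simp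
  also have "\<dots> = (\<Sum>p\<in>idx. th p [x] * (\<Sum>q\<in>idx. th q [y] * \<beta> [XX p, XX q]))"
  proof (rule sum.cong[OF refl])
    fix p
    have "\<beta> [XX p, y] = \<beta> [XX p, \<Sum>q\<in>idx. th q [y] *s XX q]" unfolding frame_idx ..
    also have "\<dots> = (\<Sum>q\<in>idx. th q [y] * \<beta> [XX p, XX q])"
      using multilin_sum[OF alt_form_multilin[OF assms], of "[XX p]" "[]" "\<lambda>q. th q [y]" XX idx] by simp
    finally show "th p [x] * \<beta> [XX p, y] = th p [x] * (\<Sum>q\<in>idx. th q [y] * \<beta> [XX p, XX q])" by simp
  qed
  finally show ?thesis by (simp only: sum_distrib_left)
qed

lemma two_form_eqI:
  assumes "alt_form 2 \<beta>" "alt_form 2 \<gamma>"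
    and "\<And>a A b B. a < r \<Longrightarrow> A \<le> m \<Longrightarrow> b < r \<Longrightarrow> B \<le> m \<Longrightarrow> \<beta> [X a A, X b B] = \<gamma> [X a A, X b B]"
  shows "\<beta> xs = \<gamma> xs"
proof (cases "length xs = 2")
  case True
  then obtain x y where xs: "xs = [x, y]" by (auto simp: numeral_2_eq_2 length_Suc_conv)
  have "(\<Sum>p\<in>idx. \<Sum>q\<in>idx. th p [x] * (th q [y] * \<beta> [XX p, XX q])) = (\<Sum>p\<in>idx. \<Sum>q\<in>idx. th p [x] * (th q [y] * \<gamma> [XX p, XX q]))"
    by (intro sum.cong refl) (auto simp: idx_def assms(3))
  then show ?thesis unfolding xs two_form_frame[OF assms(1), of x y] two_form_frame[OF assms(2), of x y] .
next
  case False
  then show ?thesis using alt_form_length[OF assms(1) False] alt_form_length[OF assms(2) False] by simp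
qed

lemma two_form_frame_expand:
  assumes "alt_form 2 \<beta>"
  shows "\<beta> = (\<lambda>xs. \<Sum>p\<in>idx \<times> idx. \<beta> [XX (fst p), XX (snd p)] / 2 * wedge 1 1 (th (fst p)) (th (snd p)) xs)"
proof
  fix xs
  show "\<beta> xs = (\<Sum>p\<in>idx \<times> idx. \<beta> [XX (fst p), XX (snd p)] / 2 * wedge 1 1 (th (fst p)) (th (snd p)) xs)"
  proof (cases "length xs = 2")
    case True
    then obtain x y where xs: "xs = [x, y]" by (auto simp: numeral_2_eq_2 length_Suc_conv)
    have "\<beta> [y, x] = - \<beta> [x, y]" using alt_form_move[OF assms, of "[y]" 1 x] by simp
    then have "\<beta> [x, y] = (\<beta> [x, y] - \<beta> [y, x]) / 2" by simp
    also have "\<dots> = (\<Sum>p\<in>idx. \<Sum>q\<in>idx. (th p [x] * (th q [y] * \<beta> [XX p, XX q]) - th p [y] * (th q [x] * \<beta> [XX p, XX q])) / 2)"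
      unfolding two_form_frame[OF assms, of x y] two_form_frame[OF assms, of y x] sum_subtractf[symmetric] sum_divide_distrib ..
    also have "\<dots> = (\<Sum>p\<in>idx. \<Sum>q\<in>idx. \<beta> [XX p, XX q] / 2 * wedge 1 1 (th p) (th q) [x, y])"
    proof (intro sum.cong refl)
      fix p q assume "p \<in> idx" "q \<in> idx"
      then show "(th p [x] * (th q [y] * \<beta> [XX p, XX q]) - th p [y] * (th q [x] * \<beta> [XX p, XX q])) / 2
        = \<beta> [XX p, XX q] / 2 * wedge 1 1 (th p) (th q) [x, y]"
        unfolding wedge_11[OF th_alt[OF \<open>q \<in> idx\<close>]] by (simp add: right_diff_distrib diff_divide_distrib mult_ac)
    qed
    finally show ?thesis unfolding xs by (simp only: sum.cartesian_product case_prod_unfold)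
  next
    case False
    then show ?thesis using alt_form_length[OF assms False] by (simp add: wedge_length)
  qed
qed

text \<open>Both sides are alternating, so they may be compared on frame vectors, where the sum over
  pairs of double indices becomes the one in \<open>contraction_frame\<close>.\<close>

lemma contraction:
  assumes \<beta>: "alt_form 2 \<beta>"
    and q: "\<And>a b. a < r \<Longrightarrow> b < r \<Longrightarrow> q b a = q a b"
    and \<beta>_eq: "\<And>a A b B. a < r \<Longrightarrow> A \<le> m \<Longrightarrow> b < r \<Longrightarrow> B \<le> m \<Longrightarrow> \<beta> [X a A, X b B] = q a b * f A B"
  shows "(\<Sum>p\<in>idx \<times> idx. \<beta> [XX (fst p), XX (snd p)] * \<Omega> (sharp (th (snd p)) # sharp (th (fst p)) # xs)) = 8 * (of_nat m + 2) * \<beta> xs"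
proof (rule two_form_eqI[where \<beta> = "\<lambda>xs. \<Sum>p\<in>idx \<times> idx. \<beta> [XX (fst p), XX (snd p)] * \<Omega> (sharp (th (snd p)) # sharp (th (fst p)) # xs)"
      and \<gamma> = "\<lambda>xs. 8 * (of_nat m + 2) * \<beta> xs"])
  have "alt_form 2 (\<lambda>xs. \<Omega> (u # v # xs))" for u v
    by (intro alt_form_contract) (use alt_form_Omega in \<open>simp add: numeral_eq_Suc\<close>)
  then show "alt_form 2 (\<lambda>xs. \<Sum>p\<in>idx \<times> idx. \<beta> [XX (fst p), XX (snd p)] * \<Omega> (sharp (th (snd p)) # sharp (th (fst p)) # xs))"
    by (intro alt_form_sum alt_form_scale)
  show "alt_form 2 (\<lambda>xs. 8 * (of_nat m + 2) * \<beta> xs)" by (rule alt_form_scale[OF \<beta>])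
next
  fix c C d D assume c: "c < r" "C \<le> m" "d < r" "D \<le> m"
  have "(\<Sum>p\<in>idx \<times> idx. \<beta> [XX (fst p), XX (snd p)] * \<Omega> (sharp (th (snd p)) # sharp (th (fst p)) # [X c C, X d D])) =
    (\<Sum>a<r. \<Sum>A\<le>m. \<Sum>b<r. \<Sum>B\<le>m. \<beta> [X a A, X b B] * \<Omega> [sharp (\<theta> b B), sharp (\<theta> a A), X c C, X d D])"
    by (simp add: sum.cartesian_product' idx_def)
  also have "\<dots> = (\<Sum>a<r. \<Sum>A\<le>m. \<Sum>b<r. \<Sum>B\<le>m. q a b * f A B * \<Omega> [sharp (\<theta> b B), sharp (\<theta> a A), X c C, X d D])"
    by (intro sum.cong refl) (simp add: \<beta>_eq)
  also have "\<dots> = 8 * (of_nat m + 2) * (q c d * f C D)" by (rule contraction_frame[OF q c])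
  finally show "(\<Sum>p\<in>idx \<times> idx. \<beta> [XX (fst p), XX (snd p)] * \<Omega> [sharp (th (snd p)), sharp (th (fst p)), X c C, X d D]) =
     8 * (of_nat m + 2) * \<beta> [X c C, X d D]"
    by (simp add: \<beta>_eq c)
qed

text \<open>The witness has for q the matrix unit at (0, 0). It shows that the eigenvalue really
  occurs and that \<Omega> does not vanish. The factor 1/2 compensates that the skew matrix f meets
  each pair of coframe elements in both orders.\<close>

lemma exists_eigenform:
  obtains \<beta> where "alt_form 2 \<beta>" "\<beta> \<noteq> (\<lambda>_. 0)"
    "\<And>a A b B. a < r \<Longrightarrow> A \<le> m \<Longrightarrow> b < r \<Longrightarrow> B \<le> m \<Longrightarrow> \<beta> [X a A, X b B] = (if a = 0 \<and> b = 0 then 1 else 0) * f A B"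
proof
  let ?\<beta> = "\<lambda>xs. \<Sum>A\<le>m. \<Sum>B\<le>m. f A B / 2 * wedge 1 1 (\<theta> 0 A) (\<theta> 0 B) xs"
  have r0: "0 < r" using r_ge_2 by simp
  have "alt_form (1 + 1) (wedge 1 1 (\<theta> 0 A) (\<theta> 0 B))" if "A \<le> m" "B \<le> m" for A B
    by (intro alt_form_wedge theta_multilin r0 that)
  then have w: "A \<le> m \<Longrightarrow> B \<le> m \<Longrightarrow> alt_form 2 (wedge 1 1 (\<theta> 0 A) (\<theta> 0 B))" for A B
    by (simp only: one_add_one)
  then show "alt_form 2 ?\<beta>" by (intro alt_form_sum alt_form_scale w) simp_all
  show eq: "?\<beta> [X a A, X b B] = (if a = 0 \<and> b = 0 then 1 else 0) * f A B"
    if "a < r" "A \<le> m" "b < r" "B \<le> m" for a A b B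
  proof (cases "a = 0 \<and> b = 0")
    case True
    have "?\<beta> [X a A, X b B] = (\<Sum>C\<le>m. \<Sum>D\<le>m. (if C = A then if D = B then f C D / 2 else 0 else 0) - (if C = B then if D = A then f C D / 2 else 0 else 0))"
    proof (intro sum.cong refl)
      fix C D assume "C \<in> {..m}" "D \<in> {..m}"
      then have cd: "C \<le> m" "D \<le> m" by auto
      show "f C D / 2 * wedge 1 1 (\<theta> 0 C) (\<theta> 0 D) [X a A, X b B] =
        (if C = A then if D = B then f C D / 2 else 0 else 0) - (if C = B then if D = A then f C D / 2 else 0 else 0)"
        unfolding wedge_11[OF theta_alt[OF r0 cd(2)]] using True that cd r0 by (simp add: theta_X)
    qed
    also have "\<dots> = f A B / 2 - f B A / 2"
    proof -
      have 1: "(\<Sum>C\<le>m. \<Sum>D\<le>m. if C = A then if D = B then f C D / 2 else 0 else 0) = f A B / 2"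
        by (rule sum_delta2) (use that in simp_all)
      have 2: "(\<Sum>C\<le>m. \<Sum>D\<le>m. if C = B then if D = A then f C D / 2 else 0 else 0) = f B A / 2"
        by (rule sum_delta2) (use that in simp_all)
      show ?thesis unfolding sum_subtractf 1 2 ..
    qed
    also have "\<dots> = f A B" using f_skew[of A B] that by simp
    finally show ?thesis using True by simp
  next
    case False
    have "?\<beta> [X a A, X b B] = (\<Sum>C\<le>m. \<Sum>D\<le>m. 0)"
    proof (intro sum.cong refl)
      fix C D assume "C \<in> {..m}" "D \<in> {..m}"
      then have cd: "C \<le> m" "D \<le> m" by auto
      show "f C D / 2 * wedge 1 1 (\<theta> 0 C) (\<theta> 0 D) [X a A, X b B] = 0"
        unfolding wedge_11[OF theta_alt[OF r0 cd(2)]] using False that cd r0 by (auto simp: theta_X)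
    qed
    then show ?thesis by (simp only: sum.neutral_const if_not_P[OF False] mult_zero_left)
  qed
  have "?\<beta> [X 0 0, X 0 m] \<noteq> 0" unfolding eq[OF r0 le0 r0 order_refl] using f_nonzero[of 0 m] by simp
  then show "?\<beta> \<noteq> (\<lambda>_. 0)" by (rule contrapos_nn) (rule fun_cong)
qed

text \<open>Contraction with the eigenform multiplies it by 8 (m + 2), which is not zero, whereas
  contracting a vanishing form would give zero.\<close>

lemma Omega_nonzero: "\<Omega> \<noteq> (\<lambda>_. 0)"
proof
  assume z: "\<Omega> = (\<lambda>_. 0)"
  obtain \<beta> where \<beta>: "alt_form 2 \<beta>" "\<beta> \<noteq> (\<lambda>_. 0)"
    "\<And>a A b B. a < r \<Longrightarrow> A \<le> m \<Longrightarrow> b < r \<Longrightarrow> B \<le> m \<Longrightarrow> \<beta> [X a A, X b B] = (if a = 0 \<and> b = 0 then 1 else 0) * f A B"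
    by (rule exists_eigenform) (rule that)
  have "8 * (of_nat m + 2) * \<beta> xs = 0" for xs
  proof -
    have "(\<Sum>p\<in>idx \<times> idx. \<beta> [XX (fst p), XX (snd p)] * \<Omega> (sharp (th (snd p)) # sharp (th (fst p)) # xs)) = 8 * (of_nat m + 2) * \<beta> xs"
      by (rule contraction[where q = "\<lambda>a b. if a = 0 \<and> b = 0 then 1 else 0"]) (rule \<beta>, simp, rule \<beta>(3), assumption+)
    then show ?thesis unfolding z by simp
  qed
  moreover have "8 * (of_nat m + 2 :: complex) \<noteq> 0" by (simp add: complex_eq_iff del: distrib_left_numeral)
  ultimately have "\<beta> xs = 0" for xs by (metis mult_eq_0_iff)
  then show False using \<beta>(2) by blast
qed

end

locale frame_volume = frame_at m r \<epsilon> h \<theta> X + metric_volume "metric_at m r \<epsilon> (omega_pow m h) \<theta>" vol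
  for m r :: nat and \<epsilon> h :: cmat and \<theta> :: "nat \<Rightarrow> nat \<Rightarrow> 'n::finite covec" and X :: "nat \<Rightarrow> nat \<Rightarrow> complex^'n" and vol :: "'n covec"
begin

text \<open>The factor 1/2 in the expansion of \<beta> by the coframe and the minus sign of
  \<open>hodge_wedge_contract\<close> turn the 8 of the contraction into -4. Recorded before the
  outer Hodge star is applied, since the Yang-Mills equation uses it in this form.\<close>

lemma wedge_star_Omega:
  assumes \<beta>: "alt_form 2 \<beta>"
    and q: "\<And>a b. a < r \<Longrightarrow> b < r \<Longrightarrow> q b a = q a b"
    and \<beta>_eq: "\<And>a A b B. a < r \<Longrightarrow> A \<le> m \<Longrightarrow> b < r \<Longrightarrow> B \<le> m \<Longrightarrow> \<beta> [X a A, X b B] = q a b * f A B"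
  shows "wedge (CARD('n) - 4) 2 (hodge g vol 4 \<Omega>) \<beta> xs = - 4 * (of_nat m + 2) * hodge g vol 2 \<beta> xs"
proof -
  let ?c = "\<lambda>p. \<beta> [XX (fst p), XX (snd p)] / 2"
  let ?O = "\<lambda>p xs. \<Omega> (sharp (th (snd p)) # sharp (th (fst p)) # xs)"
  have 2: "2 \<le> CARD('n)" using dimension_ge_4 by simp
  have "wedge (CARD('n) - 4) 2 (hodge g vol 4 \<Omega>) \<beta> xs =
    wedge (CARD('n) - 4) 2 (hodge g vol 4 \<Omega>) (\<lambda>xs. \<Sum>p\<in>idx \<times> idx. ?c p * wedge 1 1 (th (fst p)) (th (snd p)) xs) xs"
    by (rule arg_cong[where f = "\<lambda>b. wedge (CARD('n) - 4) 2 (hodge g vol 4 \<Omega>) b xs"], rule two_form_frame_expand[OF \<beta>])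
  also have "\<dots> = (\<Sum>p\<in>idx \<times> idx. ?c p * wedge (CARD('n) - 4) 2 (hodge g vol 4 \<Omega>) (wedge 1 1 (th (fst p)) (th (snd p))) xs)"
    by (rule wedge_sum_right)
  also have "\<dots> = (\<Sum>p\<in>idx \<times> idx. ?c p * (- hodge g vol 2 (?O p) xs))"
  proof (rule sum.cong[OF refl])
    fix p assume "p \<in> idx \<times> idx"
    then have "fst p \<in> idx" "snd p \<in> idx" by auto
    then show "?c p * wedge (CARD('n) - 4) 2 (hodge g vol 4 \<Omega>) (wedge 1 1 (th (fst p)) (th (snd p))) xs = ?c p * (- hodge g vol 2 (?O p) xs)"
      using hodge_wedge_contract[OF alt_form_Omega th_alt th_alt dimension_even dimension_ge_4, of "fst p" "snd p" xs] by simp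
  qed
  also have "\<dots> = - (\<Sum>p\<in>idx \<times> idx. ?c p * hodge g vol 2 (?O p) xs)" by (simp add: sum_negf)
  also have "(\<Sum>p\<in>idx \<times> idx. ?c p * hodge g vol 2 (?O p) xs) = hodge g vol 2 (\<lambda>xs. \<Sum>p\<in>idx \<times> idx. ?c p * ?O p xs) xs"
    by (rule hodge_sum[OF 2, symmetric])
  also have "(\<lambda>xs. \<Sum>p\<in>idx \<times> idx. ?c p * ?O p xs) = (\<lambda>xs. 4 * (of_nat m + 2) * \<beta> xs)"
  proof
    fix xs
    have "(\<Sum>p\<in>idx \<times> idx. ?c p * ?O p xs) = (\<Sum>p\<in>idx \<times> idx. \<beta> [XX (fst p), XX (snd p)] * ?O p xs) / 2"
      unfolding sum_divide_distrib by (rule sum.cong[OF refl]) simp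
    also have "(\<Sum>p\<in>idx \<times> idx. \<beta> [XX (fst p), XX (snd p)] * ?O p xs) = 8 * (of_nat m + 2) * \<beta> xs"
      by (rule contraction[where q = q]) (rule \<beta>, erule (1) q, rule \<beta>_eq, assumption+)
    also have "8 * (of_nat m + 2) * \<beta> xs / 2 = 4 * (of_nat m + 2) * \<beta> xs" by simp
    finally show "(\<Sum>p\<in>idx \<times> idx. ?c p * ?O p xs) = 4 * (of_nat m + 2) * \<beta> xs" .
  qed
  finally show ?thesis unfolding hodge_scale[OF 2] by (simp add: algebra_simps)
qed

lemma B_op_eigenform:
  assumes \<beta>: "alt_form 2 \<beta>"
    and q: "\<And>a b. a < r \<Longrightarrow> b < r \<Longrightarrow> q b a = q a b"
    and \<beta>_eq: "\<And>a A b B. a < r \<Longrightarrow> A \<le> m \<Longrightarrow> b < r \<Longrightarrow> B \<le> m \<Longrightarrow> \<beta> [X a A, X b B] = q a b * f A B"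
  shows "B_op g vol \<Omega> \<beta> = (\<lambda>xs. - 4 * (of_nat m + 2) * \<beta> xs)"
proof
  fix xs
  have n: "CARD('n) - 4 + 2 = CARD('n) - 2" using dimension_ge_4 by simp
  have "wedge (CARD('n) - 4) 2 (hodge g vol 4 \<Omega>) \<beta> = (\<lambda>xs. - 4 * (of_nat m + 2) * hodge g vol 2 \<beta> xs)"
    by (rule ext) (rule wedge_star_Omega[OF assms])
  then show "B_op g vol \<Omega> \<beta> xs = - 4 * (of_nat m + 2) * \<beta> xs"
    unfolding B_op_def n by (simp only: hodge_scale[OF diff_le_self] hodge_hodge_2[OF \<beta> dimension_even])
qed

end

section \<open>The Bianchi identity and the Yang-Mills equation\<close>

lemma hol_form_curvature:
  assumes "open S" "\<And>a b. a < w \<Longrightarrow> b < w \<Longrightarrow> hol_form 1 S (A i a b)" "s < w" "t < w"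
  shows "hol_form 2 S (curvature w A i s t)"
proof -
  have 1: "hol_form 2 S (ext_d 1 (A i s t))"
    using hol_form_ext_d[OF assms(1) assms(2)[OF assms(3,4)]] by (simp only: Suc_1)
  have "hol_form (1 + 1) S (\<lambda>z. wedge 1 1 (A i s c z) (A i c t z))" if "c < w" for c
    by (rule hol_form_wedge[OF assms(2)[OF assms(3) that] assms(2)[OF that assms(4)]])
  then have 2: "hol_form 2 S (\<lambda>z xs. \<Sum>c<w. wedge 1 1 (A i s c z) (A i c t z) xs)"
    by (intro hol_form_sum) (simp only: one_add_one lessThan_iff)
  show ?thesis unfolding curvature_def by (rule hol_form_add[OF 1 2])
qed

text \<open>As d d A = 0, the derivative of the curvature consists of dA wedge A minus A wedge dA,
  which the terms linear in dA of the commutator cancel. The cubic terms cancel by associativity and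
  an exchange of the two summation indices.\<close>

lemma bianchi:
  fixes A :: "('i, 'n::finite) mform"
  assumes S: "open S" "z \<in> S" and A: "\<And>a b. a < w \<Longrightarrow> b < w \<Longrightarrow> hol_form 1 S (A i a b)" and st: "s < w" "t < w"
  shows "cov_ext_d w A i 2 (curvature w A i) s t z xs = 0"
proof -
  let ?F = "curvature w A i"
  have dA: "hol_form 2 S (ext_d 1 (A i a b))" if "a < w" "b < w" for a b
    using hol_form_ext_d[OF S(1) A[OF that]] by (simp only: Suc_1)
  have AA: "hol_form 2 S (\<lambda>z. wedge 1 1 (A i a c z) (A i c b z))" if "a < w" "b < w" "c < w" for a b c
    using hol_form_wedge[OF A[OF that(1,3)] A[OF that(3,2)]] by (simp only: one_add_one)
  have sAA: "hol_form 2 S (\<lambda>z xs. \<Sum>c<w. wedge 1 1 (A i s c z) (A i c t z) xs)"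
    by (intro hol_form_sum AA st) simp
  have "ext_d 2 (?F s t) z xs = ext_d 2 (ext_d 1 (A i s t)) z xs + ext_d 2 (\<lambda>z xs. \<Sum>c<w. wedge 1 1 (A i s c z) (A i c t z) xs) z xs"
    unfolding curvature_def by (rule ext_d_add[OF dA[OF st] sAA S(2)])
  also have "ext_d 2 (ext_d 1 (A i s t)) z xs = 0"
    using ext_d_ext_d[OF S(1) A[OF st] S(2)] by (simp only: Suc_1)
  also have "ext_d 2 (\<lambda>z xs. \<Sum>c<w. wedge 1 1 (A i s c z) (A i c t z) xs) z xs = (\<Sum>c<w. ext_d 2 (\<lambda>z. wedge 1 1 (A i s c z) (A i c t z)) z xs)"
    by (rule ext_d_sum[OF _ S(2)]) (rule AA[OF st], simp)
  also have "\<dots> = (\<Sum>c<w. wedge 2 1 (ext_d 1 (A i s c) z) (A i c t z) xs - wedge 1 2 (A i s c z) (ext_d 1 (A i c t) z) xs)"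
  proof (rule sum.cong[OF refl])
    fix c assume "c \<in> {..<w}"
    then have c: "c < w" by simp
    show "ext_d 2 (\<lambda>z. wedge 1 1 (A i s c z) (A i c t z)) z xs = wedge 2 1 (ext_d 1 (A i s c) z) (A i c t z) xs - wedge 1 2 (A i s c z) (ext_d 1 (A i c t) z) xs"
      using ext_d_wedge[OF S(1) A[OF st(1) c] A[OF c st(2)] S(2), of xs] by (simp only: one_add_one Suc_1) simp
  qed
  finally have 1: "ext_d 2 (?F s t) z xs = (\<Sum>c<w. wedge 2 1 (ext_d 1 (A i s c) z) (A i c t z) xs - wedge 1 2 (A i s c z) (ext_d 1 (A i c t) z) xs)"
    by simp
  have 2: "wedge 1 2 (A i s c z) (?F c t z) xs = wedge 1 2 (A i s c z) (ext_d 1 (A i c t) z) xs +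
      (\<Sum>e<w. wedge 1 2 (A i s c z) (wedge 1 1 (A i c e z) (A i e t z)) xs)" for c
    unfolding curvature_def wedge_add_right wedge_sum_right1 ..
  have 3: "wedge 2 1 (?F s c z) (A i c t z) xs = wedge 2 1 (ext_d 1 (A i s c) z) (A i c t z) xs +
      (\<Sum>e<w. wedge 1 2 (A i s e z) (wedge 1 1 (A i e c z) (A i c t z)) xs)" for c
  proof -
    have "wedge 2 1 (wedge 1 1 \<alpha> \<beta>) \<gamma> xs = wedge 1 2 \<alpha> (wedge 1 1 \<beta> \<gamma>) xs" for \<alpha> \<beta> \<gamma> :: "'n covec"
      using wedge_assoc[of 1 1 1 \<alpha> \<beta> \<gamma> xs] by (simp only: one_add_one)
    then show ?thesis unfolding curvature_def wedge_add_left wedge_sum_left1 by (simp only:)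
  qed
  have 4: "(\<Sum>c<w. \<Sum>e<w. wedge 1 2 (A i s e z) (wedge 1 1 (A i e c z) (A i c t z)) xs) =
     (\<Sum>c<w. \<Sum>e<w. wedge 1 2 (A i s c z) (wedge 1 1 (A i c e z) (A i e t z)) xs)"
    by (rule sum.swap)
  have "cov_ext_d w A i 2 ?F s t z xs = ext_d 2 (?F s t) z xs +
     ((\<Sum>c<w. wedge 1 2 (A i s c z) (?F c t z) xs) - (\<Sum>c<w. wedge 2 1 (?F s c z) (A i c t z) xs))"
    unfolding cov_ext_d_def by (simp add: sum_subtractf)
  then show ?thesis
    unfolding 1 2 3 sum.distrib sum_subtractf 4 by simp
qed

text \<open>A scalar form of even degree passes the connection form without a sign, and closedness
  removes its own derivative. Wedging with it thus commutes with the covariant exterior derivative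
  at the point, and the Bianchi identity remains. The formula for \<psi> is assumed on an open set
  because \<psi> is differentiated.\<close>

lemma yang_mills_of_wedge:
  fixes A :: "('i, 'n::finite) mform" and \<sigma> :: "'n form"
  assumes S: "open S" "z \<in> S" and A: "\<And>a b. a < w \<Longrightarrow> b < w \<Longrightarrow> hol_form 1 S (A i a b)"
    and \<sigma>: "hol_form p S \<sigma>" and p: "even p" and closed: "\<And>xs. ext_d p \<sigma> z xs = 0"
    and st: "s < w" "t < w"
    and \<psi>: "\<And>a b y. a < w \<Longrightarrow> b < w \<Longrightarrow> y \<in> S \<Longrightarrow> \<psi> a b y = (\<lambda>xs. c0 * wedge p 2 (\<sigma> y) (curvature w A i a b y) xs)"
  shows "cov_ext_d w A i (p + 2) \<psi> s t z xs = 0"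
proof -
  let ?F = "curvature w A i"
  have three: "1 + 2 = (3::nat)" "2 + 1 = (3::nat)" by simp_all
  have sg: "(-1) ^ p = (1 :: complex)" "(-1) ^ (p + 2) = (1 :: complex)" using p by simp_all
  have F: "hol_form 2 S (?F a b)" if "a < w" "b < w" for a b
    by (rule hol_form_curvature[where A = A and i = i, OF S(1) _ that]) (rule A)
  have w: "hol_form (p + 2) S (\<lambda>y. wedge p 2 (\<sigma> y) (?F a b y))" if "a < w" "b < w" for a b
    by (rule hol_form_wedge[OF \<sigma> F[OF that]])
  have com: "wedge p 1 \<alpha> \<epsilon> = wedge 1 p \<epsilon> \<alpha>" for \<alpha> \<epsilon> :: "'n covec"
    by (rule ext) (simp only: wedge_commute_1 sg mult_1)
  have z0: "ext_d p \<sigma> z = (\<lambda>xs. 0 * 0)" by (rule ext) (simp add: closed)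
  have "ext_d (p + 2) (\<psi> s t) z xs = ext_d (p + 2) (\<lambda>y xs. c0 * wedge p 2 (\<sigma> y) (?F s t y) xs) z xs"
    by (rule ext_d_cong[OF S, symmetric]) (intro hol_form_scale[OF hol_const] w st, simp add: \<psi> st)
  also have "\<dots> = c0 * ext_d (p + 2) (\<lambda>y. wedge p 2 (\<sigma> y) (?F s t y)) z xs"
    by (rule ext_d_cmult[OF w[OF st] S(2)])
  also have "ext_d (p + 2) (\<lambda>y. wedge p 2 (\<sigma> y) (?F s t y)) z xs = wedge p (Suc 2) (\<sigma> z) (ext_d 2 (?F s t) z) xs"
    unfolding ext_d_wedge[OF S(1) \<sigma> F[OF st] S(2)] z0 wedge_scale_left sg by simp
  finally have 1: "ext_d (p + 2) (\<psi> s t) z xs = c0 * wedge p 3 (\<sigma> z) (ext_d 2 (?F s t) z) xs" by simp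
  have 2: "wedge 1 (p + 2) (A i s c z) (\<psi> c t z) xs = c0 * wedge p 3 (\<sigma> z) (wedge 1 2 (A i s c z) (?F c t z)) xs" if "c < w" for c
  proof -
    have "wedge 1 (p + 2) (A i s c z) (\<psi> c t z) xs = c0 * wedge 1 (p + 2) (A i s c z) (wedge p 2 (\<sigma> z) (?F c t z)) xs"
      unfolding \<psi>[OF that st(2) S(2)] by (rule wedge_scale_right)
    also have "wedge 1 (p + 2) (A i s c z) (wedge p 2 (\<sigma> z) (?F c t z)) xs = wedge (p + 1) 2 (wedge p 1 (\<sigma> z) (A i s c z)) (?F c t z) xs"
      unfolding wedge_assoc[symmetric] com by (simp only: add.commute)
    also have "\<dots> = wedge p (1 + 2) (\<sigma> z) (wedge 1 2 (A i s c z) (?F c t z)) xs" by (rule wedge_assoc)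
    finally show ?thesis unfolding three .
  qed
  have 3: "wedge (p + 2) 1 (\<psi> s c z) (A i c t z) xs = c0 * wedge p 3 (\<sigma> z) (wedge 2 1 (?F s c z) (A i c t z)) xs" if "c < w" for c
  proof -
    have "wedge (p + 2) 1 (\<psi> s c z) (A i c t z) xs = c0 * wedge (p + 2) 1 (wedge p 2 (\<sigma> z) (?F s c z)) (A i c t z) xs"
      unfolding \<psi>[OF st(1) that S(2)] by (rule wedge_scale_left)
    also have "wedge (p + 2) 1 (wedge p 2 (\<sigma> z) (?F s c z)) (A i c t z) xs = wedge p (2 + 1) (\<sigma> z) (wedge 2 1 (?F s c z) (A i c t z)) xs"
      by (rule wedge_assoc)
    finally show ?thesis unfolding three .
  qed
  have "cov_ext_d w A i (p + 2) \<psi> s t z xs = c0 * (wedge p 3 (\<sigma> z) (ext_d 2 (?F s t) z) xs +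
     (\<Sum>c<w. wedge p 3 (\<sigma> z) (wedge 1 2 (A i s c z) (?F c t z)) xs - wedge p 3 (\<sigma> z) (wedge 2 1 (?F s c z) (A i c t z)) xs))"
  proof -
    have "(\<Sum>c<w. wedge 1 (p + 2) (A i s c z) (\<psi> c t z) xs - 1 * wedge (p + 2) 1 (\<psi> s c z) (A i c t z) xs) =
      (\<Sum>c<w. c0 * wedge p 3 (\<sigma> z) (wedge 1 2 (A i s c z) (?F c t z)) xs - c0 * wedge p 3 (\<sigma> z) (wedge 2 1 (?F s c z) (A i c t z)) xs)"
      by (rule sum.cong[OF refl]) (simp only: lessThan_iff 2 3 mult_1_left)
    then show ?thesis
      unfolding cov_ext_d_def 1 sg by (simp only: distrib_left sum_distrib_left right_diff_distrib)
  qed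
  also have "\<dots> = c0 * wedge p 3 (\<sigma> z) (cov_ext_d w A i 2 ?F s t z) xs"
  proof -
    have "cov_ext_d w A i 2 ?F s t z = (\<lambda>xs. ext_d 2 (?F s t) z xs +
       (\<Sum>c<w. wedge 1 2 (A i s c z) (?F c t z) xs + (- 1) * wedge 2 1 (?F s c z) (A i c t z) xs))"
      unfolding cov_ext_d_def by simp
    then show ?thesis
      by (simp only: wedge_add_right wedge_sum_right1 wedge_scale_right) simp
  qed
  also have "cov_ext_d w A i 2 ?F s t z = (\<lambda>xs. 0 * 0)"
    using bianchi[where A = A and i = i, OF S _ st] A by (intro ext) simp
  finally show ?thesis unfolding wedge_scale_right by simp
qed

section \<open>Holomorphic dependence of the Hodge dual on the point\<close>

lemma hol_det:
  fixes G :: "complex^'m \<Rightarrow> complex^'n^'n"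
  assumes "\<And>p q. hol S (\<lambda>z. G z $ p $ q)" shows "hol S (\<lambda>z. det (G z))"
  unfolding det_def by (intro hol_sum hol_cmult hol_prod assms)

text \<open>Cramer's rule writes an entry of the inverse as a quotient of determinants with a
  nonvanishing denominator.\<close>

lemma hol_matrix_inv:
  fixes G :: "complex^'m \<Rightarrow> complex^'n^'n"
  assumes "open S" and G: "\<And>p q. hol S (\<lambda>z. G z $ p $ q)" and inv: "\<And>z. z \<in> S \<Longrightarrow> invertible (G z)"
  shows "hol S (\<lambda>z. matrix_inv (G z) $ p $ q)"
proof (rule hol_cong[OF assms(1)])
  let ?M = "\<lambda>z. \<chi> i j. if j = p then (axis q 1 :: complex^'n) $ i else G z $ i $ j"
  fix z assume z: "z \<in> S"
  have d: "det (G z) \<noteq> 0" using inv[OF z] invertible_det_nz by blast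
  have "G z ** matrix_inv (G z) = mat 1"
    using inv[OF z] unfolding matrix_inv_def invertible_def by (rule someI2_ex) blast
  then have "G z *v (\<chi> k. matrix_inv (G z) $ k $ q) = axis q 1"
    by (simp add: vec_eq_iff matrix_vector_mult_def matrix_matrix_mult_def mat_def axis_def)
  then have "(\<chi> k. matrix_inv (G z) $ k $ q) = (\<chi> k. det (\<chi> i j. if j = k then (axis q 1 :: complex^'n) $ i else G z $ i $ j) / det (G z))"
    unfolding cramer[OF d] .
  then show "det (?M z) / det (G z) = matrix_inv (G z) $ p $ q"
    by (simp add: vec_eq_iff)
next
  show "hol S (\<lambda>z. det (\<chi> i j. if j = p then (axis q 1 :: complex^'n) $ i else G z $ i $ j) / det (G z))"
  proof (intro hol_divide hol_det)
    show "hol S (\<lambda>z. G z $ i $ j)" for i j by (rule G)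
    show "hol S (\<lambda>z. (\<chi> i j. if j = p then (axis q 1 :: complex^'n) $ i else G z $ i $ j) $ k $ l)" for k l
      by (cases "l = p") (simp_all add: G hol_const)
    show "det (G z) \<noteq> 0" if "z \<in> S" for z using inv[OF that] invertible_det_nz by blast
  qed
qed

text \<open>The Leibniz rule is going to be applied to the Hodge dual of the four-form as a function
  of the point.\<close>

lemma hol_hodge:
  fixes g :: "complex^'n \<Rightarrow> complex^'n \<Rightarrow> complex^'n \<Rightarrow> complex"
  assumes "\<And>p q. hol S (\<lambda>z. matrix_inv (gram (g z)) $ p $ q)" "\<And>xs. hol S (\<lambda>z. vol z xs)" "\<And>xs. hol S (\<lambda>z. \<beta> z xs)"
  shows "hol S (\<lambda>z. hodge (g z) (vol z) k (\<beta> z) xs)"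
proof (cases "length xs = CARD('n) - k")
  case True
  show ?thesis unfolding hodge_def if_P[OF True] divide_inverse
    by (intro hol_mult hol_sum hol_prod hol_const assms)
next
  case False
  then show ?thesis by (simp add: hodge_def hol_const)
qed

section \<open>The theorem\<close>

lemma has_derivative_vec:
  fixes F :: "'a::real_normed_vector \<Rightarrow> complex^'n::finite"
  assumes "\<And>k. ((\<lambda>x. F x $ k) has_derivative (\<lambda>v. D v $ k)) (at a)"
  shows "(F has_derivative D) (at a)"
proof (subst has_derivative_componentwise_within, rule ballI)
  fix b :: "complex^'n" assume "b \<in> Basis"
  then obtain k c where b: "b = axis k c" by (auto simp: Basis_vec_def)
  have "((\<lambda>x. F x $ k \<bullet> c) has_derivative (\<lambda>v. D v $ k \<bullet> c)) (at a)"
    by (rule has_derivative_inner_left[OF assms])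
  then show "((\<lambda>x. F x \<bullet> b) has_derivative (\<lambda>v. D v \<bullet> b)) (at a)" unfolding b inner_axis .
qed

locale symplectic_grassmann =
  fixes U :: "'i \<Rightarrow> 'a::{t2_space,second_countable_topology} set"
    and \<phi> :: "'i \<Rightarrow> 'a \<Rightarrow> complex^'n"
    and m r :: nat
    and tE tH :: "('i, 'n) cocycle"
    and CE CH :: "('i, 'n) mform"
    and \<omega>H \<omega>E :: "'i \<Rightarrow> complex^'n \<Rightarrow> cmat"
    and X :: "'i \<Rightarrow> nat \<Rightarrow> nat \<Rightarrow> complex^'n \<Rightarrow> complex^'n"
    and \<theta> :: "('i, 'n) mform"
  assumes grassmann: "spin_grassmann U \<phi> m r tE CE tH CH \<omega>H X \<theta>"
    and odd: "odd m"
    and form_E: "symplectic_form U \<phi> r (dual_cocycle U \<phi> tE) \<omega>E"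
begin

lemma manifold: "complex_manifold U \<phi>"
  and form_H: "symplectic_form U \<phi> 2 (dual_cocycle U \<phi> tH) \<omega>H"
  and sold: "soldering U \<phi> m r tE tH X \<theta>"
  using grassmann unfolding spin_grassmann_def by blast+

section \<open>Changes of charts and their Jacobians\<close>

lemma open_cdom: "open (cdom U \<phi> i)"
  and open_U: "open (U i)"
  and chart: "homeomorphism (U i) (cdom U \<phi> i) (\<phi> i) (inv_into (U i) (\<phi> i))"
  and hol_chg: "hol (overlap U \<phi> i j) (\<lambda>z. chg U \<phi> i j z $ k)"
  using manifold unfolding complex_manifold_def by blast+

lemma open_overlap: "open (overlap U \<phi> i j)"
proof -
  have "openin (top_of_set (U i)) (U i \<inter> U j)" using open_U by (simp add: openin_open_Int)
  from homeomorphism_imp_open_map[OF chart this] show ?thesis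
    unfolding overlap_def using open_cdom openin_open_trans by blast
qed

lemma inv_chart: "p \<in> U i \<Longrightarrow> inv_into (U i) (\<phi> i) (\<phi> i p) = p"
  by (rule homeomorphism_apply1[OF chart])

lemma overlapE:
  assumes "z \<in> overlap U \<phi> i j"
  obtains p where "p \<in> U i" "p \<in> U j" "z = \<phi> i p" "chg U \<phi> i j z = \<phi> j p"
proof -
  obtain p where p: "p \<in> U i" "p \<in> U j" "z = \<phi> i p" using assms by (auto simp: overlap_def)
  moreover have "chg U \<phi> i j z = \<phi> j p" unfolding chg_def p(3) using inv_chart[OF p(1)] by simp
  ultimately show ?thesis by (rule that)
qed

lemma overlap_cdom: "z \<in> overlap U \<phi> i j \<Longrightarrow> z \<in> cdom U \<phi> i"
  by (auto simp: overlap_def cdom_def)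

lemma chg_overlap: "z \<in> overlap U \<phi> i j \<Longrightarrow> chg U \<phi> i j z \<in> overlap U \<phi> j i"
  by (erule overlapE) (auto simp: overlap_def)

lemma chg_chg: "z \<in> overlap U \<phi> i j \<Longrightarrow> chg U \<phi> j i (chg U \<phi> i j z) = z"
  by (erule overlapE) (simp add: chg_def inv_chart)

lemma chg_has_derivative:
  assumes "z \<in> overlap U \<phi> i j"
  shows "(chg U \<phi> i j has_derivative jac U \<phi> i j z) (at z)"
    and "jac U \<phi> i j z v = (\<chi> k. frechet_derivative (\<lambda>z. chg U \<phi> i j z $ k) (at z) v)"
proof -
  let ?D = "\<lambda>v. \<chi> k. frechet_derivative (\<lambda>z. chg U \<phi> i j z $ k) (at z) v"
  have d: "(chg U \<phi> i j has_derivative ?D) (at z)"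
    by (rule has_derivative_vec) (simp add: hol_has_derivative[OF hol_chg assms])
  then have e: "?D = jac U \<phi> i j z" unfolding jac_def by (rule frechet_derivative_at)
  show "(chg U \<phi> i j has_derivative jac U \<phi> i j z) (at z)" using d unfolding e .
  show "jac U \<phi> i j z v = ?D v" by (rule fun_cong[OF e, symmetric])
qed

lemma jac_scale: "z \<in> overlap U \<phi> i j \<Longrightarrow> jac U \<phi> i j z (c *s v) = c *s jac U \<phi> i j z v"
  by (simp add: chg_has_derivative(2) hol_linear[OF hol_chg] vec_eq_iff)

lemma jac_sum:
  assumes "z \<in> overlap U \<phi> i j"
  shows "jac U \<phi> i j z (\<Sum>p\<in>P. c p *s u p) = (\<Sum>p\<in>P. c p *s jac U \<phi> i j z (u p))"
proof -
  have l: "linear (jac U \<phi> i j z)"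
    by (rule has_derivative_linear[OF chg_has_derivative(1)[OF assms]])
  show ?thesis unfolding linear_sum[OF l] by (simp add: jac_scale[OF assms])
qed

text \<open>The chain rule for the two mutually inverse changes of charts; their composition is the
  identity near z because the overlap is open.\<close>

lemma jac_inverse:
  assumes z: "z \<in> overlap U \<phi> i j"
  shows "jac U \<phi> j i (chg U \<phi> i j z) (jac U \<phi> i j z v) = v"
proof -
  have "((\<lambda>y. chg U \<phi> j i (chg U \<phi> i j y)) has_derivative (\<lambda>v. jac U \<phi> j i (chg U \<phi> i j z) (jac U \<phi> i j z v))) (at z)"
    by (rule has_derivative_compose[OF chg_has_derivative(1)[OF z] chg_has_derivative(1)[OF chg_overlap[OF z]]])
  then have "((\<lambda>y. y) has_derivative (\<lambda>v. jac U \<phi> j i (chg U \<phi> i j z) (jac U \<phi> i j z v))) (at z)"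
    by (rule has_derivative_transform_within_open[OF _ open_overlap z chg_chg])
  from has_derivative_unique[OF this has_derivative_ident] show ?thesis by (rule fun_cong)
qed

section \<open>From the manifold to the frame at a point, and gluing\<close>

lemma frame_at:
  assumes z: "z \<in> cdom U \<phi> i"
  shows "frame_at m r (\<omega>E i z) (\<omega>H i z) (\<lambda>a j. \<theta> i a j z) (\<lambda>a j. X i a j z)"
proof
  show "alt_form 1 (\<theta> i a j z)" if "a < r" "j \<le> m" for a j
    using sold that z unfolding soldering_def hol_form_def by blast
  show "\<theta> i a j z [X i b k z] = (if a = b \<and> j = k then 1 else 0)" if "a < r" "j \<le> m" "b < r" "k \<le> m" for a j b k
    using sold that z unfolding soldering_def by blast
  show "(\<Sum>a<r. \<Sum>j\<le>m. \<theta> i a j z [v] *s X i a j z) = v" for v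
    using sold z unfolding soldering_def by blast
  show "symplectic_mat r (\<omega>E i z)" using form_E z unfolding symplectic_form_def by blast
  show "symplectic_mat 2 (\<omega>H i z)" using form_H z unfolding symplectic_form_def by blast
  show "odd m" by (rule odd)
qed

lemma theta_hol_form: "a < r \<Longrightarrow> j \<le> m \<Longrightarrow> hol_form 1 (cdom U \<phi> i) (\<theta> i a j)"
  using sold unfolding soldering_def by blast

lemma omegaE_hol: "a < r \<Longrightarrow> b < r \<Longrightarrow> hol (cdom U \<phi> i) (\<lambda>z. \<omega>E i z a b)"
  using form_E unfolding symplectic_form_def by blast

lemma omegaH_hol: "a < 2 \<Longrightarrow> b < 2 \<Longrightarrow> hol (cdom U \<phi> i) (\<lambda>z. \<omega>H i z a b)"
  using form_H unfolding symplectic_form_def by blast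

lemma omega_pow_hol:
  assumes "j \<le> m" "k \<le> m" shows "hol (cdom U \<phi> i) (\<lambda>z. omega_pow m (\<omega>H i z) j k)"
  unfolding omega_pow_def
proof (intro hol_sum hol_prod omegaH_hol)
  fix \<sigma> \<tau> :: "nat \<Rightarrow> nat" and l assume "\<sigma> \<in> {\<sigma>. \<sigma> permutes {..<m}}" "\<tau> \<in> {\<sigma>. \<sigma> permutes {..<m}}" "l \<in> {..<m}"
  then have "\<sigma> l < m" "\<tau> l < m" using permutes_in_image[of \<sigma> "{..<m}" l] permutes_in_image[of \<tau> "{..<m}" l] by auto
  then show "word m j ! \<sigma> l < 2" "word m k ! \<tau> l < 2" using word_lt2 assms by auto
qed

abbreviation G where "G \<equiv> gr_metric m r \<omega>E \<omega>H \<theta>"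
abbreviation Om where "Om \<equiv> gr_form m r \<omega>E \<omega>H \<theta>"

lemma G_at: "G i z = metric_at m r (\<omega>E i z) (omega_pow m (\<omega>H i z)) (\<lambda>a j. \<theta> i a j z)"
  by (intro ext) (rule gr_metric_at)

lemma Om_at: "Om i z = form_at m r (\<omega>E i z) (omega_pow m (\<omega>H i z)) (\<lambda>a j. \<theta> i a j z)"
  by (intro ext) (rule gr_form_at)

lemma G_hol: "hol (cdom U \<phi> i) (\<lambda>z. G i z u v)"
  unfolding gr_metric_def
  by (intro hol_sum hol_mult omegaE_hol omega_pow_hol hol_form_hol[OF theta_hol_form]) auto

lemma Om_hol: "hol (cdom U \<phi> i) (\<lambda>z. Om i z xs)"
  unfolding gr_form_def
  by (intro hol_sum hol_mult omegaE_hol omega_pow_hol hol_wedge hol_form_hol[OF theta_hol_form]) auto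

lemma Om_hol_form: "hol_form 4 (cdom U \<phi> i) (Om i)"
  unfolding hol_form_def using Om_hol frame_at.alt_form_Omega[OF frame_at] by (simp add: Om_at)

text \<open>The right-hand sides are the coefficients of a vector with the same image as \<open>v\<close> under the
  Jacobian, which is injective.\<close>

lemma theta_transform:
  assumes z: "z \<in> overlap U \<phi> i j" and a: "a < r" "A \<le> m"
  shows "\<theta> i a A z [v] = (\<Sum>b<r. \<Sum>B\<le>m. dual_cocycle U \<phi> tE i j z a b * sym_pow m (dual_cocycle U \<phi> tH i j z) A B *
      \<theta> j b B (chg U \<phi> i j z) [jac U \<phi> i j z v])"
proof -
  let ?z' = "chg U \<phi> i j z" and ?J = "jac U \<phi> i j z"
  let ?s = "dual_cocycle U \<phi> tE i j z" and ?S = "sym_pow m (dual_cocycle U \<phi> tH i j z)"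
  define c where "c a A = (\<Sum>b<r. \<Sum>B\<le>m. ?s a b * ?S A B * \<theta> j b B ?z' [?J v])" for a A
  interpret i: frame_at m r "\<omega>E i z" "\<omega>H i z" "\<lambda>a j. \<theta> i a j z" "\<lambda>a j. X i a j z"
    by (rule frame_at[OF overlap_cdom[OF z]])
  interpret j: frame_at m r "\<omega>E j ?z'" "\<omega>H j ?z'" "\<lambda>a k. \<theta> j a k ?z'" "\<lambda>a k. X j a k ?z'"
    by (rule frame_at[OF overlap_cdom[OF chg_overlap[OF z]]])
  have X: "X j b B ?z' = (\<Sum>a<r. \<Sum>A\<le>m. (?s a b * ?S A B) *s ?J (X i a A z))" if "b < r" "B \<le> m" for b B
    using sold z that unfolding soldering_def by blast
  let ?w = "\<Sum>p\<in>i.idx. c (fst p) (snd p) *s X i (fst p) (snd p) z"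
  have "?J ?w = (\<Sum>a<r. \<Sum>A\<le>m. c a A *s ?J (X i a A z))"
    unfolding jac_sum[OF z] i.idx_def by (simp add: sum.cartesian_product case_prod_unfold)
  also have "\<dots> = (\<Sum>a<r. \<Sum>A\<le>m. \<Sum>b<r. \<Sum>B\<le>m. (?s a b * ?S A B * \<theta> j b B ?z' [?J v]) *s ?J (X i a A z))"
    unfolding c_def by (simp only: vec.scale_sum_left)
  also have "\<dots> = (\<Sum>b<r. \<Sum>B\<le>m. \<Sum>a<r. \<Sum>A\<le>m. (?s a b * ?S A B * \<theta> j b B ?z' [?J v]) *s ?J (X i a A z))"
    by (rule sum_swap2)
  also have "\<dots> = (\<Sum>b<r. \<Sum>B\<le>m. \<theta> j b B ?z' [?J v] *s X j b B ?z')"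
    by (intro sum.cong refl) (simp add: X vec.scale_sum_right mult_ac)
  also have "\<dots> = ?J v" by (rule j.frame)
  finally have "?J ?w = ?J v" .
  from arg_cong[OF this, of "jac U \<phi> j i ?z'"] have "?w = v" unfolding jac_inverse[OF z] .
  then have "v = (\<Sum>a<r. \<Sum>A\<le>m. c a A *s X i a A z)"
    unfolding i.idx_def by (simp add: sum.cartesian_product case_prod_unfold)
  then have "\<theta> i a A z [v] = c a A" using i.theta_combination[OF a, of c] by simp
  then show ?thesis unfolding c_def .
qed

lemma omegaE_transform:
  assumes "z \<in> overlap U \<phi> i j" "b < r" "b' < r"
  shows "\<omega>E j (chg U \<phi> i j z) b b' = (\<Sum>a<r. \<Sum>a'<r. dual_cocycle U \<phi> tE i j z a b * dual_cocycle U \<phi> tE i j z a' b' * \<omega>E i z a a')"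
  using form_E assms unfolding symplectic_form_def by blast

lemma omega_pow_transform:
  assumes z: "z \<in> overlap U \<phi> i j" and B: "B \<le> m" "B' \<le> m"
  shows "omega_pow m (\<omega>H j (chg U \<phi> i j z)) B B' = (\<Sum>A\<le>m. \<Sum>A'\<le>m. sym_pow m (dual_cocycle U \<phi> tH i j z) A B *
     sym_pow m (dual_cocycle U \<phi> tH i j z) A' B' * omega_pow m (\<omega>H i z) A A')"
  unfolding sym_pow_transform[OF B]
proof (rule omega_pow_cong[OF _ B])
  show "\<omega>H j (chg U \<phi> i j z) a b = (\<Sum>c<2. \<Sum>d<2. dual_cocycle U \<phi> tH i j z c a * dual_cocycle U \<phi> tH i j z d b * \<omega>H i z c d)"
    if "a < 2" "b < 2" for a b
    using form_H z that unfolding symplectic_form_def by blast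
qed

lemma hol_metric_G: "hol_metric U \<phi> G"
  unfolding hol_metric_def
proof (intro conjI allI ballI)
  fix i z assume z: "z \<in> cdom U \<phi> i"
  interpret frame_at m r "\<omega>E i z" "\<omega>H i z" "\<lambda>a j. \<theta> i a j z" "\<lambda>a j. X i a j z" by (rule frame_at[OF z])
  show "G i z (c *s u + v) w = c * G i z u w + G i z v w" for c u v w unfolding G_at by (rule g_linear)
  show "G i z u v = G i z v u" for u v unfolding G_at by (rule g_sym)
  show "(\<forall>v. G i z u v = 0) \<longrightarrow> u = 0" for u unfolding G_at using g_nondegenerate by blast
next
  show "hol (cdom U \<phi> i) (\<lambda>z. G i z u v)" for i u v by (rule G_hol)
next
  fix i j z u v assume z: "z \<in> overlap U \<phi> i j"
  show "G i z u v = G j (chg U \<phi> i j z) (jac U \<phi> i j z u) (jac U \<phi> i j z v)"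
    unfolding G_at
    by (rule metric_at_transform[where s = "dual_cocycle U \<phi> tE i j z" and S = "sym_pow m (dual_cocycle U \<phi> tH i j z)"])
       (simp_all only: omegaE_transform[OF z] omega_pow_transform[OF z] theta_transform[OF z])
qed

lemma global_form_Om: "global_form U \<phi> 4 Om"
  unfolding global_form_def
proof (intro conjI allI ballI)
  show "hol_form 4 (cdom U \<phi> i) (Om i)" for i by (rule Om_hol_form)
next
  fix i j z and xs :: "(complex^'n) list" assume z: "z \<in> overlap U \<phi> i j"
  \<comment> \<open>The identity map is displayed so that the two sides match the maps L and L' of
    \<open>form_at_transform\<close>.\<close>
  have "Om i z (map (\<lambda>x. x) xs) = Om j (chg U \<phi> i j z) (map (jac U \<phi> i j z) xs)"
    unfolding Om_at
    by (rule form_at_transform[where s = "dual_cocycle U \<phi> tE i j z" and S = "sym_pow m (dual_cocycle U \<phi> tH i j z)"])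
       (simp_all only: omegaE_transform[OF z] omega_pow_transform[OF z] theta_transform[OF z])
  then show "Om i z xs = Om j (chg U \<phi> i j z) (map (jac U \<phi> i j z) xs)" by simp
qed

section \<open>Invariance under the symplectic groups\<close>

lemma theta_gr_act:
  assumes z: "z \<in> cdom U \<phi> i" and b: "b < r" "k \<le> m"
  shows "\<theta> i b k z [gr_act m r X \<theta> S T i z v] = (\<Sum>a<r. \<Sum>j\<le>m. S b a * sym_pow m T k j * \<theta> i a j z [v])"
proof -
  interpret frame_at m r "\<omega>E i z" "\<omega>H i z" "\<lambda>a j. \<theta> i a j z" "\<lambda>a j. X i a j z" by (rule frame_at[OF z])
  let ?t = "\<lambda>a b j k. (S b a * sym_pow m T k j * \<theta> i a j z [v]) *s X i b k z"
  have "gr_act m r X \<theta> S T i z v = (\<Sum>b<r. \<Sum>a<r. \<Sum>j\<le>m. \<Sum>k\<le>m. ?t a b j k)"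
    unfolding gr_act_def by (rule sum.swap)
  also have "\<dots> = (\<Sum>b<r. \<Sum>a<r. \<Sum>k\<le>m. \<Sum>j\<le>m. ?t a b j k)"
    by (rule sum.cong[OF refl], rule sum.cong[OF refl], rule sum.swap)
  also have "\<dots> = (\<Sum>b<r. \<Sum>k\<le>m. \<Sum>a<r. \<Sum>j\<le>m. ?t a b j k)"
    by (rule sum.cong[OF refl], rule sum.swap)
  also have "\<dots> = (\<Sum>b<r. \<Sum>k\<le>m. (\<Sum>a<r. \<Sum>j\<le>m. S b a * sym_pow m T k j * \<theta> i a j z [v]) *s X i b k z)"
    by (simp only: vec.scale_sum_left)
  finally show ?thesis
    using theta_combination[OF b, of "\<lambda>b k. \<Sum>a<r. \<Sum>j\<le>m. S b a * sym_pow m T k j * \<theta> i a j z [v]"] by simp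
qed

lemma omega_pow_sp:
  assumes "sp_mat 2 (\<omega>H i z) T" "B \<le> m" "B' \<le> m"
  shows "omega_pow m (\<omega>H i z) B B' = (\<Sum>A\<le>m. \<Sum>A'\<le>m. sym_pow m T A B * sym_pow m T A' B' * omega_pow m (\<omega>H i z) A A')"
  unfolding sym_pow_transform[OF assms(2,3)]
proof (rule omega_pow_cong[OF _ assms(2,3)])
  show "\<omega>H i z a b = (\<Sum>c<2. \<Sum>d<2. T c a * T d b * \<omega>H i z c d)" if "a < 2" "b < 2" for a b
    using assms(1) that unfolding sp_mat_def by simp
qed

lemma omegaE_sp:
  assumes "sp_mat r (\<omega>E i z) S" "b < r" "b' < r"
  shows "\<omega>E i z b b' = (\<Sum>a<r. \<Sum>a'<r. S a b * S a' b' * \<omega>E i z a a')"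
  using assms unfolding sp_mat_def by simp

lemma sp_invariant_metric_G: "sp_invariant_metric U \<phi> m r \<omega>E \<omega>H X \<theta> G"
  unfolding sp_invariant_metric_def
proof (intro allI ballI impI)
  fix i z S T u v assume z: "z \<in> cdom U \<phi> i" and sp: "sp_mat r (\<omega>E i z) S \<and> sp_mat 2 (\<omega>H i z) T"
  show "G i z (gr_act m r X \<theta> S T i z u) (gr_act m r X \<theta> S T i z v) = G i z u v"
    unfolding G_at
    by (rule metric_at_transform[where s = S and S = "sym_pow m T"])
       (fact omegaE_sp[OF conjunct1[OF sp]], fact omega_pow_sp[OF conjunct2[OF sp]], simp_all only: theta_gr_act[OF z])
qed

lemma sp_invariant_form_Om: "sp_invariant_form U \<phi> m r \<omega>E \<omega>H X \<theta> Om"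
  unfolding sp_invariant_form_def
proof (intro allI ballI impI)
  fix i z S T and xs :: "(complex^'n) list" assume z: "z \<in> cdom U \<phi> i" and sp: "sp_mat r (\<omega>E i z) S \<and> sp_mat 2 (\<omega>H i z) T"
  have "Om i z (map (gr_act m r X \<theta> S T i z) xs) = Om i z (map (\<lambda>x. x) xs)"
    unfolding Om_at
    by (rule form_at_transform[where s = S and S = "sym_pow m T"])
       (fact omegaE_sp[OF conjunct1[OF sp]], fact omega_pow_sp[OF conjunct2[OF sp]], simp_all only: theta_gr_act[OF z])
  then show "Om i z (map (gr_act m r X \<theta> S T i z) xs) = Om i z xs" by simp
qed

lemma Om_nonzero: "z \<in> cdom U \<phi> i \<Longrightarrow> Om i z \<noteq> (\<lambda>_. 0)"
  unfolding Om_at by (rule frame_at.Omega_nonzero[OF frame_at])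

section \<open>Curvature, self-duality and the Yang-Mills equation\<close>

lemma frame_volume:
  assumes V: "unit_volume U \<phi> G i V vol" and z: "z \<in> V"
  shows "frame_volume m r (\<omega>E i z) (\<omega>H i z) (\<lambda>a j. \<theta> i a j z) (\<lambda>a j. X i a j z) (vol z)"
proof -
  have zc: "z \<in> cdom U \<phi> i" using V z unfolding unit_volume_def by blast
  interpret frame_at m r "\<omega>E i z" "\<omega>H i z" "\<lambda>a j. \<theta> i a j z" "\<lambda>a j. X i a j z" by (rule frame_at[OF zc])
  show ?thesis
  proof
    show "alt_form CARD('n) (vol z)" using V z unfolding unit_volume_def hol_form_def by blast
    show "(vol z (map (\<lambda>s. axis s 1) I))\<^sup>2 = det (gram (metric_at m r (\<omega>E i z) (omega_pow m (\<omega>H i z)) (\<lambda>a j. \<theta> i a j z)))"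
      if "distinct I" "set I = UNIV" for I
      using V z that unfolding unit_volume_def G_at by blast
  qed
qed

text \<open>For odd m the bound 2 k is m - 1, so all components but the one of degree m vanish. The
  latter has a scalar in the symmetric power of degree 0, so it is that scalar times
  \<open>omega_pow\<close>; being of odd degree it is symmetric in the E indices.\<close>

lemma partially_flat_curvature:
  assumes "partially_flat U \<phi> m r \<omega>H X ((m - 1) div 2) w A" "z \<in> cdom U \<phi> i" "s < w" "t < w"
  obtains q where "\<And>a b. a < r \<Longrightarrow> b < r \<Longrightarrow> q b a = q a b"
    "\<And>a j b k. a < r \<Longrightarrow> j \<le> m \<Longrightarrow> b < r \<Longrightarrow> k \<le> m \<Longrightarrow>
       curvature w A i s t z [X i a j z, X i b k z] = q a b * omega_pow m (\<omega>H i z) j k"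
proof -
  obtain q where q: "curv_components m r w (\<omega>H i z) (\<lambda>a j. X i a j z) (\<lambda>s t. curvature w A i s t z) q"
    and q0: "\<forall>l\<le>m. l \<le> 2 * ((m - 1) div 2) \<longrightarrow> (\<forall>s<w. \<forall>t<w. \<forall>a<r. \<forall>b<r. \<forall>n\<le>2 * m - 2 * l. q l s t a b n = 0)"
    using assms(1,2) unfolding partially_flat_def by blast
  have m2: "2 * ((m - 1) div 2) = m - 1" using odd by (auto elim: oddE)
  have sym: "q l s t b a n = (if even l then - q l s t a b n else q l s t a b n)"
    if "a < r" "b < r" "l \<le> m" "n \<le> 2 * m - 2 * l" for a b l n
    using q assms(3,4) that unfolding curv_components_def by blast
  have F: "curvature w A i s t z [X i a j z, X i b k z] = (\<Sum>l\<le>m. omega_mult m l (\<omega>H i z) (q l s t a b) j k)"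
    if "a < r" "b < r" "j \<le> m" "k \<le> m" for a b j k
    using q assms(3,4) that unfolding curv_components_def by blast
  have low: "omega_mult m l (\<omega>H i z) (q l s t a b) j k = 0" if "a < r" "b < r" "j \<le> m" "k \<le> m" "l < m" for a b j k l
  proof -
    \<comment> \<open>The components are only known to vanish up to the argument 2 m - 2 l. The
      argument counts ones among the 2 (m - l) letters left after l contractions, so it stays in
      that range.\<close>
    have "q l s t a b (\<Sum>n=l..<m. word m j ! \<sigma> n + word m k ! \<tau> n) = 0"
      if \<sigma>: "\<sigma> permutes {..<m}" and \<tau>: "\<tau> permutes {..<m}" for \<sigma> \<tau>
    proof -
      have "(\<Sum>n=l..<m. word m j ! \<sigma> n + word m k ! \<tau> n) \<le> (\<Sum>n=l..<m. 2)"
      proof (rule sum_mono)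
        fix n assume "n \<in> {l..<m}"
        then have "\<sigma> n < m" "\<tau> n < m" using permutes_in_image[OF \<sigma>, of n] permutes_in_image[OF \<tau>, of n] by auto
        then show "word m j ! \<sigma> n + word m k ! \<tau> n \<le> 2"
          using word_lt2[OF \<open>j \<le> m\<close>, of "\<sigma> n"] word_lt2[OF \<open>k \<le> m\<close>, of "\<tau> n"] by linarith
      qed
      then have "(\<Sum>n=l..<m. word m j ! \<sigma> n + word m k ! \<tau> n) \<le> 2 * m - 2 * l" by (simp add: diff_mult_distrib)
      moreover have "l \<le> m" "l \<le> 2 * ((m - 1) div 2)" unfolding m2 using \<open>l < m\<close> by auto
      ultimately show ?thesis using q0 assms(3,4) \<open>a < r\<close> \<open>b < r\<close> by blast
    qed
    then show ?thesis unfolding omega_mult_def by (intro sum.neutral ballI) simp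
  qed
  have top: "omega_mult m m (\<omega>H i z) (q m s t a b) j k = q m s t a b 0 * omega_pow m (\<omega>H i z) j k" for a b j k
    unfolding omega_mult_def omega_pow_def by (simp add: sum_distrib_left mult.commute)
  show ?thesis
  proof (rule that[of "\<lambda>a b. q m s t a b 0"])
    show "q m s t b a 0 = q m s t a b 0" if "a < r" "b < r" for a b
      using sym[OF that order_refl, of 0] odd by simp
    show "curvature w A i s t z [X i a j z, X i b k z] = q m s t a b 0 * omega_pow m (\<omega>H i z) j k"
      if "a < r" "j \<le> m" "b < r" "k \<le> m" for a j b k
    proof -
      have "(\<Sum>l\<le>m. omega_mult m l (\<omega>H i z) (q l s t a b) j k) =
        (\<Sum>l<m. omega_mult m l (\<omega>H i z) (q l s t a b) j k) + omega_mult m m (\<omega>H i z) (q m s t a b) j k"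
        by (simp only: lessThan_Suc_atMost[symmetric] sum.lessThan_Suc)
      also have "(\<Sum>l<m. omega_mult m l (\<omega>H i z) (q l s t a b) j k) = 0"
        by (rule sum.neutral) (use low that in simp)
      finally show ?thesis unfolding F[OF that(1,3,2,4)] top by simp
    qed
  qed
qed

abbreviation \<mu> :: complex where "\<mu> \<equiv> - 4 * (of_nat m + 2)"

lemma mu_nonzero: "\<mu> \<noteq> 0"
  by (simp add: complex_eq_iff)

lemma self_dual_yang_mills:
  assumes closed: "co_closed U \<phi> G 4 Om"
    and conn: "connection U \<phi> w tW A"
    and flat: "partially_flat U \<phi> m r \<omega>H X ((m - 1) div 2) w A"
  shows "self_dual U \<phi> G Om \<mu> w A" and "yang_mills U \<phi> G w A"
proof -
  have A: "hol_form 1 (cdom U \<phi> i) (A i a b)" if "a < w" "b < w" for i a b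
    using conn that unfolding connection_def by blast
  have F: "hol_form 2 (cdom U \<phi> i) (curvature w A i s t)" if "s < w" "t < w" for i s t
    by (rule hol_form_curvature[where A = A and i = i, OF open_cdom _ that]) (rule A)
  have cl: "ext_d (CARD('n) - 4) (\<lambda>y. hodge (G i y) (vol y) 4 (Om i y)) z xs = 0"
    if "unit_volume U \<phi> G i V vol" "z \<in> V" for i V vol z xs
    using closed that unfolding co_closed_def by blast
  have zc: "z \<in> cdom U \<phi> i" if "unit_volume U \<phi> G i V vol" "z \<in> V" for i V vol z
    using that unfolding unit_volume_def by blast
  \<comment> \<open>Both identities follow from the same description of the curvature at a point:
    \<open>eig\<close> yields self-duality, while \<open>star\<close>, divided by the eigenvalue,
    expresses the Hodge dual of the curvature for the Yang-Mills equation.\<close>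
  have eig: "B_op (G i z) (vol z) (Om i z) (curvature w A i s t z) xs = \<mu> * curvature w A i s t z xs"
    and star: "wedge (CARD('n) - 4) 2 (hodge (G i z) (vol z) 4 (Om i z)) (curvature w A i s t z) xs = \<mu> * hodge (G i z) (vol z) 2 (curvature w A i s t z) xs"
    if V: "unit_volume U \<phi> G i V vol" and z: "z \<in> V" and st: "s < w" "t < w" for i V vol z s t xs
  proof -
    interpret frame_volume m r "\<omega>E i z" "\<omega>H i z" "\<lambda>a j. \<theta> i a j z" "\<lambda>a j. X i a j z" "vol z"
      by (rule frame_volume[OF V z])
    obtain q where q: "\<And>a b. a < r \<Longrightarrow> b < r \<Longrightarrow> q b a = q a b"
      "\<And>a j b k. a < r \<Longrightarrow> j \<le> m \<Longrightarrow> b < r \<Longrightarrow> k \<le> m \<Longrightarrow>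
        curvature w A i s t z [X i a j z, X i b k z] = q a b * omega_pow m (\<omega>H i z) j k"
      by (rule partially_flat_curvature[OF flat zc[OF V z] st]) (rule that)
    have a: "alt_form 2 (curvature w A i s t z)" by (rule hol_form_alt[OF F[OF st] zc[OF V z]])
    show "B_op (G i z) (vol z) (Om i z) (curvature w A i s t z) xs = \<mu> * curvature w A i s t z xs"
      unfolding G_at Om_at
      by (rule fun_cong[OF B_op_eigenform[where q = q]]) (rule a, erule (1) q(1), rule q(2), assumption+)
    show "wedge (CARD('n) - 4) 2 (hodge (G i z) (vol z) 4 (Om i z)) (curvature w A i s t z) xs = \<mu> * hodge (G i z) (vol z) 2 (curvature w A i s t z) xs"
      unfolding G_at Om_at
      by (rule wedge_star_Omega[where q = q]) (rule a, erule (1) q(1), rule q(2), assumption+)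
  qed
  show "self_dual U \<phi> G Om \<mu> w A"
    unfolding self_dual_def B_eigenvalue_def
  proof (intro conjI allI impI ballI)
    show "\<mu> \<noteq> 0" by (rule mu_nonzero)
  next
    fix i V vol z assume V: "unit_volume U \<phi> G i V vol" and z: "z \<in> V"
    interpret frame_volume m r "\<omega>E i z" "\<omega>H i z" "\<lambda>a j. \<theta> i a j z" "\<lambda>a j. X i a j z" "vol z"
      by (rule frame_volume[OF V z])
    obtain \<beta> where b: "alt_form 2 \<beta>" "\<beta> \<noteq> (\<lambda>_. 0)"
      "\<And>a A b B. a < r \<Longrightarrow> A \<le> m \<Longrightarrow> b < r \<Longrightarrow> B \<le> m \<Longrightarrow> \<beta> [X i a A z, X i b B z] = (if a = 0 \<and> b = 0 then 1 else 0) * f A B"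
      by (rule exists_eigenform) (rule that)
    have "B_op (G i z) (vol z) (Om i z) \<beta> = (\<lambda>xs. \<mu> * \<beta> xs)"
      unfolding G_at Om_at
      by (rule B_op_eigenform[where q = "\<lambda>a b. if a = 0 \<and> b = 0 then 1 else 0"]) (rule b(1), simp, rule b(3), assumption+)
    then show "\<exists>\<beta>. alt_form 2 \<beta> \<and> \<beta> \<noteq> (\<lambda>_. 0) \<and> B_op (G i z) (vol z) (Om i z) \<beta> = (\<lambda>xs. \<mu> * \<beta> xs)"
      by (intro exI[of _ \<beta>] conjI b(1,2))
  next
    fix i V vol z s t xs assume V: "unit_volume U \<phi> G i V vol" and z: "z \<in> V" and st: "s < w" "t < w"
    show "B_op (G i z) (vol z) (Om i z) (curvature w A i s t z) xs = \<mu> * curvature w A i s t z xs"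
      by (rule eig[OF V z st])
    have "ext_d (CARD('n) - 4) (\<lambda>y. hodge (G i y) (vol y) 4 (Om i y)) z = (\<lambda>xs. 0 * 0)"
      by (rule ext) (simp add: cl[OF V z])
    then show "wedge (Suc (CARD('n) - 4)) 2 (ext_d (CARD('n) - 4) (\<lambda>y. hodge (G i y) (vol y) 4 (Om i y)) z) (curvature w A i s t z) xs = 0"
      by (simp only: wedge_scale_left) simp
  qed
  show "yang_mills U \<phi> G w A"
    unfolding yang_mills_def
  proof (intro allI impI ballI)
    fix i V vol z s t xs assume V: "unit_volume U \<phi> G i V vol" and z: "z \<in> V" and st: "s < w" "t < w"
    let ?\<sigma> = "\<lambda>y. hodge (G i y) (vol y) 4 (Om i y)"
    interpret frame_volume m r "\<omega>E i z" "\<omega>H i z" "\<lambda>a j. \<theta> i a j z" "\<lambda>a j. X i a j z" "vol z"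
      by (rule frame_volume[OF V z])
    have oV: "open V" and Vc: "V \<subseteq> cdom U \<phi> i" and vol: "hol_form CARD('n) V vol"
      using V unfolding unit_volume_def by blast+
    have inv: "invertible (gram (G i y))" if "y \<in> V" for y
    proof -
      interpret y: frame_volume m r "\<omega>E i y" "\<omega>H i y" "\<lambda>a j. \<theta> i a j y" "\<lambda>a j. X i a j y" "vol y"
        by (rule frame_volume[OF V that])
      show ?thesis unfolding G_at by (rule y.invertible_gram)
    qed
    have gram: "hol V (\<lambda>y. gram (G i y) $ p $ q)" for p q
      unfolding gram_def using hol_subset[OF G_hol Vc] by simp
    have "hol_form (CARD('n) - 4) V ?\<sigma>"
      unfolding hol_form_def
    proof (intro conjI ballI allI)
      show "hol V (\<lambda>y. ?\<sigma> y xs)" for xs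
        by (intro hol_hodge hol_matrix_inv[OF oV gram inv] hol_form_hol[OF vol] hol_subset[OF Om_hol Vc])
      fix y assume y: "y \<in> V"
      interpret y: frame_volume m r "\<omega>E i y" "\<omega>H i y" "\<lambda>a j. \<theta> i a j y" "\<lambda>a j. X i a j y" "vol y"
        by (rule frame_volume[OF V y])
      show "alt_form (CARD('n) - 4) (?\<sigma> y)" unfolding G_at by (rule y.alt_form_hodge[OF dimension_ge_4])
    qed
    moreover have "even (CARD('n) - 4)" using dimension_even by simp
    moreover have "hodge (G i y) (vol y) 2 (curvature w A i a b y) = (\<lambda>xs. (1 / \<mu>) * wedge (CARD('n) - 4) 2 (?\<sigma> y) (curvature w A i a b y) xs)"
      if "a < w" "b < w" "y \<in> V" for a b y
      unfolding star[OF V that(3,1,2)] using mu_nonzero by simp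
    moreover have "hol_form 1 V (A i a b)" if "a < w" "b < w" for a b
      using A[OF that, of i] Vc hol_subset unfolding hol_form_def by blast
    ultimately have "cov_ext_d w A i (CARD('n) - 4 + 2) (\<lambda>a b y. hodge (G i y) (vol y) 2 (curvature w A i a b y)) s t z xs = 0"
      by (intro yang_mills_of_wedge[where \<sigma> = ?\<sigma> and S = V and ?c0.0 = "1 / \<mu>"] oV z cl[OF V z] st)
    \<comment> \<open>Subtraction is truncated, so matching the two degrees uses that the dimension
      is at least 4.\<close>
    moreover have "CARD('n) - 4 + 2 = CARD('n) - 2" using dimension_ge_4 by simp
    ultimately show "cov_ext_d w A i (CARD('n) - 2) (\<lambda>a b y. hodge (G i y) (vol y) 2 (curvature w A i a b y)) s t z xs = 0"
      by (simp only:)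
  qed
qed

end

theorem theorem6:
  fixes U :: "'i \<Rightarrow> 'a::{t2_space,second_countable_topology} set"
    and \<phi> :: "'i \<Rightarrow> 'a \<Rightarrow> complex^'n"
    and m r :: nat
    and tE tH :: "('i, 'n) cocycle"
    and CE CH :: "('i, 'n) mform"
    and \<omega>H \<omega>E :: "'i \<Rightarrow> complex^'n \<Rightarrow> cmat"
    and X :: "'i \<Rightarrow> nat \<Rightarrow> nat \<Rightarrow> complex^'n \<Rightarrow> complex^'n"
    and \<theta> :: "('i, 'n) mform"
  defines "g \<equiv> gr_metric m r \<omega>E \<omega>H \<theta>"
    and "\<Omega> \<equiv> gr_form m r \<omega>E \<omega>H \<theta>"
  assumes "spin_grassmann U \<phi> m r tE CE tH CH \<omega>H X \<theta>"
    and "half_flat U \<phi> m CH"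
    and "odd m"
    and "symplectic_form U \<phi> r (dual_cocycle U \<phi> tE) \<omega>E"
    and "parallel_form U \<phi> r (dual_conn CE) \<omega>E"
  shows "hol_metric U \<phi> g \<and> sp_invariant_metric U \<phi> m r \<omega>E \<omega>H X \<theta> g \<and>
    global_form U \<phi> 4 \<Omega> \<and> sp_invariant_form U \<phi> m r \<omega>E \<omega>H X \<theta> \<Omega> \<and>
    (\<forall>i. \<forall>z\<in>cdom U \<phi> i. \<Omega> i z \<noteq> (\<lambda>_. 0)) \<and>
    (co_closed U \<phi> g 4 \<Omega> \<longrightarrow>
      (\<forall>w tW A. vec_bundle U \<phi> w tW \<and> connection U \<phi> w tW A \<and>
         partially_flat U \<phi> m r \<omega>H X ((m - 1) div 2) w A \<longrightarrow>
         (\<exists>\<mu>. self_dual U \<phi> g \<Omega> \<mu> w A) \<and> yang_mills U \<phi> g w A))"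
proof -
  interpret symplectic_grassmann U \<phi> m r tE tH CE CH \<omega>H \<omega>E X \<theta>
    by standard fact+
  show ?thesis
    unfolding g_def \<Omega>_def
    using hol_metric_G sp_invariant_metric_G global_form_Om sp_invariant_form_Om Om_nonzero self_dual_yang_mills
    by blast
qed

end
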